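(* Assume: (A1) for each $j\in N$: (i) there exists $x^{s,*}_j$ with $f_j(x^{s,*}_j,0)=0$; (ii) for every constant $\bar\omega_j\in\mathbb{R}$, every compact invariant set of $\dot x^s_j=f_j(x^s_j,-\bar\omega_j)$ consists only of equilibrium points; (A2) there exists at least one bus $j\in N$ such that whenever $f_j(\bar x^s_j,-\bar\omega_j)=0$ for constants $\bar x^s_j,\bar\omega_j$, then $\bar\omega_j=0$. Let $x^*=(\eta^*,\omega^*,x^{s,*})$ be an equilibrium of $\dot x\in Q(x)$ (so $0_n\in Q(x^* )$; then $\omega^*=0$) such that (A3) for each $j\in N$, the system $\dot x^s_j=f_j(x^s_j,u)$, $s_j=g_j(x^s_j,u)$ (input $u=-\omega_j$) is locally input strictly passive around the input $u=0$ and the point $x^{s,*}_j$, with a storage function $V^S_j$ that has a strict local minimum at $x^{s,*}_j$; (A4) $|\eta^*_{ij}|<\pi/2$ for all $(i,j)\in E$. Then there exists an open neighborhood $\Xi$ of $x^*$ such that every Filippov solution $x=(\eta,\omega,x^s):[0,\infty)\to\mathbb{R}^n$ of $\dot x\in Q(x)$ with $x(0)\in\Xi$ converges to the set of equilibria of $\dot x\in Q(x)$; in particular $\omega(t)\to 0_{|N|}$.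
   Context: Network model. $(N,E)$ is a connected directed graph with $N=\{1,\dots,|N|\}$, $E\subseteq N\times N$, with arbitrary orientation: if $(i,j)\in E$ then $(j,i)\notin E$. For $j\in N$, "$i:i\to j$" ranges over $i$ with $(i,j)\in E$ and "$k:j\to k$" over $k$ with $(j,k)\in E$. Constants: $M_j>0$, $p^L_j\in\mathbb{R}$ ($j\in N$), $B_{ij}>0$ ($(i,j)\in E$). States: $\eta_{ij}\in\mathbb{R}$ for $(i,j)\in E$, $\omega_j\in\mathbb{R}$ and $x^s_j\in\mathbb{R}^{n_j}$ for $j\in N$; the full state is $x=(\eta,\omega,x^s)\in\mathbb{R}^n$, $n=|E|+|N|+\sum_j n_j$. The dynamics are $\dot\eta_{ij}=\omega_i-\omega_j$, $(i,j)\in E$; $M_j\dot\omega_j=-p^L_j+s_j-d^c_j-\sum_{k:j\to k}p_{jk}+\sum_{i:i\to j}p_{ij}$, $j\in N$; $p_{ij}=B_{ij}\sin\eta_{ij}$; $\dot x^s_j=f_j(x^s_j,-\omega_j)$, $s_j=g_j(x^s_j,-\omega_j)$, where $f_j:\mathbb{R}^{n_j}\times\mathbb{R}\to\mathbb{R}^{n_j}$ and $g_j:\mathbb{R}^{n_j}\times\mathbb{R}\to\mathbb{R}$ are globally Lipschitz. On-off loads. For each $j$, constants $-\infty<\underline d_j\le 0\le\overline d_j<\infty$ and $\underline\omega_j<0<\overline\omega_j$ are given, and $d^c_j=f^c_j(\omega_j)$ where $f^c_j(\omega)=\overline d_j$ if $\omega>\overline\omega_j$, $=0$ if $\underline\omega_j<\omega\le\overline\omega_j$,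 $=\underline d_j$ if $\omega\le\underline\omega_j$. Its Filippov set-valued map is $F[d^c_j](\omega)=[0,\overline d_j]$ if $\omega=\overline\omega_j$, $[\underline d_j,0]$ if $\omega=\underline\omega_j$, and $\{f^c_j(\omega)\}$ otherwise. The set-valued map $Q(x)$ has components: $\{\omega_i-\omega_j\}$ for each $(i,j)\in E$; $\{\frac1{M_j}(-p^L_j+s_j-v_j-\sum_{k:j\to k}p_{jk}+\sum_{i:i\to j}p_{ij}): v_j\in F[d^c_j](\omega_j)\}$ for each $j\in N$; $\{f_j(x^s_j,-\omega_j)\}$ for each $j\in N$. A Filippov solution on an interval $I$ is an absolutely continuous map $x$ with $\dot x(t)\in Q(x(t))$ for almost all $t\in I$. A point $x^*$ is an equilibrium if $0_n\in Q(x^* )$. Passivity. The system $\dot x^s_j=f_j(x^s_j,u)$, $s_j=g_j(x^s_j,u)$ is locally input strictly passive around the constant input $\bar u$ and point $\bar x^s_j$ if there exist open neighborhoods $\Omega_j$ of $\bar u$ and $X^s_j$ of $\bar x^s_j$, a continuously differentiable positive semidefinite function $V^S_j:\mathbb{R}^{n_j}\to\mathbb{R}$ (storage function) and a positive definite function $\phi_j:\mathbb{R}\to\mathbb{R}$ such that for all $u\in\Omega_j$ and $x^s_j\in X^s_j$: $\frac{\partial V^S_j}{\partial x^s_j}(x^s_j)\,f_j(x^s_j,u)\le (u-\bar u)(g_j(x^s_j,u)-\bar s_j)-\phi_j(u-\bar u)$, where $\bar s_j=g_j(\bar x^s_j,\bar u)$. *)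

theory Defs
  imports "HOL-Analysis.Analysis"
begin

section \<open>Conventions\<close>

text \<open>Buses are N = {1..nN}.  A state x = (eta, omega, xs) is a triple
  eta :: nat \<times> nat \<Rightarrow> real (only entries on edges (i,j) in E are meaningful),
  omega :: nat \<Rightarrow> real (only entries j in N meaningful),
  xs :: nat \<Rightarrow> nat \<Rightarrow> real, where xs j represents the vector x^s_j in R^(nd j)
  through its coordinates 0..nd j - 1 (the remaining coordinates are ignored).
  A vector of R^n (n = nd j) is encoded by a function nat \<Rightarrow> real vanishing from n on,
  i.e. an element of vspace n.\<close>

type_synonym state = "((nat \<times> nat) \<Rightarrow> real) \<times> (nat \<Rightarrow> real) \<times> (nat \<Rightarrow> nat \<Rightarrow> real)"

definition st_eta :: "state \<Rightarrow> (nat \<times> nat) \<Rightarrow> real" where "st_eta x = fst x"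
definition st_om :: "state \<Rightarrow> nat \<Rightarrow> real" where "st_om x = fst (snd x)"
definition st_xs :: "state \<Rightarrow> nat \<Rightarrow> nat \<Rightarrow> real" where "st_xs x = snd (snd x)"

definition buses :: "nat \<Rightarrow> nat set" where "buses nN = {1..nN}"

text \<open>R^n encoded inside nat \<Rightarrow> real.\<close>
definition vspace :: "nat \<Rightarrow> (nat \<Rightarrow> real) set" where
  "vspace n = {x. \<forall>k\<ge>n. x k = 0}"

definition trunc :: "nat \<Rightarrow> (nat \<Rightarrow> real) \<Rightarrow> (nat \<Rightarrow> real)" where
  "trunc n x = (\<lambda>k. if k < n then x k else 0)"

text \<open>Euclidean distance on R^n.\<close>
definition vdist :: "nat \<Rightarrow> (nat \<Rightarrow> real) \<Rightarrow> (nat \<Rightarrow> real) \<Rightarrow> real" where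
  "vdist n x y = sqrt (\<Sum>k<n. (x k - y k)^2)"

section \<open>Network\<close>

definition out_nb :: "(nat \<times> nat) set \<Rightarrow> nat \<Rightarrow> nat set" where
  "out_nb E j = {k. (j,k) \<in> E}"
definition in_nb :: "(nat \<times> nat) set \<Rightarrow> nat \<Rightarrow> nat set" where
  "in_nb E j = {i. (i,j) \<in> E}"

text \<open>Connected directed graph with arbitrary orientation (connected as an undirected graph).\<close>
definition network_graph :: "nat \<Rightarrow> (nat \<times> nat) set \<Rightarrow> bool" where
  "network_graph nN E \<longleftrightarrow>
     E \<subseteq> buses nN \<times> buses nN \<and>
     (\<forall>i j. (i,j) \<in> E \<longrightarrow> (j,i) \<notin> E) \<and>
     (\<forall>i\<in>buses nN. \<forall>j\<in>buses nN. (i,j) \<in> (E \<union> E\<inverse>)\<^sup>*)"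

text \<open>Global Lipschitz continuity of f_j : R^n \<times> R \<rightarrow> R^n and g_j : R^n \<times> R \<rightarrow> R.\<close>
definition lipschitz_f :: "nat \<Rightarrow> ((nat \<Rightarrow> real) \<Rightarrow> real \<Rightarrow> (nat \<Rightarrow> real)) \<Rightarrow> bool" where
  "lipschitz_f n F \<longleftrightarrow> (\<exists>L. \<forall>x\<in>vspace n. \<forall>y\<in>vspace n. \<forall>u v.
      vdist n (F x u) (F y v) \<le> L * sqrt ((vdist n x y)^2 + (u - v)^2))"

definition lipschitz_g :: "nat \<Rightarrow> ((nat \<Rightarrow> real) \<Rightarrow> real \<Rightarrow> real) \<Rightarrow> bool" where
  "lipschitz_g n G \<longleftrightarrow> (\<exists>L. \<forall>x\<in>vspace n. \<forall>y\<in>vspace n. \<forall>u v.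
      \<bar>G x u - G y v\<bar> \<le> L * sqrt ((vdist n x y)^2 + (u - v)^2))"

text \<open>On-off load f^c_j and its Filippov set-valued map F[d^c_j].\<close>
definition fc :: "real \<Rightarrow> real \<Rightarrow> real \<Rightarrow> real \<Rightarrow> real \<Rightarrow> real" where
  "fc dlo dhi wlo whi w =
     (if w > whi then dhi else if wlo < w then 0 else dlo)"

definition Fdc :: "real \<Rightarrow> real \<Rightarrow> real \<Rightarrow> real \<Rightarrow> real \<Rightarrow> real set" where
  "Fdc dlo dhi wlo whi w =
     (if w = whi then {0..dhi} else if w = wlo then {dlo..0} else {fc dlo dhi wlo whi w})"

text \<open>dx \<in> Q(x): the Filippov set-valued right-hand side.\<close>
definition inQ ::
  "nat \<Rightarrow> (nat \<times> nat) set \<Rightarrow> (nat \<Rightarrow> real) \<Rightarrow> (nat \<Rightarrow> real) \<Rightarrow> (nat \<Rightarrow> nat \<Rightarrow> real)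
   \<Rightarrow> (nat \<Rightarrow> real) \<Rightarrow> (nat \<Rightarrow> real) \<Rightarrow> (nat \<Rightarrow> real) \<Rightarrow> (nat \<Rightarrow> real) \<Rightarrow> (nat \<Rightarrow> nat)
   \<Rightarrow> (nat \<Rightarrow> (nat \<Rightarrow> real) \<Rightarrow> real \<Rightarrow> (nat \<Rightarrow> real))
   \<Rightarrow> (nat \<Rightarrow> (nat \<Rightarrow> real) \<Rightarrow> real \<Rightarrow> real) \<Rightarrow> state \<Rightarrow> state \<Rightarrow> bool" where
  "inQ nN E M pL B dlo dhi wlo whi nd f g x dx \<longleftrightarrow>
     (\<forall>(i,j)\<in>E. st_eta dx (i,j) = st_om x i - st_om x j) \<and>
     (\<forall>j\<in>buses nN. \<exists>v\<in>Fdc (dlo j) (dhi j) (wlo j) (whi j) (st_om x j).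
        st_om dx j = (1 / M j) * (- pL j + g j (trunc (nd j) (st_xs x j)) (- st_om x j) - v
            - (\<Sum>k\<in>out_nb E j. B j k * sin (st_eta x (j,k)))
            + (\<Sum>i\<in>in_nb E j. B i j * sin (st_eta x (i,j))))) \<and>
     (\<forall>j\<in>buses nN. \<forall>k<nd j.
        st_xs dx j k = f j (trunc (nd j) (st_xs x j)) (- st_om x j) k)"

definition zero_state :: state where "zero_state = ((\<lambda>_. 0), (\<lambda>_. 0), (\<lambda>_ _. 0))"

text \<open>Euclidean distance between the relevant coordinates of two states (norm of R^n).\<close>
definition sdist :: "nat \<Rightarrow> (nat \<times> nat) set \<Rightarrow> (nat \<Rightarrow> nat) \<Rightarrow> state \<Rightarrow> state \<Rightarrow> real" where
  "sdist nN E nd x y = sqrt (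
      (\<Sum>e\<in>E. (st_eta x e - st_eta y e)^2)
    + (\<Sum>j\<in>buses nN. (st_om x j - st_om y j)^2)
    + (\<Sum>j\<in>buses nN. \<Sum>k<nd j. (st_xs x j k - st_xs y j k)^2))"

definition setdist_st :: "nat \<Rightarrow> (nat \<times> nat) set \<Rightarrow> (nat \<Rightarrow> nat) \<Rightarrow> state \<Rightarrow> state set \<Rightarrow> real" where
  "setdist_st nN E nd x S = Inf {sdist nN E nd x y | y. y \<in> S}"

text \<open>Absolute continuity of a real function on [a,b].\<close>
definition abs_cont_on :: "real \<Rightarrow> real \<Rightarrow> (real \<Rightarrow> real) \<Rightarrow> bool" where
  "abs_cont_on a b h \<longleftrightarrow> (\<forall>\<epsilon>>0. \<exists>\<delta>>0. \<forall>(m::nat) (l::nat \<Rightarrow> real) (r::nat \<Rightarrow> real).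
      (\<forall>k<m. a \<le> l k \<and> l k \<le> r k \<and> r k \<le> b) \<and>
      (\<forall>k<m. \<forall>k'<m. k \<noteq> k' \<longrightarrow> r k \<le> l k' \<or> r k' \<le> l k) \<and>
      (\<Sum>k<m. r k - l k) < \<delta> \<longrightarrow> (\<Sum>k<m. \<bar>h (r k) - h (l k)\<bar>) < \<epsilon>)"

text \<open>A trajectory is absolutely continuous on [0,\<infinity>) (i.e. on every compact subinterval)
  in each coordinate of R^n.\<close>
definition traj_abs_cont :: "nat \<Rightarrow> (nat \<times> nat) set \<Rightarrow> (nat \<Rightarrow> nat) \<Rightarrow> (real \<Rightarrow> state) \<Rightarrow> bool" where
  "traj_abs_cont nN E nd x \<longleftrightarrow> (\<forall>T\<ge>0.
      (\<forall>e\<in>E. abs_cont_on 0 T (\<lambda>t. st_eta (x t) e)) \<and>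
      (\<forall>j\<in>buses nN. abs_cont_on 0 T (\<lambda>t. st_om (x t) j)) \<and>
      (\<forall>j\<in>buses nN. \<forall>k<nd j. abs_cont_on 0 T (\<lambda>t. st_xs (x t) j k)))"

text \<open>dx is the derivative of the trajectory x at time t (coordinatewise in R^n).\<close>
definition traj_deriv :: "nat \<Rightarrow> (nat \<times> nat) set \<Rightarrow> (nat \<Rightarrow> nat) \<Rightarrow> (real \<Rightarrow> state) \<Rightarrow> state \<Rightarrow> real \<Rightarrow> bool" where
  "traj_deriv nN E nd x dx t \<longleftrightarrow>
      (\<forall>e\<in>E. ((\<lambda>s. st_eta (x s) e) has_real_derivative st_eta dx e) (at t)) \<and>
      (\<forall>j\<in>buses nN. ((\<lambda>s. st_om (x s) j) has_real_derivative st_om dx j) (at t)) \<and>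
      (\<forall>j\<in>buses nN. \<forall>k<nd j. ((\<lambda>s. st_xs (x s) j k) has_real_derivative st_xs dx j k) (at t))"

section \<open>Subsystem notions (on R^n encoded as vspace n)\<close>

text \<open>Classical solution of x' = F(x) on the whole real line.\<close>
definition sub_solution :: "nat \<Rightarrow> ((nat \<Rightarrow> real) \<Rightarrow> (nat \<Rightarrow> real)) \<Rightarrow> (real \<Rightarrow> nat \<Rightarrow> real) \<Rightarrow> bool" where
  "sub_solution n F \<phi> \<longleftrightarrow> (\<forall>t. \<phi> t \<in> vspace n) \<and>
     (\<forall>t. \<forall>k<n. ((\<lambda>s. \<phi> s k) has_real_derivative F (\<phi> t) k) (at t))"

definition sub_invariant :: "nat \<Rightarrow> ((nat \<Rightarrow> real) \<Rightarrow> (nat \<Rightarrow> real)) \<Rightarrow> (nat \<Rightarrow> real) set \<Rightarrow> bool" where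
  "sub_invariant n F C \<longleftrightarrow> (\<forall>\<phi>. sub_solution n F \<phi> \<and> \<phi> 0 \<in> C \<longrightarrow> (\<forall>t. \<phi> t \<in> C))"

definition sub_equilibrium :: "nat \<Rightarrow> ((nat \<Rightarrow> real) \<Rightarrow> (nat \<Rightarrow> real)) \<Rightarrow> (nat \<Rightarrow> real) \<Rightarrow> bool" where
  "sub_equilibrium n F x \<longleftrightarrow> x \<in> vspace n \<and> (\<forall>k<n. F x k = 0)"

text \<open>V : R^n \<rightarrow> R continuously differentiable, with gradient G.\<close>
definition C1_with_grad :: "nat \<Rightarrow> ((nat \<Rightarrow> real) \<Rightarrow> real) \<Rightarrow> ((nat \<Rightarrow> real) \<Rightarrow> nat \<Rightarrow> real) \<Rightarrow> bool" where
  "C1_with_grad n V G \<longleftrightarrow>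
     (\<forall>x\<in>vspace n. \<forall>\<epsilon>>0. \<exists>\<delta>>0. \<forall>y\<in>vspace n. vdist n y x < \<delta> \<longrightarrow>
        \<bar>V y - V x - (\<Sum>k<n. G x k * (y k - x k))\<bar> \<le> \<epsilon> * vdist n y x) \<and>
     (\<forall>x\<in>vspace n. \<forall>\<epsilon>>0. \<exists>\<delta>>0. \<forall>y\<in>vspace n. vdist n y x < \<delta> \<longrightarrow>
        (\<forall>k<n. \<bar>G y k - G x k\<bar> < \<epsilon>))"

definition pos_def_fun :: "(real \<Rightarrow> real) \<Rightarrow> bool" where
  "pos_def_fun \<phi> \<longleftrightarrow> \<phi> 0 = 0 \<and> (\<forall>u. u \<noteq> 0 \<longrightarrow> \<phi> u > 0)"

text \<open>Local input strict passivity of x' = F(x,u), s = G(x,u) around input ub and point xb,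
  with storage function V (and its gradient DV).\<close>
definition loc_isp_with ::
  "nat \<Rightarrow> ((nat \<Rightarrow> real) \<Rightarrow> real \<Rightarrow> (nat \<Rightarrow> real)) \<Rightarrow> ((nat \<Rightarrow> real) \<Rightarrow> real \<Rightarrow> real)
   \<Rightarrow> real \<Rightarrow> (nat \<Rightarrow> real) \<Rightarrow> ((nat \<Rightarrow> real) \<Rightarrow> real) \<Rightarrow> ((nat \<Rightarrow> real) \<Rightarrow> nat \<Rightarrow> real) \<Rightarrow> bool" where
  "loc_isp_with n F Gs ub xb V DV \<longleftrightarrow>
     C1_with_grad n V DV \<and> (\<forall>x\<in>vspace n. V x \<ge> 0) \<and>
     (\<exists>\<Omega> X \<phi>. open \<Omega> \<and> ub \<in> \<Omega> \<and> open X \<and> xb \<in> X \<and> pos_def_fun \<phi> \<and>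
        (\<forall>u\<in>\<Omega>. \<forall>x\<in>X \<inter> vspace n.
           (\<Sum>k<n. DV x k * F x u k) \<le> (u - ub) * (Gs x u - Gs xb ub) - \<phi> (u - ub)))"

definition strict_local_min :: "nat \<Rightarrow> ((nat \<Rightarrow> real) \<Rightarrow> real) \<Rightarrow> (nat \<Rightarrow> real) \<Rightarrow> bool" where
  "strict_local_min n V xb \<longleftrightarrow> (\<exists>\<epsilon>>0. \<forall>x\<in>vspace n. 0 < vdist n x xb \<and> vdist n x xb < \<epsilon> \<longrightarrow> V x > V xb)"

end

theory Submission
  imports Defs
begin

text \<open>
  The energy function is the sum of the kinetic energies \<open>M\<^sub>j \<omega>\<^sub>j\<^sup>2 / 2\<close>, of the line potentials
  \<open>- B\<^sub>i\<^sub>j (cos \<eta>\<^sub>i\<^sub>j + sin \<eta>\<^sup>*\<^sub>i\<^sub>j \<eta>\<^sub>i\<^sub>j)\<close> and of the storage functions.  Along a Filippov solution the power flows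
  cancel and the on-off loads only dissipate, so the energy decreases at least at the rate of the
  passivity slack; as it has a strict local minimum at the equilibrium, solutions starting nearby stay
  in a compact box.  An absolutely continuous function with almost everywhere nonpositive derivative
  is nonincreasing (by a gauge argument), which makes this rigorous for the discontinuous right-hand side.

  No invariance principle for differential inclusions is needed.  Barbalat's argument applied to the
  energy gives \<open>\<omega> \<longlongrightarrow> 0\<close>; from some time on the frequencies are therefore inside the deadband, where
  the loads vanish, and Barbalat's argument applied to \<open>\<omega>\<close> itself shows that the power imbalances
  tend to 0.  The supply subsystems are then driven by inputs tending to 0, so their limit sets are
  invariant under \<open>f\<^sub>j(\<cdot>, 0)\<close> and consist of equilibria by (A1).  Hence every limit point of the
  trajectory is an equilibrium.
\<close>

section \<open>Absolutely continuous functions\<close>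

text \<open>The discontinuity sits in the frequency equations alone. The angle and supply equations
  have continuous right-hand sides, so they hold at every positive time; the frequencies keep an
  almost everywhere equation with some selection of the load. While a solution is in a box, all
  velocities are uniformly bounded whatever the selection, so coordinates and energy are Lipschitz
  in time: this yields the absolute continuity of the energy and the uniform continuity that
  Barbalat's argument requires. The load thresholds lie strictly on either side of 0, hence away
  from the limit of the frequencies, so settling \<open>\<omega>\<close> removes the discontinuity
  from the rest of the argument. The guaranteed loss of energy is strict only where some frequency
  is nonzero and says nothing about angles or supply states; these are reached through limit points,
  and the conclusion is convergence to a set. The type \<open>state\<close> carries meaningless
  entries, so compactness and continuity are phrased through the finitely many meaningful
  coordinates.\<close>

lemma abs_cont_on_division:
  assumes ac: "abs_cont_on a b h" and e: "0 < \<epsilon>"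
  obtains \<delta> where "0 < \<delta>"
    "\<And>D. D division_of \<Union>D \<Longrightarrow> \<Union>D \<subseteq> {a..b} \<Longrightarrow> measure lebesgue (\<Union>D) < \<delta>
      \<Longrightarrow> (\<Sum>K\<in>D. \<bar>h (Sup K) - h (Inf K)\<bar>) < \<epsilon>"
proof -
  obtain \<delta> where d: "\<delta> > 0" and dd0: "\<forall>(m::nat) l r.
      (\<forall>k<m. a \<le> l k \<and> l k \<le> r k \<and> r k \<le> b) \<and>
      (\<forall>k<m. \<forall>k'<m. k \<noteq> k' \<longrightarrow> r k \<le> l k' \<or> r k' \<le> l k) \<and>
      (\<Sum>k<m. r k - l k) < \<delta> \<longrightarrow> (\<Sum>k<m. \<bar>h (r k) - h (l k)\<bar>) < \<epsilon>"
    using ac[unfolded abs_cont_on_def, THEN spec, THEN mp, OF e] by (elim exE conjE)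
  note dd = dd0[THEN spec, THEN spec, THEN spec, THEN mp, OF conjI, OF _ conjI]
  show ?thesis
  proof
    show "\<delta> > 0" by fact
    fix D :: "real set set"
    assume D: "D division_of \<Union>D" and sub: "\<Union>D \<subseteq> {a..b}"
      and small: "measure lebesgue (\<Union>D) < \<delta>"
    \<comment> \<open>A division may contain one-point intervals, even strictly inside another
      member, because only interiors have to be disjoint. These could violate the separation
      condition of \<open>abs_cont_on\<close>; they contribute 0 to both sums and are
      dropped.\<close>
    define D' where "D' = {K\<in>D. Inf K < Sup K}"
    have finD: "finite D" using D by blast
    then have fin: "finite D'" by (simp add: D'_def)
    have rep: "K = {Inf K..Sup K} \<and> Inf K \<le> Sup K \<and> a \<le> Inf K \<and> Sup K \<le> b" if K: "K \<in> D" for K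
    proof -
      obtain u v where uv: "K = cbox u v" using division_ofD(4)[OF D K] by blast
      moreover have "K \<noteq> {}" using division_ofD(3)[OF D K] .
      moreover have "K \<subseteq> {a..b}" using sub K by blast
      ultimately show ?thesis by auto
    qed
    have disj: "Sup K \<le> Inf K' \<or> Sup K' \<le> Inf K" if "K \<in> D'" "K' \<in> D'" "K \<noteq> K'" for K K'
    proof (rule ccontr)
      assume "\<not> ?thesis"
      then have "max (Inf K) (Inf K') < min (Sup K) (Sup K')"
        using that by (auto simp: D'_def)
      then obtain z where z: "max (Inf K) (Inf K') < z" "z < min (Sup K) (Sup K')"
        using dense by blast
      have "interior K = {Inf K<..<Sup K}" "interior K' = {Inf K'<..<Sup K'}"
        using that rep by (metis (no_types, lifting) D'_def interior_atLeastAtMost_real mem_Collect_eq)+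
      then have "z \<in> interior K \<inter> interior K'" using z by auto
      then show False using division_ofD(5)[OF D, of K K'] that by (auto simp: D'_def)
    qed
    obtain q where q: "bij_betw q {..<card D'} D'"
      using ex_bij_betw_nat_finite[OF fin] by (auto simp: atLeast0LessThan)
    have qD: "q k \<in> D'" if "k < card D'" for k
      using q that by (auto simp: bij_betw_def)
    have "(\<Sum>k<card D'. Sup (q k) - Inf (q k)) = (\<Sum>K\<in>D'. Sup K - Inf K)"
      using sum.reindex_bij_betw[OF q, of "\<lambda>K. Sup K - Inf K"] .
    also have "\<dots> \<le> (\<Sum>K\<in>D. Sup K - Inf K)"
      by (rule sum_mono2) (use finD rep in \<open>auto simp: D'_def\<close>)
    also have "\<dots> = (\<Sum>K\<in>D. measure lebesgue K)"
    proof (rule sum.cong)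
      fix K assume "K \<in> D"
      from rep[OF this] show "Sup K - Inf K = measure lebesgue K"
        by (metis content_real measure_completion sets_lborel closed_real_atLeastAtMost borel_closed)
    qed simp
    also have "\<dots> = measure lebesgue (\<Union>D)" by (rule content_division[OF D])
    finally have "(\<Sum>k<card D'. Sup (q k) - Inf (q k)) < \<delta>" using small by simp
    then have "(\<Sum>k<card D'. \<bar>h (Sup (q k)) - h (Inf (q k))\<bar>) < \<epsilon>"
    proof (rule dd[rotated 2])
      show "\<forall>k<card D'. a \<le> Inf (q k) \<and> Inf (q k) \<le> Sup (q k) \<and> Sup (q k) \<le> b"
        using qD rep by (auto simp: D'_def)
      show "\<forall>k<card D'. \<forall>k'<card D'. k \<noteq> k' \<longrightarrow> Sup (q k) \<le> Inf (q k') \<or> Sup (q k') \<le> Inf (q k)"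
      proof (intro allI impI)
        fix k k' assume "k < card D'" "k' < card D'" "k \<noteq> k'"
        then have "q k \<noteq> q k'" using q by (auto simp: bij_betw_def inj_on_def)
        then show "Sup (q k) \<le> Inf (q k') \<or> Sup (q k') \<le> Inf (q k)"
          using disj qD \<open>k < card D'\<close> \<open>k' < card D'\<close> by blast
      qed
    qed
    also have "(\<Sum>k<card D'. \<bar>h (Sup (q k)) - h (Inf (q k))\<bar>) = (\<Sum>K\<in>D'. \<bar>h (Sup K) - h (Inf K)\<bar>)"
      using sum.reindex_bij_betw[OF q, of "\<lambda>K. \<bar>h (Sup K) - h (Inf K)\<bar>"] .
    also have "\<dots> = (\<Sum>K\<in>D. \<bar>h (Sup K) - h (Inf K)\<bar>)"
      by (rule sum.mono_neutral_left) (use finD rep in \<open>force simp: D'_def\<close>)+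
    finally show "(\<Sum>K\<in>D. \<bar>h (Sup K) - h (Inf K)\<bar>) < \<epsilon>" .
  qed
qed

text \<open>Straddle lemma: close to \<open>t\<close> the difference quotients on both sides exceed
  \<open>c\<close>, and the estimates over \<open>[l, t]\<close> and \<open>[t, u]\<close> add up.
  Both sides matter because the tag of a gauge-fine interval may lie anywhere in it.\<close>

lemma has_real_derivative_straddle:
  assumes d: "(h has_real_derivative d) (at t)" and c: "c < d"
  shows "\<exists>\<delta>>0. \<forall>l u. l \<le> t \<longrightarrow> t \<le> u \<longrightarrow> t - \<delta> < l \<longrightarrow> u < t + \<delta> \<longrightarrow> c * (u - l) \<le> h u - h l"
proof -
  have "((\<lambda>y. (h y - h t) / (y - t)) \<longlongrightarrow> d) (at t)"
    using d by (simp add: has_field_derivative_iff)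
  then have "eventually (\<lambda>y. c < (h y - h t) / (y - t)) (at t)"
    using c by (rule order_tendstoD)
  then obtain \<delta> where \<delta>: "\<delta> > 0"
    and *: "\<And>y. y \<noteq> t \<Longrightarrow> dist y t < \<delta> \<Longrightarrow> c < (h y - h t) / (y - t)"
    by (auto simp: eventually_at)
  have up: "c * (y - t) \<le> h y - h t" if "t \<le> y" "y < t + \<delta>" for y
    using *[of y] that by (cases "y = t") (auto simp: dist_real_def pos_less_divide_eq)
  have lo: "c * (t - y) \<le> h t - h y" if "y \<le> t" "t - \<delta> < y" for y
  proof (cases "y = t")
    case False
    then have "c < (h y - h t) / (y - t)" "y < t" using *[of y] that by (auto simp: dist_real_def)
    then have "h y - h t < c * (y - t)" by (simp add: neg_less_divide_eq)
    then show ?thesis by (simp add: algebra_simps)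
  qed auto
  have "c * (u - l) \<le> h u - h l" if "l \<le> t" "t \<le> u" "t - \<delta> < l" "u < t + \<delta>" for l u
    using up[of u] lo[of l] that by (simp add: algebra_simps)
  then show ?thesis using \<delta> by blast
qed

text \<open>Gauge argument. Intervals tagged outside \<open>S\<close> are made so short that the
  straddle estimate applies. Intervals tagged in \<open>S\<close> are forced into an open set of
  tiny measure, where absolute continuity makes the total increment of \<open>h\<close> small. The
  error \<open>\<epsilon>\<close> pays for the second kind only.\<close>

lemma abs_cont_on_growth_ge_almost:
  assumes ac: "abs_cont_on a b h" and ab: "a \<le> b" and neg: "negligible S"
    and der: "\<And>t. t \<in> {a..b} - S \<Longrightarrow> \<exists>d>c. (h has_real_derivative d) (at t)"
    and e: "0 < \<epsilon>"
  shows "c * (b - a) - \<epsilon> \<le> h b - h a"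
proof -
  obtain \<delta> where \<delta>: "0 < \<delta>" and ac\<delta>:
    "\<And>D. D division_of \<Union>D \<Longrightarrow> \<Union>D \<subseteq> {a..b} \<Longrightarrow> measure lebesgue (\<Union>D) < \<delta>
      \<Longrightarrow> (\<Sum>K\<in>D. \<bar>h (Sup K) - h (Inf K)\<bar>) < \<epsilon> / 2"
    using abs_cont_on_division[OF ac half_gt_zero[OF e]] by blast
  \<comment> \<open>The first bound makes absolute continuity applicable with error
    \<open>\<epsilon> / 2\<close>; the second keeps the linear part \<open>c * length\<close> over
    the exceptional intervals below \<open>\<epsilon> / 2\<close>, the summand 1 guarding against
    \<open>c = 0\<close>.\<close>
  define \<mu> where "\<mu> = min \<delta> (\<epsilon> / (2 * (\<bar>c\<bar> + 1)))"
  have \<mu>: "\<mu> > 0" "\<mu> \<le> \<delta>" "\<bar>c\<bar> * \<mu> \<le> \<epsilon> / 2"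
  proof -
    show "\<mu> > 0" "\<mu> \<le> \<delta>" using \<delta> e by (auto simp: \<mu>_def intro!: divide_pos_pos)
    have "\<bar>c\<bar> * \<mu> \<le> (\<bar>c\<bar> + 1) * (\<epsilon> / (2 * (\<bar>c\<bar> + 1)))"
      by (rule mult_mono) (use \<open>\<mu> > 0\<close> in \<open>auto simp: \<mu>_def\<close>)
    also have "\<dots> = \<epsilon> / 2"
    proof -
      have "\<bar>c\<bar> + 1 \<noteq> 0" by linarith
      then show ?thesis by (simp add: field_simps)
    qed
    finally show "\<bar>c\<bar> * \<mu> \<le> \<epsilon> / 2" .
  qed
  have S0: "S \<in> null_sets lebesgue" using neg by (simp add: negligible_iff_null_sets)
  obtain U where U: "open U" "S \<subseteq> U" "U - S \<in> lmeasurable" "emeasure lebesgue (U - S) < ennreal \<mu>"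
    using sets_lebesgue_outer_open[of S \<mu>] S0 \<mu> by auto
  have Um: "emeasure lebesgue U < ennreal \<mu>"
  proof -
    have "U \<in> sets lebesgue" using U(1) by (auto intro: borel_open)
    then have "emeasure lebesgue (U - S) = emeasure lebesgue U" using S0 by (rule emeasure_Diff_null_set[rotated])
    then show ?thesis using U(4) by simp
  qed
  have Ul: "U \<in> lmeasurable" using Um U(1) by (auto simp: fmeasurable_def intro: less_trans borel_open)
  have Um': "measure lebesgue U < \<mu>" using Um \<mu>(1)
    by (simp add: measure_def enn2real_less_iff less_top order.strict_trans2)
  \<comment> \<open>The gauge is built pointwise: a straddle neighbourhood at good points,
    \<open>U\<close> at points of \<open>S\<close>, and the whole line at the remaining points,
    which lie outside \<open>[a, b]\<close> and never serve as tags.\<close>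
  have "\<exists>G. t \<in> G \<and> open G \<and> (t \<in> S \<longrightarrow> G \<subseteq> U) \<and>
     (t \<in> {a..b} - S \<longrightarrow> (\<forall>l u. l \<le> t \<longrightarrow> t \<le> u \<longrightarrow> {l..u} \<subseteq> G \<longrightarrow> c * (u - l) \<le> h u - h l))" for t
  proof (cases "t \<in> {a..b} - S")
    case True
    obtain d where "d > c" "(h has_real_derivative d) (at t)" using der[OF True] by blast
    from has_real_derivative_straddle[OF this(2,1)] obtain \<rho> where \<rho>: "\<rho> > 0"
      "\<forall>l u. l \<le> t \<longrightarrow> t \<le> u \<longrightarrow> t - \<rho> < l \<longrightarrow> u < t + \<rho> \<longrightarrow> c * (u - l) \<le> h u - h l" by blast
    show ?thesis
      by (rule exI[of _ "{t - \<rho><..<t + \<rho>}"]) (use \<rho> True in \<open>auto simp: subset_iff\<close>)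
  next
    case False
    then show ?thesis using U
      by (intro exI[of _ "if t \<in> S then U else UNIV"]) auto
  qed
  then obtain G where G: "\<And>t. t \<in> G t" "\<And>t. open (G t)" "\<And>t. t \<in> S \<Longrightarrow> G t \<subseteq> U"
    "\<And>t l u. t \<in> {a..b} - S \<Longrightarrow> l \<le> t \<Longrightarrow> t \<le> u \<Longrightarrow> {l..u} \<subseteq> G t \<Longrightarrow> c * (u - l) \<le> h u - h l"
    by metis
  have "gauge G" using G by (simp add: gauge_def)
  then obtain p where p: "p tagged_division_of {a..b}" and fine: "G fine p"
    using fine_division_exists_real by blast
  have finp: "finite p" using p by blast
  have rep: "K = {Inf K..Sup K} \<and> Inf K \<le> Sup K \<and> Inf K \<le> t \<and> t \<le> Sup K \<and> K \<subseteq> G t \<and> t \<in> {a..b} \<and> K \<subseteq> {a..b}"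
    if K: "(t, K) \<in> p" for t K
  proof -
    obtain u v where uv: "K = cbox u v" using tagged_division_ofD(4)[OF p K] by blast
    have "t \<in> K" "K \<subseteq> {a..b}" using tagged_division_ofD(2,3)[OF p K] by auto
    moreover have "K \<subseteq> G t" using fine K by (auto simp: fine_def)
    ultimately show ?thesis using uv by auto
  qed
  \<comment> \<open>The increment over \<open>K\<close> of the tilted function
    \<open>h t - c * t\<close>; the claim is that these increments sum to at least
    \<open>- \<epsilon>\<close>.\<close>
  define k where "k K = h (Sup K) - h (Inf K) - c * (Sup K - Inf K)" for K
  define p1 where "p1 = {(t, K). (t, K) \<in> p \<and> t \<in> S}"
  define D where "D = snd ` p1"
  have p1p: "p1 \<subseteq> p" by (auto simp: p1_def)
  then have finp1: "finite p1" using finp finite_subset by blast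
  have p1: "p1 tagged_division_of \<Union>D"
    unfolding D_def
    by (intro tagged_partial_division_of_Union_self tagged_partial_division_subset[OF _ p1p])
      (use p in \<open>auto simp: tagged_division_of_def\<close>)
  have Ddiv: "D division_of \<Union>D"
    using division_of_tagged_division[OF p1] by (simp add: D_def)
  have Dab: "\<Union>D \<subseteq> {a..b}" using rep by (fastforce simp: D_def p1_def)
  have DU: "\<Union>D \<subseteq> U" using rep G(3) by (fastforce simp: D_def p1_def)
  have "measure lebesgue (\<Union>D) \<le> measure lebesgue U"
    using DU lmeasurable_division[OF Ddiv] Ul by (intro measure_mono_fmeasurable) auto
  then have Dm: "measure lebesgue (\<Union>D) < \<mu>" using Um' by simp
  have Drep: "K = {Inf K..Sup K} \<and> Inf K \<le> Sup K" if "K \<in> D" for K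
    using that rep by (auto simp: D_def p1_def)
  have "(\<Sum>K\<in>D. Sup K - Inf K) = (\<Sum>K\<in>D. measure lebesgue K)"
  proof (rule sum.cong)
    fix K assume "K \<in> D"
    from Drep[OF this] show "Sup K - Inf K = measure lebesgue K"
      by (metis content_real measure_completion sets_lborel closed_real_atLeastAtMost borel_closed)
  qed simp
  also have "\<dots> = measure lebesgue (\<Union>D)" by (rule content_division[OF Ddiv])
  finally have len: "(\<Sum>K\<in>D. Sup K - Inf K) < \<mu>" using Dm by simp
  have "(\<Sum>K\<in>D. \<bar>k K\<bar>) \<le> (\<Sum>K\<in>D. \<bar>h (Sup K) - h (Inf K)\<bar> + \<bar>c\<bar> * (Sup K - Inf K))"
  proof (rule sum_mono)
    fix K assume "K \<in> D"
    then have "\<bar>c * (Sup K - Inf K)\<bar> = \<bar>c\<bar> * (Sup K - Inf K)"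
      using Drep[of K] by (simp add: abs_mult)
    then show "\<bar>k K\<bar> \<le> \<bar>h (Sup K) - h (Inf K)\<bar> + \<bar>c\<bar> * (Sup K - Inf K)"
      unfolding k_def by linarith
  qed
  also have "\<dots> = (\<Sum>K\<in>D. \<bar>h (Sup K) - h (Inf K)\<bar>) + \<bar>c\<bar> * (\<Sum>K\<in>D. Sup K - Inf K)"
    by (simp add: sum.distrib sum_distrib_left)
  also have "\<dots> \<le> \<epsilon> / 2 + \<bar>c\<bar> * \<mu>"
    using ac\<delta>[OF Ddiv Dab] Dm \<mu>(2) len by (intro add_mono mult_left_mono) auto
  finally have kD: "(\<Sum>K\<in>D. \<bar>k K\<bar>) \<le> \<epsilon>" using \<mu>(3) by linarith
  \<comment> \<open>Passing from tagged pairs to intervals requires a summand that vanishes on every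
    interval with empty interior. The guard covers the empty interval, where \<open>Sup\<close> and
    \<open>Inf\<close> carry no information.\<close>
  have "(\<Sum>(t, K)\<in>p1. \<bar>k K\<bar>) = (\<Sum>(t, K)\<in>p1. if K = {} then 0 else \<bar>k K\<bar>)"
    by (rule sum.cong) (use rep in \<open>force simp: p1_def\<close>)+
  also have "\<dots> = (\<Sum>K\<in>D. if K = {} then 0 else \<bar>k K\<bar>)"
    unfolding D_def
  proof (rule sum.over_tagged_division_lemma[OF p1])
    fix u v :: real assume "box u v = {}"
    then show "(if cbox u v = {} then 0 else \<bar>k (cbox u v)\<bar>) = 0"
      by (cases "u = v") (auto simp: k_def)
  qed
  also have "\<dots> \<le> (\<Sum>K\<in>D. \<bar>k K\<bar>)" by (rule sum_mono) auto
  finally have kp1: "(\<Sum>(t, K)\<in>p1. \<bar>k K\<bar>) \<le> \<epsilon>" using kD by linarith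
  have "- \<epsilon> \<le> - (\<Sum>(t, K)\<in>p1. \<bar>k K\<bar>)" using kp1 by simp
  also have "\<dots> \<le> (\<Sum>(t, K)\<in>p1. k K)"
    unfolding sum_negf[symmetric] by (rule sum_mono) auto
  also have "\<dots> \<le> (\<Sum>(t, K)\<in>p. k K)"
  proof (rule sum_mono2[OF finp p1p])
    fix y assume y: "y \<in> p - p1"
    then obtain t K where tK: "y = (t, K)" "(t, K) \<in> p" "t \<notin> S" by (auto simp: p1_def)
    with rep[OF tK(2)] G(4)[of t "Inf K" "Sup K"] show "0 \<le> (case y of (t, K) \<Rightarrow> k K)"
      by (auto simp: k_def)
  qed
  also have "\<dots> = (h b - c * b) - (h a - c * a)"
    using additive_tagged_division_1[OF ab p, of "\<lambda>t. h t - c * t"]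
    by (simp add: k_def algebra_simps)
  finally show ?thesis by (simp add: algebra_simps)
qed

text \<open>Lowering the slope from \<open>c\<close> to \<open>c - \<epsilon>\<close> makes the
  derivative bound strict, so the preceding estimate applies; the loss
  \<open>\<epsilon> * (b - a) + \<epsilon>\<close> is arbitrarily small. Increments are thus
  estimated without representing them as integrals of a derivative.\<close>

lemma abs_cont_on_growth_ge:
  assumes ac: "abs_cont_on a b h" and ab: "a \<le> b"
    and der: "AE t in lebesgue. t \<in> {a..b} \<longrightarrow> (\<exists>d\<ge>c. (h has_real_derivative d) (at t))"
  shows "c * (b - a) \<le> h b - h a"
proof (rule field_le_epsilon)
  fix e :: real assume e: "e > 0"
  from der obtain S where S: "S \<in> null_sets lebesgue"
    "{t. \<not> (t \<in> {a..b} \<longrightarrow> (\<exists>d\<ge>c. (h has_real_derivative d) (at t)))} \<subseteq> S"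
    unfolding eventually_ae_filter by auto
  define \<epsilon> where "\<epsilon> = e / (b - a + 1)"
  have \<epsilon>: "\<epsilon> > 0" "\<epsilon> * (b - a) + \<epsilon> = e"
  proof -
    have p: "b - a + 1 > 0" using ab by simp
    then show "\<epsilon> > 0" using e by (simp add: \<epsilon>_def)
    have "\<epsilon> * (b - a) + \<epsilon> = \<epsilon> * (b - a + 1)" by (simp add: algebra_simps)
    also have "\<dots> = e" using p by (simp add: \<epsilon>_def)
    finally show "\<epsilon> * (b - a) + \<epsilon> = e" .
  qed
  have "(c - \<epsilon>) * (b - a) - \<epsilon> \<le> h b - h a"
  proof (rule abs_cont_on_growth_ge_almost[OF ac ab])
    show "negligible S" using S by (simp add: negligible_iff_null_sets)
    show "\<exists>d>c - \<epsilon>. (h has_real_derivative d) (at t)" if "t \<in> {a..b} - S" for t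
      using that S(2) \<epsilon>(1) by force
  qed (rule \<epsilon>)
  then show "c * (b - a) \<le> h b - h a + e" using \<epsilon>(2) by (simp add: algebra_simps)
qed

lemma abs_cont_on_uminus:
  "abs_cont_on a b h \<Longrightarrow> abs_cont_on a b (\<lambda>t. - h t)"
  unfolding abs_cont_on_def minus_diff_minus abs_minus_cancel .

lemma abs_cont_on_growth_le:
  assumes ac: "abs_cont_on a b h" and ab: "a \<le> b"
    and der: "AE t in lebesgue. t \<in> {a..b} \<longrightarrow> (\<exists>d\<le>c. (h has_real_derivative d) (at t))"
  shows "h b - h a \<le> c * (b - a)"
proof -
  have "(- c) * (b - a) \<le> (- h b) - (- h a)"
  proof (rule abs_cont_on_growth_ge[OF abs_cont_on_uminus[OF ac] ab])
    show "AE t in lebesgue. t \<in> {a..b} \<longrightarrow> (\<exists>d\<ge>- c. ((\<lambda>t. - h t) has_real_derivative d) (at t))"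
      using der
    proof eventually_elim
      case (elim t)
      show ?case
      proof
        assume "t \<in> {a..b}"
        then obtain d where "d \<le> c" "(h has_real_derivative d) (at t)" using elim by blast
        then show "\<exists>d\<ge>- c. ((\<lambda>t. - h t) has_real_derivative d) (at t)"
          by (intro exI[of _ "- d"]) (auto intro: DERIV_minus)
      qed
    qed
  qed
  then show ?thesis by simp
qed

section \<open>From absolute continuity to continuity and classical derivatives\<close>

lemma abs_cont_on_subinterval:
  assumes "abs_cont_on a b h" "a \<le> a'" "b' \<le> b"
  shows "abs_cont_on a' b' h"
  unfolding abs_cont_on_def
proof (intro allI impI)
  fix e :: real assume e: "e > 0"
  obtain \<delta> where "\<delta> > 0" and d: "\<forall>(m::nat) l r.
      (\<forall>k<m. a \<le> l k \<and> l k \<le> r k \<and> r k \<le> b) \<and>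
      (\<forall>k<m. \<forall>k'<m. k \<noteq> k' \<longrightarrow> r k \<le> l k' \<or> r k' \<le> l k) \<and>
      (\<Sum>k<m. r k - l k) < \<delta> \<longrightarrow> (\<Sum>k<m. \<bar>h (r k) - h (l k)\<bar>) < e"
    using assms(1)[unfolded abs_cont_on_def, THEN spec, THEN mp, OF e] by (elim exE conjE)
  show "\<exists>\<delta>>0. \<forall>(m::nat) l r.
      (\<forall>k<m. a' \<le> l k \<and> l k \<le> r k \<and> r k \<le> b') \<and>
      (\<forall>k<m. \<forall>k'<m. k \<noteq> k' \<longrightarrow> r k \<le> l k' \<or> r k' \<le> l k) \<and>
      (\<Sum>k<m. r k - l k) < \<delta> \<longrightarrow> (\<Sum>k<m. \<bar>h (r k) - h (l k)\<bar>) < e"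
  proof (intro exI[of _ \<delta>] conjI allI impI)
    fix m :: nat and l r :: "nat \<Rightarrow> real"
    assume "(\<forall>k<m. a' \<le> l k \<and> l k \<le> r k \<and> r k \<le> b') \<and>
      (\<forall>k<m. \<forall>k'<m. k \<noteq> k' \<longrightarrow> r k \<le> l k' \<or> r k' \<le> l k) \<and> (\<Sum>k<m. r k - l k) < \<delta>"
    then show "(\<Sum>k<m. \<bar>h (r k) - h (l k)\<bar>) < e"
      using assms(2,3) by (intro d[rule_format]) force
  qed fact
qed

lemma abs_cont_on_imp_continuous_on:
  assumes "abs_cont_on a b h"
  shows "continuous_on {a..b} h"
  unfolding continuous_on_iff
proof (intro ballI allI impI)
  fix x e :: real assume x: "x \<in> {a..b}" and e: "0 < e"
  obtain \<delta> where d: "\<delta> > 0" and dd0: "\<forall>(m::nat) l r.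
      (\<forall>k<m. a \<le> l k \<and> l k \<le> r k \<and> r k \<le> b) \<and>
      (\<forall>k<m. \<forall>k'<m. k \<noteq> k' \<longrightarrow> r k \<le> l k' \<or> r k' \<le> l k) \<and>
      (\<Sum>k<m. r k - l k) < \<delta> \<longrightarrow> (\<Sum>k<m. \<bar>h (r k) - h (l k)\<bar>) < e"
    using assms[unfolded abs_cont_on_def, THEN spec, THEN mp, OF e] by (elim exE conjE)
  note dd = dd0[THEN spec, THEN spec, THEN spec, THEN mp, OF conjI, OF _ conjI]
  have "dist (h y) (h x) < e" if "y \<in> {a..b}" "dist y x < \<delta>" for y
    using dd[of 1 "\<lambda>_. x" "\<lambda>_. y"] dd[of 1 "\<lambda>_. y" "\<lambda>_. x"] x that
    by (cases "x \<le> y") (auto simp: dist_real_def abs_minus_commute)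
  with d show "\<exists>d>0. \<forall>y\<in>{a..b}. dist y x < d \<longrightarrow> dist (h y) (h x) < e" by blast
qed

lemma lipschitz_imp_abs_cont_on:
  assumes L: "\<And>s t. a \<le> s \<Longrightarrow> s \<le> t \<Longrightarrow> t \<le> b \<Longrightarrow> \<bar>h t - h s\<bar> \<le> L * (t - s)"
  shows "abs_cont_on a b h"
  unfolding abs_cont_on_def
proof (intro allI impI)
  fix e :: real assume e: "e > 0"
  define \<delta> where "\<delta> = e / (\<bar>L\<bar> + 1)"
  have pos: "\<bar>L\<bar> + 1 > 0" by linarith
  have "(\<Sum>k<m. \<bar>h (r k) - h (l k)\<bar>) < e"
    if H: "\<forall>k<m. a \<le> l k \<and> l k \<le> r k \<and> r k \<le> b" and s: "(\<Sum>k<m. r k - l k) < \<delta>"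
    for m :: nat and l r :: "nat \<Rightarrow> real"
  proof -
    have "(\<Sum>k<m. \<bar>h (r k) - h (l k)\<bar>) \<le> (\<Sum>k<m. (\<bar>L\<bar> + 1) * (r k - l k))"
    proof (rule sum_mono)
      fix k assume "k \<in> {..<m}"
      then have "\<bar>h (r k) - h (l k)\<bar> \<le> L * (r k - l k)" "0 \<le> r k - l k" using L H by auto
      then show "\<bar>h (r k) - h (l k)\<bar> \<le> (\<bar>L\<bar> + 1) * (r k - l k)"
        by (smt (verit) mult_right_mono)
    qed
    also have "\<dots> = (\<bar>L\<bar> + 1) * (\<Sum>k<m. r k - l k)" by (simp add: sum_distrib_left)
    also have "\<dots> < (\<bar>L\<bar> + 1) * \<delta>" using s pos by (rule mult_strict_left_mono)
    also have "\<dots> = e" using pos by (simp add: \<delta>_def)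
    finally show ?thesis .
  qed
  moreover have "\<delta> > 0" using e pos by (simp add: \<delta>_def)
  ultimately show "\<exists>\<delta>>0. \<forall>(m::nat) l r.
      (\<forall>k<m. a \<le> l k \<and> l k \<le> r k \<and> r k \<le> b) \<and>
      (\<forall>k<m. \<forall>k'<m. k \<noteq> k' \<longrightarrow> r k \<le> l k' \<or> r k' \<le> l k) \<and>
      (\<Sum>k<m. r k - l k) < \<delta> \<longrightarrow> (\<Sum>k<m. \<bar>h (r k) - h (l k)\<bar>) < e"
    by blast
qed

text \<open>Near \<open>t\<close> the continuous candidate \<open>q\<close> stays within
  \<open>\<epsilon>\<close> of \<open>q t\<close>, so the growth bounds squeeze every increment on a
  short interval between slopes \<open>q t - \<epsilon>\<close> and \<open>q t + \<epsilon>\<close>.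
  This upgrades the angle and supply equations from almost every time to every positive
  time.\<close>

lemma abs_cont_continuous_derivative:
  assumes ac: "\<And>T. 0 \<le> T \<Longrightarrow> abs_cont_on 0 T h"
    and der: "AE t in lebesgue. 0 \<le> t \<longrightarrow> (h has_real_derivative q t) (at t)"
    and q: "continuous_on {0..} q" and t: "0 < t"
  shows "(h has_real_derivative q t) (at t)"
  unfolding has_field_derivative_iff
proof (rule tendstoI)
  fix e :: real assume "e > 0"
  define \<epsilon> where "\<epsilon> = e / 2"
  have e: "\<epsilon> > 0" "\<epsilon> < e" using \<open>e > 0\<close> by (auto simp: \<epsilon>_def)
  obtain \<delta>' where \<delta>': "\<delta>' > 0" "\<And>s. 0 \<le> s \<Longrightarrow> \<bar>s - t\<bar> < \<delta>' \<Longrightarrow> \<bar>q s - q t\<bar> < \<epsilon>"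
    using q t e(1) unfolding continuous_on_iff dist_real_def by (metis atLeast_iff less_imp_le)
  \<comment> \<open>Capping by \<open>t\<close> keeps the window inside the half-line on which
    \<open>q\<close> and the derivative are controlled.\<close>
  define \<delta> where "\<delta> = min \<delta>' t"
  have \<delta>: "\<delta> > 0" "\<And>s. \<bar>s - t\<bar> < \<delta> \<Longrightarrow> 0 \<le> s \<and> \<bar>q s - q t\<bar> < \<epsilon>"
    using \<delta>' t by (auto simp: \<delta>_def abs_less_iff)
  have inc: "(q t - \<epsilon>) * (b - a) \<le> h b - h a \<and> h b - h a \<le> (q t + \<epsilon>) * (b - a)"
    if ab: "a \<le> b" "t - \<delta> < a" "b < t + \<delta>" for a b
  proof
    have near: "\<bar>s - t\<bar> < \<delta>" if "s \<in> {a..b}" for s using that ab by (auto simp: abs_less_iff)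
    have "0 \<le> a" using \<delta>(2)[OF near, of a] ab by auto
    then have ac': "abs_cont_on a b h" using ab ac[of b] abs_cont_on_subinterval by fastforce
    have "AE s in lebesgue. s \<in> {a..b} \<longrightarrow> (\<exists>d\<ge>q t - \<epsilon>. (h has_real_derivative d) (at s))"
      using der
    proof eventually_elim
      case (elim s)
      then show ?case using \<delta>(2)[OF near, of s] by (auto intro!: exI[of _ "q s"])
    qed
    then show "(q t - \<epsilon>) * (b - a) \<le> h b - h a" by (rule abs_cont_on_growth_ge[OF ac' ab(1)])
    have "AE s in lebesgue. s \<in> {a..b} \<longrightarrow> (\<exists>d\<le>q t + \<epsilon>. (h has_real_derivative d) (at s))"
      using der
    proof eventually_elim
      case (elim s)
      then show ?case using \<delta>(2)[OF near, of s] by (auto intro!: exI[of _ "q s"])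
    qed
    then show "h b - h a \<le> (q t + \<epsilon>) * (b - a)" by (rule abs_cont_on_growth_le[OF ac' ab(1)])
  qed
  have "dist ((h y - h t) / (y - t)) (q t) < e" if y: "y \<noteq> t" "dist y t < \<delta>" for y
  proof -
    have "\<bar>(h y - h t) - q t * (y - t)\<bar> \<le> \<epsilon> * \<bar>y - t\<bar>"
    proof (cases "t \<le> y")
      case True
      then show ?thesis using inc[of t y] y \<delta>(1) by (auto simp: dist_real_def algebra_simps abs_le_iff)
    next
      case False
      then show ?thesis using inc[of y t] y \<delta>(1) by (auto simp: dist_real_def algebra_simps abs_le_iff)
    qed
    moreover have "(h y - h t) / (y - t) - q t = ((h y - h t) - q t * (y - t)) / (y - t)"
      using y by (simp add: field_simps)
    ultimately have "\<bar>(h y - h t) / (y - t) - q t\<bar> \<le> \<epsilon>"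
      using y by (simp add: abs_divide pos_divide_le_eq)
    then show ?thesis using e by (simp add: dist_real_def)
  qed
  then show "eventually (\<lambda>y. dist ((h y - h t) / (y - t)) (q t) < e) (at t)"
    using \<delta>(1) unfolding eventually_at by blast
qed

section \<open>Functions on the half-line and Barbalat's argument\<close>

lemma continuous_on_atLeast_if_compact:
  fixes h :: "real \<Rightarrow> 'b::topological_space"
  assumes "\<And>T. 0 \<le> T \<Longrightarrow> continuous_on {0..T} h"
  shows "continuous_on {0..} h"
  unfolding continuous_on_def
proof
  fix t :: real assume t: "t \<in> {0..}"
  have "at t within {0..} = at t within {0..t + 1}"
    by (rule at_within_nhd[of _ "{..<t + 1}"]) auto
  moreover have "(h \<longlongrightarrow> h t) (at t within {0..t + 1})"
    using assms[of "t + 1"] t unfolding continuous_on_def by auto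
  ultimately show "(h \<longlongrightarrow> h t) (at t within {0..})" by simp
qed

lemma mvt_lipschitz_bound:
  fixes h :: "real \<Rightarrow> real"
  assumes ab: "a \<le> b" and c: "continuous_on {a..b} h"
    and der: "\<And>t. a < t \<Longrightarrow> t < b \<Longrightarrow> (h has_real_derivative d t) (at t) \<and> \<bar>d t\<bar> \<le> K"
  shows "\<bar>h b - h a\<bar> \<le> K * (b - a)"
proof (cases "a = b")
  case False
  then have "\<exists>l z. a < z \<and> z < b \<and> (h has_real_derivative l) (at z) \<and> h b - h a = (b - a) * l"
    using ab c der by (intro MVT) (auto simp: real_differentiable_def)
  then obtain l z where z: "a < z" "z < b" "(h has_real_derivative l) (at z)" "h b - h a = (b - a) * l" by blast
  then have "\<bar>l\<bar> \<le> K" using der[OF z(1,2)] DERIV_unique by blast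
  then show ?thesis using z(4) ab by (simp add: abs_mult mult.commute mult_right_mono)
qed simp

text \<open>If \<open>q t\<close> is at least \<open>\<epsilon>\<close> at a late time, uniform
  continuity keeps \<open>q\<close> above \<open>\<epsilon> / 2\<close> on a window of fixed length,
  and \<open>F\<close> rises there by a fixed amount, contradicting convergence. The relation
  "\<open>q\<close> is the derivative of \<open>F\<close>" is replaced by an inequality for
  increments, which fits functions that are only absolutely continuous or satisfy a mere
  differential inequality.\<close>

lemma barbalat:
  fixes F q :: "real \<Rightarrow> real"
  assumes lim: "(F \<longlongrightarrow> l) at_top"
    and q: "uniformly_continuous_on {0..} q"
    and growth: "\<And>a b c. T \<le> a \<Longrightarrow> a \<le> b \<Longrightarrow> (\<And>t. t \<in> {a..b} \<Longrightarrow> c \<le> q t) \<Longrightarrow> c * (b - a) \<le> F b - F a"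
    and e: "0 < \<epsilon>"
  shows "eventually (\<lambda>t. q t < \<epsilon>) at_top"
proof -
  obtain \<tau> where \<tau>: "\<tau> > 0" and ut: "\<And>s t. 0 \<le> s \<Longrightarrow> 0 \<le> t \<Longrightarrow> \<bar>s - t\<bar> < \<tau> \<Longrightarrow> \<bar>q s - q t\<bar> < \<epsilon> / 2"
    using q e unfolding uniformly_continuous_on_def dist_real_def
    by (metis atLeast_iff half_gt_zero)
  have "eventually (\<lambda>t. \<bar>F t - l\<bar> < \<epsilon> * \<tau> / 16) at_top"
    using tendstoD[OF lim, of "\<epsilon> * \<tau> / 16"] e \<tau> by (simp add: dist_real_def)
  then obtain T' where T': "\<And>t. t \<ge> T' \<Longrightarrow> \<bar>F t - l\<bar> < \<epsilon> * \<tau> / 16"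
    by (auto simp: eventually_at_top_linorder)
  have "q t < \<epsilon>" if "t \<ge> max 0 (max T T')" for t
  proof (rule ccontr)
    assume "\<not> q t < \<epsilon>"
    have "\<epsilon> / 2 \<le> q s" if s: "s \<in> {t..t + \<tau> / 2}" for s
    proof -
      have "\<bar>q s - q t\<bar> < \<epsilon> / 2" using ut[of s t] s \<open>t \<ge> _\<close> \<tau> by auto
      then show ?thesis using \<open>\<not> q t < \<epsilon>\<close> by linarith
    qed
    then have "\<epsilon> / 2 * (t + \<tau> / 2 - t) \<le> F (t + \<tau> / 2) - F t"
      using that \<tau> by (intro growth) auto
    moreover have "\<bar>F (t + \<tau> / 2) - l\<bar> < \<epsilon> * \<tau> / 16" "\<bar>F t - l\<bar> < \<epsilon> * \<tau> / 16"
      using T' that \<tau> by auto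
    moreover have "\<epsilon> * \<tau> > 0" using e \<tau> by simp
    moreover have "\<epsilon> / 2 * (t + \<tau> / 2 - t) = \<epsilon> * \<tau> / 4" by simp
    ultimately show False by linarith
  qed
  then show ?thesis unfolding eventually_at_top_linorder by blast
qed

section \<open>Spaces with finitely many real coordinates\<close>

lemma bounded_finite_family_subsequence:
  fixes X :: "nat \<Rightarrow> 'a" and I :: "('a \<Rightarrow> real) set"
  assumes "finite I" and "\<And>c. c \<in> I \<Longrightarrow> bounded (range (\<lambda>n. c (X n)))"
  shows "\<exists>s l. strict_mono (s :: nat \<Rightarrow> nat) \<and> (\<forall>c\<in>I. (\<lambda>n. c (X (s n))) \<longlonglongrightarrow> l c)"
  using assms
proof (induction I rule: finite_induct)
  case empty
  then show ?case by (auto intro: strict_mono_id)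
next
  case (insert c I)
  then obtain s l where s: "strict_mono (s :: nat \<Rightarrow> nat)"
    and l: "\<forall>d\<in>I. (\<lambda>n. d (X (s n))) \<longlonglongrightarrow> l d" by auto
  have "bounded (range (\<lambda>n. c (X (s n))))"
    using insert.prems[of c] by (rule bounded_subset) auto
  then obtain L r where r: "strict_mono (r :: nat \<Rightarrow> nat)" and L: "((\<lambda>n. c (X (s n))) \<circ> r) \<longlonglongrightarrow> L"
    using bounded_imp_convergent_subsequence by blast
  have "(\<lambda>n. d (X ((s \<circ> r) n))) \<longlonglongrightarrow> (l(c := L)) d" if "d \<in> insert c I" for d
    using that L LIMSEQ_subseq_LIMSEQ[OF l[rule_format, of d] r] by (auto simp: o_def)
  then show ?case using strict_mono_o[OF s r] by blast
qed

text \<open>Points are seen only through a finite family \<open>I\<close> of real functionals, so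
  points that agree on \<open>I\<close> are indistinguishable. \<open>cnhds\<close> is the
  neighbourhood filter of the topology that \<open>I\<close> induces. Realizability of all value
  assignments is what makes closed boxes sequentially compact: a limit of coordinate values is
  attained by some point.\<close>

locale coord_space =
  fixes I :: "('a \<Rightarrow> real) set"
  assumes finite_coords: "finite I"
    and coords_realizable: "\<And>l. \<exists>z. \<forall>c\<in>I. c z = l c"
begin

definition cnhds :: "'a \<Rightarrow> 'a filter" where
  "cnhds z = (INF c\<in>I. filtercomap c (nhds (c z)))"

definition coord_box :: "'a \<Rightarrow> real \<Rightarrow> 'a set" where
  "coord_box z r = {x. \<forall>c\<in>I. \<bar>c x - c z\<bar> \<le> r}"

definition coord_cont :: "('a \<Rightarrow> real) \<Rightarrow> bool" where
  "coord_cont \<Phi> \<longleftrightarrow> (\<forall>z. (\<Phi> \<longlongrightarrow> \<Phi> z) (cnhds z))"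

lemma filterlim_cnhds:
  "filterlim X (cnhds z) F \<longleftrightarrow> (\<forall>c\<in>I. ((\<lambda>t. c (X t)) \<longlongrightarrow> c z) F)"
  by (simp add: cnhds_def filterlim_INF filterlim_filtercomap_iff o_def)

lemma tendsto_coord: "c \<in> I \<Longrightarrow> (c \<longlongrightarrow> c z) (cnhds z)"
  using filterlim_cnhds[of "\<lambda>x. x" z "cnhds z"] by (simp add: filterlim_ident)

lemma eventually_cnhds:
  "eventually P (cnhds z) \<longleftrightarrow> (\<exists>\<delta>>0. \<forall>x. (\<forall>c\<in>I. \<bar>c x - c z\<bar> < \<delta>) \<longrightarrow> P x)"
proof
  assume "eventually P (cnhds z)"
  then obtain Q where Q: "\<And>c. c \<in> I \<Longrightarrow> eventually (Q c) (filtercomap c (nhds (c z)))"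
    "\<And>x. (\<forall>c\<in>I. Q c x) \<Longrightarrow> P x"
    unfolding cnhds_def eventually_INF_finite[OF finite_coords] by blast
  have "\<exists>\<delta>>0. \<forall>x. \<bar>c x - c z\<bar> < \<delta> \<longrightarrow> Q c x" if c: "c \<in> I" for c
    using Q(1)[OF c] unfolding eventually_filtercomap eventually_nhds_metric dist_real_def by blast
  then obtain d where d: "\<And>c. c \<in> I \<Longrightarrow> d c > 0" "\<And>c x. c \<in> I \<Longrightarrow> \<bar>c x - c z\<bar> < d c \<Longrightarrow> Q c x"
    by metis
  define \<delta> where "\<delta> = Min (insert 1 (d ` I))"
  have "\<delta> > 0" "\<And>c. c \<in> I \<Longrightarrow> \<delta> \<le> d c"
    using finite_coords d by (auto simp: \<delta>_def)
  then show "\<exists>\<delta>>0. \<forall>x. (\<forall>c\<in>I. \<bar>c x - c z\<bar> < \<delta>) \<longrightarrow> P x"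
    using d(2) Q(2) by (meson less_le_trans)
next
  assume "\<exists>\<delta>>0. \<forall>x. (\<forall>c\<in>I. \<bar>c x - c z\<bar> < \<delta>) \<longrightarrow> P x"
  then obtain \<delta> where \<delta>: "\<delta> > 0" "\<And>x. (\<forall>c\<in>I. \<bar>c x - c z\<bar> < \<delta>) \<Longrightarrow> P x" by blast
  have "eventually (\<lambda>x. \<forall>c\<in>I. \<bar>c x - c z\<bar> < \<delta>) (cnhds z)"
    using \<delta>(1) tendstoD[OF tendsto_coord, of _ \<delta> z]
    by (intro eventually_ball_finite finite_coords) (auto simp: dist_real_def)
  then show "eventually P (cnhds z)" by (rule eventually_mono) (rule \<delta>(2))
qed

lemma coord_cont_tendsto:
  assumes "coord_cont \<Phi>" and "\<And>c. c \<in> I \<Longrightarrow> ((\<lambda>t. c (X t)) \<longlongrightarrow> c z) F"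
  shows "((\<lambda>t. \<Phi> (X t)) \<longlongrightarrow> \<Phi> z) F"
proof (rule filterlim_compose[of \<Phi> "nhds (\<Phi> z)" "cnhds z" X F])
  show "(\<Phi> \<longlongrightarrow> \<Phi> z) (cnhds z)" using assms(1) by (simp add: coord_cont_def)
  show "filterlim X (cnhds z) F" using assms(2) by (simp add: filterlim_cnhds)
qed

lemma coord_cont_continuous_on:
  assumes "coord_cont \<Phi>" and "\<And>c. c \<in> I \<Longrightarrow> continuous_on S (\<lambda>t. c (X t))"
  shows "continuous_on S (\<lambda>t. \<Phi> (X t))"
  using assms coord_cont_tendsto unfolding continuous_on_def by blast

lemma coord_box_subsequence:
  assumes X: "\<And>n. X n \<in> coord_box z r"
  obtains s z' where "strict_mono (s :: nat \<Rightarrow> nat)" "z' \<in> coord_box z r"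
    "\<And>c. c \<in> I \<Longrightarrow> (\<lambda>n. c (X (s n))) \<longlonglongrightarrow> c z'"
proof -
  have bd: "\<bar>c (X n) - c z\<bar> \<le> r" if "c \<in> I" for c n
    using X[of n] that by (auto simp: coord_box_def)
  have "bounded (range (\<lambda>n. c (X n)))" if "c \<in> I" for c
  proof (rule boundedI)
    fix y assume "y \<in> range (\<lambda>n. c (X n))"
    then obtain n where "y = c (X n)" by blast
    then show "norm y \<le> \<bar>c z\<bar> + r" using bd[OF that, of n] by auto
  qed
  then obtain s l where s: "strict_mono (s :: nat \<Rightarrow> nat)"
    and l: "\<forall>c\<in>I. (\<lambda>n. c (X (s n))) \<longlonglongrightarrow> l c"
    using bounded_finite_family_subsequence[OF finite_coords, of X] by blast
  obtain z' where z': "\<forall>c\<in>I. c z' = l c" using coords_realizable by blast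
  have lim: "(\<lambda>n. c (X (s n))) \<longlonglongrightarrow> c z'" if "c \<in> I" for c
    using l z' that by auto
  have "\<bar>c z' - c z\<bar> \<le> r" if c: "c \<in> I" for c
  proof (rule tendsto_upperbound)
    show "(\<lambda>n. \<bar>c (X (s n)) - c z\<bar>) \<longlonglongrightarrow> \<bar>c z' - c z\<bar>"
      by (intro tendsto_intros lim c)
  qed (use bd[OF c] in auto)
  then have "z' \<in> coord_box z r" by (simp add: coord_box_def)
  then show ?thesis using s lim that by blast
qed

lemma coord_cont_bounded_on_box:
  assumes \<Phi>: "coord_cont \<Phi>"
  obtains K where "0 < K" "\<And>x. x \<in> coord_box z r \<Longrightarrow> \<bar>\<Phi> x\<bar> \<le> K"
proof (rule ccontr)
  assume "\<not> thesis"
  then have "\<exists>x\<in>coord_box z r. real (Suc n) < \<bar>\<Phi> x\<bar>" for n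
    using that[of "real (Suc n)"] by force
  then obtain X where X: "\<And>n. X n \<in> coord_box z r" "\<And>n. real (Suc n) < \<bar>\<Phi> (X n)\<bar>" by metis
  obtain s z' where s: "strict_mono (s :: nat \<Rightarrow> nat)" "z' \<in> coord_box z r"
    "\<And>c. c \<in> I \<Longrightarrow> (\<lambda>n. c (X (s n))) \<longlonglongrightarrow> c z'"
    using coord_box_subsequence[of X z r] X(1) by blast
  have "(\<lambda>n. \<Phi> (X (s n))) \<longlonglongrightarrow> \<Phi> z'" by (rule coord_cont_tendsto[OF \<Phi> s(3)])
  then have "Bseq (\<lambda>n. \<Phi> (X (s n)))" by (intro convergent_imp_Bseq convergentI)
  then obtain K where K: "\<And>n. \<bar>\<Phi> (X (s n))\<bar> \<le> K" by (auto simp: Bseq_def)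
  obtain n where "K < real n" using reals_Archimedean2 by blast
  moreover have "real n \<le> real (Suc (s n))" using seq_suble[OF s(1), of n] by simp
  ultimately show False using K[of n] X(2)[of "s n"] by linarith
qed

lemma coord_cont_uniform_on_box:
  assumes \<Phi>: "coord_cont \<Phi>" and e: "0 < \<epsilon>"
  obtains \<delta> where "0 < \<delta>" "\<And>x y. x \<in> coord_box z r \<Longrightarrow> y \<in> coord_box z r
    \<Longrightarrow> (\<And>c. c \<in> I \<Longrightarrow> \<bar>c x - c y\<bar> < \<delta>) \<Longrightarrow> \<bar>\<Phi> x - \<Phi> y\<bar> < \<epsilon>"
proof (rule ccontr)
  assume "\<not> thesis"
  then have "\<exists>x\<in>coord_box z r. \<exists>y\<in>coord_box z r. (\<forall>c\<in>I. \<bar>c x - c y\<bar> < inverse (real (Suc n))) \<and> \<epsilon> \<le> \<bar>\<Phi> x - \<Phi> y\<bar>" for n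
    using that[of "inverse (real (Suc n))"] by (meson not_less inverse_positive_iff_positive of_nat_0_less_iff zero_less_Suc)
  then obtain X Y where X: "\<And>n. X n \<in> coord_box z r" "\<And>n. Y n \<in> coord_box z r"
    "\<And>n c. c \<in> I \<Longrightarrow> \<bar>c (X n) - c (Y n)\<bar> < inverse (real (Suc n))" "\<And>n. \<epsilon> \<le> \<bar>\<Phi> (X n) - \<Phi> (Y n)\<bar>" by metis
  obtain s z' where s: "strict_mono (s :: nat \<Rightarrow> nat)" "z' \<in> coord_box z r"
    "\<And>c. c \<in> I \<Longrightarrow> (\<lambda>n. c (X (s n))) \<longlonglongrightarrow> c z'"
    using coord_box_subsequence[of X z r] X(1) by blast
  have Y: "(\<lambda>n. c (Y (s n))) \<longlonglongrightarrow> c z'" if c: "c \<in> I" for c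
  proof -
    have "(\<lambda>n. inverse (real (Suc (s n)))) \<longlonglongrightarrow> 0"
      using LIMSEQ_subseq_LIMSEQ[OF LIMSEQ_inverse_real_of_nat s(1)] by (simp add: o_def)
    then have "(\<lambda>n. c (X (s n)) - c (Y (s n))) \<longlonglongrightarrow> 0"
      by (rule Lim_null_comparison[rotated]) (use X(3)[OF c] in \<open>auto intro!: always_eventually less_imp_le\<close>)
    from tendsto_diff[OF s(3)[OF c] this] show ?thesis by simp
  qed
  have "(\<lambda>n. \<bar>\<Phi> (X (s n)) - \<Phi> (Y (s n))\<bar>) \<longlonglongrightarrow> \<bar>\<Phi> z' - \<Phi> z'\<bar>"
    by (intro tendsto_intros coord_cont_tendsto[OF \<Phi>] s(3) Y)
  then have "\<epsilon> \<le> \<bar>\<Phi> z' - \<Phi> z'\<bar>"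
    by (rule tendsto_lowerbound) (use X(4) in auto)
  then show False using e by simp
qed

text \<open>Positivity on the closed part of the box where \<open>\<Psi>\<close> is at least
  \<open>\<epsilon>\<close> becomes uniform by compactness. It serves twice: for the energy barrier
  on the faces of a box, and for a positive rate of loss while a frequency stays away from
  0.\<close>

lemma coord_cont_lower_bound_on_box:
  assumes \<Phi>: "coord_cont \<Phi>" and \<Psi>: "coord_cont \<Psi>"
    and pos: "\<And>x. x \<in> coord_box z r \<Longrightarrow> \<epsilon> \<le> \<Psi> x \<Longrightarrow> 0 < \<Phi> x"
  obtains m where "0 < m" "\<And>x. x \<in> coord_box z r \<Longrightarrow> \<epsilon> \<le> \<Psi> x \<Longrightarrow> m \<le> \<Phi> x"
proof (rule ccontr)
  assume "\<not> thesis"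
  then have "\<exists>x\<in>coord_box z r. \<epsilon> \<le> \<Psi> x \<and> \<Phi> x \<le> inverse (real (Suc n))" for n
    using that[of "inverse (real (Suc n))"]
    by (meson linear inverse_positive_iff_positive of_nat_0_less_iff zero_less_Suc)
  then obtain X where X: "\<And>n. X n \<in> coord_box z r"
    "\<And>n. \<epsilon> \<le> \<Psi> (X n)" "\<And>n. \<Phi> (X n) \<le> inverse (real (Suc n))" by metis
  obtain s z' where s: "strict_mono (s :: nat \<Rightarrow> nat)" "z' \<in> coord_box z r"
    "\<And>c. c \<in> I \<Longrightarrow> (\<lambda>n. c (X (s n))) \<longlonglongrightarrow> c z'"
    using coord_box_subsequence[of X z r] X(1) by blast
  have "\<epsilon> \<le> \<Psi> z'"
    by (rule tendsto_lowerbound[OF coord_cont_tendsto[OF \<Psi> s(3)]]) (use X(2) in auto)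
  moreover have "(\<lambda>n. inverse (real (Suc (s n)))) \<longlonglongrightarrow> 0"
    using LIMSEQ_subseq_LIMSEQ[OF LIMSEQ_inverse_real_of_nat s(1)] by (simp add: o_def)
  then have "\<Phi> z' \<le> 0"
    by (rule tendsto_le[OF sequentially_bot _ coord_cont_tendsto[OF \<Phi> s(3)]])
      (use X(3) in auto)
  ultimately show False using pos[OF s(2)] by linarith
qed

text \<open>On the faces of the box \<open>W\<close> exceeds \<open>W z\<close> by some
  \<open>m > 0\<close>, so a path starting with \<open>W\<close> below \<open>W z + m\<close> cannot
  reach a face. Monotonicity of \<open>W\<close> is available only as long as the path has stayed in
  the box, hence the argument is made at the first hitting time.\<close>

lemma lyapunov_stability:
  assumes W: "coord_cont W" and r: "0 < r"
    and W_min: "\<And>x. x \<in> coord_box z r \<Longrightarrow> (\<exists>c\<in>I. c x \<noteq> c z) \<Longrightarrow> W z < W x"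
  obtains \<delta> where "0 < \<delta>"
    "\<And>(X :: real \<Rightarrow> 'a) t. (\<And>c. c \<in> I \<Longrightarrow> continuous_on {0..} (\<lambda>t. c (X t)))
      \<Longrightarrow> (\<And>T. 0 \<le> T \<Longrightarrow> (\<And>t. t \<in> {0..T} \<Longrightarrow> X t \<in> coord_box z r) \<Longrightarrow> W (X T) \<le> W (X 0))
      \<Longrightarrow> (\<And>c. c \<in> I \<Longrightarrow> \<bar>c (X 0) - c z\<bar> < \<delta>) \<Longrightarrow> 0 \<le> t \<Longrightarrow> X t \<in> coord_box z r"
proof -
  have "\<exists>m>0. \<forall>x\<in>coord_box z r. r \<le> \<bar>c x - c z\<bar> \<longrightarrow> m \<le> W x - W z" if c: "c \<in> I" for c
  proof -
    have "coord_cont (\<lambda>x. W x - W z)" "coord_cont (\<lambda>x. \<bar>c x - c z\<bar>)"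
      using W c unfolding coord_cont_def by (auto intro!: tendsto_intros intro: tendsto_coord)
    from coord_cont_lower_bound_on_box[OF this, of z r r] show ?thesis
      using W_min r c by (metis abs_zero diff_gt_0_iff_gt diff_self not_le)
  qed
  then obtain m' where m': "\<And>c. c \<in> I \<Longrightarrow> 0 < m' c"
    "\<And>c x. c \<in> I \<Longrightarrow> x \<in> coord_box z r \<Longrightarrow> r \<le> \<bar>c x - c z\<bar> \<Longrightarrow> m' c \<le> W x - W z"
    by metis
  \<comment> \<open>The extra element 1 keeps the minimum defined when there are no
    coordinates.\<close>
  define m where "m = Min (insert 1 (m' ` I))"
  have "m > 0" and "\<And>c. c \<in> I \<Longrightarrow> m \<le> m' c"
    using finite_coords m'(1) by (auto simp: m_def)
  then have m: "m > 0" "\<And>c x. c \<in> I \<Longrightarrow> x \<in> coord_box z r \<Longrightarrow> r \<le> \<bar>c x - c z\<bar> \<Longrightarrow> m \<le> W x - W z"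
    using m'(2) by (auto intro: order_trans)
  have "eventually (\<lambda>x. W x < W z + m) (cnhds z)"
    using W m(1) unfolding coord_cont_def by (intro order_tendstoD[of W "W z"]) auto
  then obtain \<delta>' where \<delta>': "\<delta>' > 0" "\<And>x. (\<forall>c\<in>I. \<bar>c x - c z\<bar> < \<delta>') \<Longrightarrow> W x < W z + m"
    unfolding eventually_cnhds by blast
  show ?thesis
  proof (rule that[of "min r \<delta>'"])
    show "0 < min r \<delta>'" using r \<delta>' by simp
    fix X :: "real \<Rightarrow> 'a" and t1 :: real
    assume cont: "\<And>c. c \<in> I \<Longrightarrow> continuous_on {0..} (\<lambda>t. c (X t))"
      and decr: "\<And>T. 0 \<le> T \<Longrightarrow> (\<And>t. t \<in> {0..T} \<Longrightarrow> X t \<in> coord_box z r) \<Longrightarrow> W (X T) \<le> W (X 0)"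
      and init: "\<And>c. c \<in> I \<Longrightarrow> \<bar>c (X 0) - c z\<bar> < min r \<delta>'" and t1: "0 \<le> t1"
    have cont': "continuous_on {0..T} (\<lambda>t. \<bar>c (X t) - c z\<bar>)" if "c \<in> I" for c T
      by (intro continuous_intros continuous_on_subset[OF cont[OF that]]) auto
    show "X t1 \<in> coord_box z r"
    proof (rule ccontr)
      assume "\<not> ?thesis"
      then obtain c1 where c1: "c1 \<in> I" "r < \<bar>c1 (X t1) - c1 z\<bar>" by (auto simp: coord_box_def not_le)
      \<comment> \<open>All times up to \<open>t1\<close> at which some coordinate is on or beyond
        its face. The set is closed and nonempty, so its infimum is the first hitting time.\<close>
      define S where "S = (\<Union>c\<in>I. {t \<in> {0..t1}. r \<le> \<bar>c (X t) - c z\<bar>})"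
      have "closed {t \<in> {0..t1}. r \<le> \<bar>c (X t) - c z\<bar>}" if "c \<in> I" for c
        using continuous_closed_preimage[OF cont'[OF that] _ closed_atLeast[of r], of t1]
        by (simp add: vimage_def Int_def)
      then have "closed S" unfolding S_def by (intro closed_UN finite_coords) auto
      moreover have "t1 \<in> S" using c1 t1 by (auto simp: S_def intro!: bexI[of _ c1])
      moreover have bdd: "bdd_below S" by (rule bdd_belowI[of _ 0]) (auto simp: S_def)
      ultimately have t0S: "Inf S \<in> S" by (intro closed_contains_Inf) auto
      define t0 where "t0 = Inf S"
      obtain c0 where c0: "c0 \<in> I" "r \<le> \<bar>c0 (X t0) - c0 z\<bar>" and t0: "0 \<le> t0" "t0 \<le> t1"
        using t0S by (auto simp: S_def t0_def)
      have before: "\<bar>c (X t) - c z\<bar> < r" if "c \<in> I" "0 \<le> t" "t < t0" for c t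
      proof (rule ccontr)
        assume "\<not> ?thesis"
        then have "t \<in> S" using that t0 by (auto simp: S_def intro!: bexI[of _ c])
        then show False using cInf_lower[OF _ bdd, of t] that by (simp add: t0_def)
      qed
      \<comment> \<open>A coordinate strictly beyond its face at \<open>t0\<close> would have
        crossed the face earlier by the intermediate value theorem; hence the path is still in the
        closed box at \<open>t0\<close> and monotonicity applies up to that time.\<close>
      have at0: "\<bar>c (X t0) - c z\<bar> \<le> r" if c: "c \<in> I" for c
      proof (rule ccontr)
        assume n: "\<not> ?thesis"
        have "\<exists>t\<ge>0. t \<le> t0 \<and> \<bar>c (X t) - c z\<bar> = r"
          by (rule IVT') (use n init[OF c] t0 cont'[OF c] in auto)
        then obtain t where t: "t \<ge> 0" "t \<le> t0" "\<bar>c (X t) - c z\<bar> = r" by blast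
        then have "t = t0" using before[OF c, of t] by force
        then show False using t n by simp
      qed
      have inbox: "X t \<in> coord_box z r" if "t \<in> {0..t0}" for t
        using that before at0 by (cases "t = t0") (auto simp: coord_box_def intro: less_imp_le)
      have "W (X t0) \<le> W (X 0)" by (rule decr[OF t0(1) inbox])
      also have "\<dots> < W z + m" by (rule \<delta>'(2)) (use init in auto)
      finally show False using m(2)[OF c0(1) inbox c0(2)] t0 by auto
    qed
  qed
qed

lemma lipschitz_path_uniformly_continuous:
  assumes \<Phi>: "coord_cont \<Phi>" and box: "\<And>t. t \<in> S \<Longrightarrow> X t \<in> coord_box z r"
    and L: "\<And>c s t. c \<in> I \<Longrightarrow> s \<in> S \<Longrightarrow> t \<in> S \<Longrightarrow> \<bar>c (X t) - c (X s)\<bar> \<le> L * \<bar>t - s\<bar>"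
  shows "uniformly_continuous_on (S :: real set) (\<lambda>t. \<Phi> (X t))"
  unfolding uniformly_continuous_on_def dist_real_def
proof (intro allI impI)
  fix e :: real assume "e > 0"
  then obtain \<delta> where \<delta>: "0 < \<delta>" "\<And>x y. x \<in> coord_box z r \<Longrightarrow> y \<in> coord_box z r
    \<Longrightarrow> (\<And>c. c \<in> I \<Longrightarrow> \<bar>c x - c y\<bar> < \<delta>) \<Longrightarrow> \<bar>\<Phi> x - \<Phi> y\<bar> < e"
    using coord_cont_uniform_on_box[OF \<Phi>] by blast
  have pos: "\<bar>L\<bar> + 1 > 0" by linarith
  have "\<bar>\<Phi> (X t) - \<Phi> (X s)\<bar> < e" if "s \<in> S" "t \<in> S" "\<bar>t - s\<bar> < \<delta> / (\<bar>L\<bar> + 1)" for s t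
  proof (rule \<delta>(2)[OF box box])
    fix c assume c: "c \<in> I"
    have "\<bar>c (X t) - c (X s)\<bar> \<le> L * \<bar>t - s\<bar>" by (rule L) fact+
    also have "\<dots> \<le> (\<bar>L\<bar> + 1) * \<bar>t - s\<bar>" by (rule mult_right_mono) auto
    also have "\<dots> < \<delta>" using that(3) pos by (simp add: pos_less_divide_eq mult.commute)
    finally show "\<bar>c (X t) - c (X s)\<bar> < \<delta>" .
  qed fact+
  then show "\<exists>d>0. \<forall>x\<in>S. \<forall>x'\<in>S. \<bar>x' - x\<bar> < d \<longrightarrow> \<bar>\<Phi> (X x') - \<Phi> (X x)\<bar> < e"
    using \<delta>(1) pos by (intro exI[of _ "\<delta> / (\<bar>L\<bar> + 1)"]) auto
qed

end

section \<open>Asymptotically autonomous systems\<close>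

text \<open>\<open>compact\<close> in (A1) and \<open>open\<close> in the passivity notion refer to
  the product topology on functions, where convergence is pointwise. On \<open>vspace n\<close> this
  is Euclidean convergence, since the remaining entries are constantly 0.\<close>

lemma tendsto_fun_iff:
  fixes f :: "'t \<Rightarrow> 'i \<Rightarrow> 'b::topological_space"
  shows "(f \<longlongrightarrow> l) F \<longleftrightarrow> (\<forall>i. ((\<lambda>t. f t i) \<longlongrightarrow> l i) F)"
proof -
  have "(f \<longlongrightarrow> l) F \<longleftrightarrow> limitin (product_topology (\<lambda>_. euclidean) UNIV) f l F"
    by (simp add: euclidean_product_topology)
  also have "\<dots> \<longleftrightarrow> (\<forall>i. ((\<lambda>t. f t i) \<longlongrightarrow> l i) F)"
    by (subst limitin_componentwise) simp
  finally show ?thesis .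
qed

lemma compact_PiE_UNIV:
  assumes "\<And>i. compact (S i)"
  shows "compact (PiE UNIV S)"
proof -
  have "compactin (product_topology (\<lambda>_. euclidean) UNIV) (PiE UNIV S)"
    using assms by (subst compactin_PiE) auto
  then show ?thesis by (simp add: euclidean_product_topology)
qed

lemma trunc_in_vspace [simp]: "trunc n x \<in> vspace n"
  by (simp add: trunc_def vspace_def)

lemma vspace_eqI: "x \<in> vspace n \<Longrightarrow> y \<in> vspace n \<Longrightarrow> (\<And>k. k < n \<Longrightarrow> x k = y k) \<Longrightarrow> x = y"
  unfolding vspace_def fun_eq_iff by (metis (mono_tags, lifting) mem_Collect_eq not_less)

lemma vdist_nonneg [simp]: "0 \<le> vdist n x y"
  by (simp add: vdist_def sum_nonneg)

lemma vdist_self [simp]: "vdist n x x = 0"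
  by (simp add: vdist_def)

lemma vdist_power2: "(vdist n x y)\<^sup>2 = (\<Sum>k<n. (x k - y k)\<^sup>2)"
  by (simp add: vdist_def sum_nonneg)

lemma abs_le_vdist: "k < n \<Longrightarrow> \<bar>x k - y k\<bar> \<le> vdist n x y"
  unfolding vdist_def
  by (rule real_le_rsqrt) (auto intro!: member_le_sum)

lemma vdist_pos: "k < n \<Longrightarrow> x k \<noteq> y k \<Longrightarrow> 0 < vdist n x y"
  using abs_le_vdist[of k n x y] by linarith

lemma tendsto_vdist_0:
  assumes "\<And>k. k < n \<Longrightarrow> ((\<lambda>t. a t k) \<longlongrightarrow> b k) F"
  shows "((\<lambda>t. vdist n (a t) b) \<longlongrightarrow> 0) F"
proof -
  have "((\<lambda>t. vdist n (a t) b) \<longlongrightarrow> vdist n b b) F"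
    unfolding vdist_def by (intro tendsto_intros assms) auto
  then show ?thesis by simp
qed

lemma lipschitz_f_tendsto:
  assumes lip: "lipschitz_f n G" and "\<And>t. a t \<in> vspace n" "b \<in> vspace n"
    and lim: "\<And>k. k < n \<Longrightarrow> ((\<lambda>t. a t k) \<longlongrightarrow> b k) F" "(u \<longlongrightarrow> v) F" and k: "k < n"
  shows "((\<lambda>t. G (a t) (u t) k) \<longlongrightarrow> G b v k) F"
proof -
  obtain L where L: "\<And>x y u v. x \<in> vspace n \<Longrightarrow> y \<in> vspace n \<Longrightarrow>
      vdist n (G x u) (G y v) \<le> L * sqrt ((vdist n x y)^2 + (u - v)^2)"
    using lip unfolding lipschitz_f_def by blast
  have "((\<lambda>t. L * sqrt ((vdist n (a t) b)^2 + (u t - v)^2)) \<longlongrightarrow> L * sqrt (0^2 + (v - v)^2)) F"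
    by (intro tendsto_intros tendsto_vdist_0 lim)
  then have lim0: "((\<lambda>t. L * sqrt ((vdist n (a t) b)^2 + (u t - v)^2)) \<longlongrightarrow> 0) F" by simp
  have le: "\<bar>G (a t) (u t) k - G b v k\<bar> \<le> L * sqrt ((vdist n (a t) b)^2 + (u t - v)^2)" for t
    using abs_le_vdist[OF k, of "G (a t) (u t)" "G b v"] L[of "a t" b "u t" v] assms(2,3)
    by (meson order_trans)
  have "((\<lambda>t. G (a t) (u t) k - G b v k) \<longlongrightarrow> 0) F"
    by (rule Lim_null_comparison[OF _ lim0]) (simp add: le)
  then show ?thesis by (simp add: LIM_zero_iff)
qed

lemma lipschitz_g_tendsto:
  assumes lip: "lipschitz_g n G" and "\<And>t. a t \<in> vspace n" "b \<in> vspace n"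
    and lim: "\<And>k. k < n \<Longrightarrow> ((\<lambda>t. a t k) \<longlongrightarrow> b k) F" "(u \<longlongrightarrow> v) F"
  shows "((\<lambda>t. G (a t) (u t)) \<longlongrightarrow> G b v) F"
proof -
  obtain L where L: "\<And>x y u v. x \<in> vspace n \<Longrightarrow> y \<in> vspace n \<Longrightarrow>
      \<bar>G x u - G y v\<bar> \<le> L * sqrt ((vdist n x y)^2 + (u - v)^2)"
    using lip unfolding lipschitz_g_def by blast
  have "((\<lambda>t. L * sqrt ((vdist n (a t) b)^2 + (u t - v)^2)) \<longlongrightarrow> L * sqrt (0^2 + (v - v)^2)) F"
    by (intro tendsto_intros tendsto_vdist_0 lim)
  then have lim0: "((\<lambda>t. L * sqrt ((vdist n (a t) b)^2 + (u t - v)^2)) \<longlongrightarrow> 0) F" by simp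
  have le: "\<bar>G (a t) (u t) - G b v\<bar> \<le> L * sqrt ((vdist n (a t) b)^2 + (u t - v)^2)" for t
    using L assms(2,3) by blast
  have "((\<lambda>t. G (a t) (u t) - G b v) \<longlongrightarrow> 0) F"
    by (rule Lim_null_comparison[OF _ lim0]) (simp add: le)
  then show ?thesis by (simp add: LIM_zero_iff)
qed

section \<open>Continuity and chain rule for storage functions\<close>

lemma C1_with_grad_approx:
  assumes "C1_with_grad n V G" "x \<in> vspace n" "0 < \<epsilon>"
  shows "\<exists>\<delta>>0. \<forall>y\<in>vspace n. vdist n y x < \<delta>
    \<longrightarrow> \<bar>V y - V x - (\<Sum>k<n. G x k * (y k - x k))\<bar> \<le> \<epsilon> * vdist n y x"
  by (rule assms(1)[unfolded C1_with_grad_def, THEN conjunct1, rule_format]) fact+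

lemma C1_with_grad_gradient_approx:
  assumes "C1_with_grad n V G" "x \<in> vspace n" "0 < \<epsilon>"
  shows "\<exists>\<delta>>0. \<forall>y\<in>vspace n. vdist n y x < \<delta> \<longrightarrow> (\<forall>k<n. \<bar>G y k - G x k\<bar> < \<epsilon>)"
  by (rule assms(1)[unfolded C1_with_grad_def, THEN conjunct2, rule_format]) fact+

lemma C1_with_grad_gradient_tendsto:
  assumes C1: "C1_with_grad n V G" and vs: "\<And>t. a t \<in> vspace n" "b \<in> vspace n"
    and lim: "\<And>k. k < n \<Longrightarrow> ((\<lambda>t. a t k) \<longlongrightarrow> b k) F" and k: "k < n"
  shows "((\<lambda>t. G (a t) k) \<longlongrightarrow> G b k) F"
proof (rule tendstoI)
  fix e :: real assume "e > 0"
  obtain \<delta> where \<delta>: "\<delta> > 0"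
    "\<forall>y\<in>vspace n. vdist n y b < \<delta> \<longrightarrow> (\<forall>k<n. \<bar>G y k - G b k\<bar> < e)"
    using C1_with_grad_gradient_approx[OF C1 vs(2) \<open>e > 0\<close>] by (elim exE conjE)
  have "eventually (\<lambda>t. vdist n (a t) b < \<delta>) F"
    using tendsto_vdist_0[OF lim] \<delta>(1) by (rule order_tendstoD)
  then show "eventually (\<lambda>t. dist (G (a t) k) (G b k) < e) F"
    by eventually_elim (use \<delta>(2) vs(1) k in \<open>simp add: dist_real_def\<close>)
qed

lemma C1_with_grad_tendsto:
  assumes C1: "C1_with_grad n V G" and vs: "\<And>t. a t \<in> vspace n" "b \<in> vspace n"
    and lim: "\<And>k. k < n \<Longrightarrow> ((\<lambda>t. a t k) \<longlongrightarrow> b k) F"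
  shows "((\<lambda>t. V (a t)) \<longlongrightarrow> V b) F"
proof -
  obtain \<delta> where \<delta>: "\<delta> > 0" "\<forall>y\<in>vspace n. vdist n y b < \<delta> \<longrightarrow>
      \<bar>V y - V b - (\<Sum>k<n. G b k * (y k - b k))\<bar> \<le> 1 * vdist n y b"
    using C1_with_grad_approx[OF C1 vs(2) zero_less_one] by (elim exE conjE)
  have ev: "eventually (\<lambda>t. vdist n (a t) b < \<delta>) F"
    using tendsto_vdist_0[OF lim] \<delta>(1) by (rule order_tendstoD)
  have "((\<lambda>t. \<bar>\<Sum>k<n. G b k * (a t k - b k)\<bar> + vdist n (a t) b) \<longlongrightarrow> \<bar>\<Sum>k<n. G b k * (b k - b k)\<bar> + 0) F"
    by (intro tendsto_intros tendsto_vdist_0 lim) auto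
  then have lim0: "((\<lambda>t. \<bar>\<Sum>k<n. G b k * (a t k - b k)\<bar> + vdist n (a t) b) \<longlongrightarrow> 0) F" by simp
  have "eventually (\<lambda>t. norm (V (a t) - V b) \<le> \<bar>\<Sum>k<n. G b k * (a t k - b k)\<bar> + vdist n (a t) b) F"
    using ev
  proof eventually_elim
    case (elim t)
    then show ?case using \<delta>(2)[rule_format, OF vs(1) elim] by simp
  qed
  then have "((\<lambda>t. V (a t) - V b) \<longlongrightarrow> 0) F" by (rule Lim_null_comparison[OF _ lim0])
  then show ?thesis by (simp add: LIM_zero_iff)
qed

lemma C1_with_grad_chain:
  assumes C1: "C1_with_grad n V G" and vs: "\<And>t. a t \<in> vspace n"
    and der: "\<And>k. k < n \<Longrightarrow> ((\<lambda>s. a s k) has_real_derivative d k) (at t)"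
  shows "((\<lambda>s. V (a s)) has_real_derivative (\<Sum>k<n. G (a t) k * d k)) (at t)"
proof -
  let ?q = "\<lambda>s k. (a s k - a t k) / (s - t)"
  have q: "((\<lambda>s. ?q s k) \<longlongrightarrow> d k) (at t)" if "k < n" for k
    using der[OF that] by (simp add: has_field_derivative_iff)
  have lim: "((\<lambda>s. a s k) \<longlongrightarrow> a t k) (at t)" if "k < n" for k
    using DERIV_isCont[OF der[OF that]] by (simp add: isCont_def)
  have vq: "vdist n (a s) (a t) = \<bar>s - t\<bar> * sqrt (\<Sum>k<n. (?q s k)\<^sup>2)" if "s \<noteq> t" for s
  proof -
    have "(\<Sum>k<n. (a s k - a t k)\<^sup>2) = (s - t)\<^sup>2 * (\<Sum>k<n. (?q s k)\<^sup>2)"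
      using that by (simp add: sum_distrib_left power_divide)
    then show ?thesis by (simp add: vdist_def real_sqrt_mult)
  qed
  \<comment> \<open>Any number above the speed of the curve at \<open>t\<close>: near
    \<open>t\<close> the distance travelled is at most \<open>K\<close> times the elapsed time, so
    the remainder of the linear approximation is negligible after division by
    \<open>s - t\<close>.\<close>
  define K where "K = sqrt (\<Sum>k<n. (d k)\<^sup>2) + 1"
  have "((\<lambda>s. sqrt (\<Sum>k<n. (?q s k)\<^sup>2)) \<longlongrightarrow> sqrt (\<Sum>k<n. (d k)\<^sup>2)) (at t)"
    by (intro tendsto_intros q) auto
  then have evK: "eventually (\<lambda>s. sqrt (\<Sum>k<n. (?q s k)\<^sup>2) < K) (at t)"
    by (rule order_tendstoD) (simp add: K_def)
  have Kpos: "K > 0" by (simp add: K_def add_nonneg_pos sum_nonneg)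
  have "((\<lambda>s. (V (a s) - V (a t)) / (s - t) - (\<Sum>k<n. G (a t) k * ?q s k)) \<longlongrightarrow> 0) (at t)"
  proof (rule tendstoI)
    fix e :: real assume e: "e > 0"
    then have eK: "e / (2 * K) > 0" using Kpos by simp
    obtain \<delta> where \<delta>: "\<delta> > 0" "\<forall>y\<in>vspace n. vdist n y (a t) < \<delta> \<longrightarrow>
      \<bar>V y - V (a t) - (\<Sum>k<n. G (a t) k * (y k - a t k))\<bar> \<le> e / (2 * K) * vdist n y (a t)"
      using C1_with_grad_approx[OF C1 vs[of t] eK] by (elim exE conjE)
    have "eventually (\<lambda>s. vdist n (a s) (a t) < \<delta>) (at t)"
      using tendsto_vdist_0[OF lim] \<delta>(1) by (rule order_tendstoD)
    moreover have "eventually (\<lambda>s. s \<noteq> t) (at t)" by (simp add: eventually_at_filter)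
    ultimately show "eventually (\<lambda>s. dist ((V (a s) - V (a t)) / (s - t) - (\<Sum>k<n. G (a t) k * ?q s k)) 0 < e) (at t)"
      using evK
    proof eventually_elim
      case (elim s)
      have "(V (a s) - V (a t)) / (s - t) - (\<Sum>k<n. G (a t) k * ?q s k) =
        (V (a s) - V (a t) - (\<Sum>k<n. G (a t) k * (a s k - a t k))) / (s - t)"
        by (simp add: diff_divide_distrib sum_divide_distrib right_diff_distrib)
      then have "\<bar>(V (a s) - V (a t)) / (s - t) - (\<Sum>k<n. G (a t) k * ?q s k)\<bar> =
        \<bar>V (a s) - V (a t) - (\<Sum>k<n. G (a t) k * (a s k - a t k))\<bar> / \<bar>s - t\<bar>"
        by (simp add: abs_divide)
      also have "\<dots> \<le> (e / (2 * K) * vdist n (a s) (a t)) / \<bar>s - t\<bar>"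
        by (intro divide_right_mono \<delta>(2)[rule_format] vs elim) auto
      also have "\<dots> = e / (2 * K) * sqrt (\<Sum>k<n. (?q s k)\<^sup>2)"
        using vq[of s] elim by simp
      also have "\<dots> \<le> e / (2 * K) * K"
        using elim e Kpos by (intro mult_left_mono) auto
      also have "\<dots> < e" using e Kpos by simp
      finally show ?case by (simp add: dist_real_def)
    qed
  qed
  moreover have "((\<lambda>s. \<Sum>k<n. G (a t) k * ?q s k) \<longlongrightarrow> (\<Sum>k<n. G (a t) k * d k)) (at t)"
    by (intro tendsto_intros q) auto
  ultimately have "((\<lambda>s. (V (a s) - V (a t)) / (s - t)) \<longlongrightarrow> 0 + (\<Sum>k<n. G (a t) k * d k)) (at t)"
    using tendsto_add by fastforce
  then show ?thesis by (simp add: has_field_derivative_iff)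
qed

section \<open>Gronwall's inequality and limit sets of asymptotically autonomous systems\<close>

lemma gronwall_differential:
  fixes e :: "real \<Rightarrow> real"
  assumes S: "0 \<le> S"
    and der: "\<And>s. 0 \<le> s \<Longrightarrow> s \<le> S \<Longrightarrow> \<exists>d. (e has_real_derivative d) (at s) \<and> d \<le> a * (e s + c)"
  shows "e S + c \<le> (e 0 + c) * exp (a * S)"
proof -
  have "(e S + c) * exp (- a * S) \<le> (e 0 + c) * exp (- a * 0)"
  proof (rule DERIV_nonpos_imp_nonincreasing[OF S])
    fix s assume "0 \<le> s" "s \<le> S"
    then obtain d where d: "(e has_real_derivative d) (at s)" "d \<le> a * (e s + c)" using der by blast
    have "((\<lambda>s. (e s + c) * exp (- a * s)) has_real_derivative (d - a * (e s + c)) * exp (- a * s)) (at s)"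
    proof -
      have "((\<lambda>s. exp (- a * s)) has_real_derivative exp (- a * s) * (- a)) (at s)"
        by (auto intro!: derivative_eq_intros)
      from DERIV_mult[OF DERIV_add[OF d(1) DERIV_const[of c]] this]
      show ?thesis by (simp add: algebra_simps)
    qed
    moreover have "(d - a * (e s + c)) * exp (- a * s) \<le> 0"
      using d(2) by (intro mult_nonpos_nonneg) auto
    ultimately show "\<exists>y. ((\<lambda>s. (e s + c) * exp (- a * s)) has_real_derivative y) (at s) \<and> y \<le> 0" by blast
  qed
  then have "(e S + c) * exp (- a * S) * exp (a * S) \<le> (e 0 + c) * exp (a * S)"
    by (intro mult_right_mono) auto
  moreover have "(e S + c) * exp (- a * S) * exp (a * S) = e S + c"
    by (simp add: exp_minus mult.assoc)
  ultimately show ?thesis by (simp only:)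
qed

lemma vdist_inner_le:
  "\<bar>\<Sum>k<n. (x k - y k) * (v k - w k)\<bar> \<le> vdist n x y * vdist n v w"
proof -
  have "\<bar>\<Sum>k<n. (x k - y k) * (v k - w k)\<bar> \<le> (\<Sum>k<n. \<bar>x k - y k\<bar> * \<bar>v k - w k\<bar>)"
    by (rule order_trans[OF sum_abs]) (simp add: abs_mult)
  also have "\<dots> \<le> L2_set (\<lambda>k. x k - y k) {..<n} * L2_set (\<lambda>k. v k - w k) {..<n}"
    by (rule L2_set_mult_ineq)
  finally show ?thesis by (simp add: vdist_def L2_set_def)
qed

text \<open>By Gronwall's inequality, the limit set of a bounded solution of an asymptotically autonomous system is invariant under
  the limiting autonomous system; so it consists of equilibria as soon as compact invariant sets do.\<close>

lemma asymptotically_autonomous_limit_equilibrium: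
  fixes z :: "real \<Rightarrow> nat \<Rightarrow> real" and u :: "real \<Rightarrow> real"
  assumes lip: "lipschitz_f n G" and z: "\<And>t. z t \<in> vspace n"
    and der: "\<And>t k. 0 < t \<Longrightarrow> k < n \<Longrightarrow> ((\<lambda>s. z s k) has_real_derivative G (z t) (u t) k) (at t)"
    and u: "(u \<longlongrightarrow> v) at_top"
    and bounded: "\<And>t k. 0 \<le> t \<Longrightarrow> k < n \<Longrightarrow> \<bar>z t k\<bar> \<le> R"
    and inv: "\<And>C. C \<subseteq> vspace n \<Longrightarrow> compact C \<Longrightarrow> sub_invariant n (\<lambda>x. G x v) C \<Longrightarrow>
               (\<forall>x\<in>C. sub_equilibrium n (\<lambda>x. G x v) x)"
    and \<tau>: "filterlim \<tau> at_top sequentially" and b: "b \<in> vspace n"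
    and lim: "\<And>k. k < n \<Longrightarrow> (\<lambda>i::nat. z (\<tau> i) k) \<longlonglongrightarrow> b k" and k: "k < n"
  shows "G b v k = 0"
proof -
  \<comment> \<open>The omega-limit set, written as an intersection of closed tails so that
    closedness is immediate; \<open>limC\<close> and \<open>Cseq\<close> give its description by
    sequences of times.\<close>
  define C where "C = (\<Inter>m::nat. closure (z ` {real m..}))"
  have limC: "l \<in> C"
    if \<sigma>: "filterlim \<sigma> at_top sequentially" and l: "l \<in> vspace n"
      and zl: "\<And>k. k < n \<Longrightarrow> (\<lambda>i::nat. z (\<sigma> i) k) \<longlonglongrightarrow> l k" for \<sigma> l
    unfolding C_def
  proof
    fix m :: nat
    have "(\<lambda>i. z (\<sigma> i) k) \<longlonglongrightarrow> l k" for k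
    proof (cases "k < n")
      case False
      then have "z (\<sigma> i) k = l k" for i using z[of "\<sigma> i"] l by (simp add: vspace_def)
      then show ?thesis by simp
    qed (rule zl)
    then have "(\<lambda>i. z (\<sigma> i)) \<longlonglongrightarrow> l" by (simp add: tendsto_fun_iff)
    moreover have "eventually (\<lambda>i. real m \<le> \<sigma> i) sequentially"
      using \<sigma> by (simp add: filterlim_at_top)
    then have "eventually (\<lambda>i. z (\<sigma> i) \<in> closure (z ` {real m..})) sequentially"
      by eventually_elim (use closure_subset in fastforce)
    ultimately show "l \<in> closure (z ` {real m..})"
      by (intro Lim_in_closed_set[OF closed_closure]) auto
  qed
  have Cseq: "\<exists>\<sigma>. filterlim \<sigma> at_top sequentially \<and> (\<forall>k. (\<lambda>i::nat. z (\<sigma> i) k) \<longlonglongrightarrow> l k)" if l: "l \<in> C" for l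
  proof -
    have "\<exists>t\<ge>real m. dist (z t) l < inverse (real (Suc m))" for m
    proof -
      have "l \<in> closure (z ` {real m..})" using l by (simp add: C_def)
      then obtain y where "y \<in> z ` {real m..}" "dist y l < inverse (real (Suc m))"
        unfolding closure_approachable by (meson inverse_positive_iff_positive of_nat_0_less_iff zero_less_Suc)
      then show ?thesis by auto
    qed
    then obtain \<sigma> where \<sigma>: "\<And>m::nat. real m \<le> \<sigma> m" "\<And>m. dist (z (\<sigma> m)) l < inverse (real (Suc m))" by metis
    have "(\<lambda>m. dist (z (\<sigma> m)) l) \<longlonglongrightarrow> 0"
      by (rule Lim_null_comparison[OF _ LIMSEQ_inverse_real_of_nat])
        (use \<sigma>(2) in \<open>auto intro!: always_eventually less_imp_le\<close>)
    then have "(\<lambda>m. z (\<sigma> m)) \<longlonglongrightarrow> l" by (rule tendsto_dist_iff[THEN iffD2])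
    moreover have "filterlim \<sigma> at_top sequentially"
      by (rule filterlim_at_top_mono[OF filterlim_real_sequentially]) (use \<sigma>(1) in auto)
    ultimately show ?thesis by (auto simp: tendsto_fun_iff)
  qed
  define Box where "Box = PiE UNIV (\<lambda>k. if k < n then {- R..R} else {0})"
  have "compact Box" unfolding Box_def by (rule compact_PiE_UNIV) auto
  have zBox: "z t \<in> Box" if "0 \<le> t" for t
    using bounded[OF that] z[of t] by (auto simp: Box_def vspace_def PiE_iff abs_le_iff minus_le_iff)
  have "closure (z ` {real 0..}) \<subseteq> Box"
    by (rule closure_minimal) (use zBox compact_imp_closed[OF \<open>compact Box\<close>] in auto)
  then have CBox: "C \<subseteq> Box" unfolding C_def by blast
  have "closed C" unfolding C_def by (intro closed_INT) auto
  then have "compact (Box \<inter> C)" using \<open>compact Box\<close> by (rule compact_Int_closed[rotated])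
  then have compC: "compact C" using CBox by (simp add: Int_absorb1)
  have "x k = 0" if "x \<in> C" "n \<le> k" for x k
    using subsetD[OF CBox that(1)] that(2) by (auto simp: Box_def PiE_iff dest: spec[of _ k])
  then have Cvs: "C \<subseteq> vspace n" by (auto simp: vspace_def)
  obtain L' where L': "\<And>x y u v. x \<in> vspace n \<Longrightarrow> y \<in> vspace n \<Longrightarrow>
      vdist n (G x u) (G y v) \<le> L' * sqrt ((vdist n x y)^2 + (u - v)^2)"
    using lip unfolding lipschitz_f_def by blast
  define L where "L = \<bar>L'\<bar>"
  have L: "L \<ge> 0" "\<And>x y u v. x \<in> vspace n \<Longrightarrow> y \<in> vspace n \<Longrightarrow>
      vdist n (G x u) (G y v) \<le> L * sqrt ((vdist n x y)^2 + (u - v)^2)"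
  proof -
    fix x y u v assume "x \<in> vspace n" "y \<in> vspace n"
    then have "vdist n (G x u) (G y v) \<le> L' * sqrt ((vdist n x y)^2 + (u - v)^2)" by (rule L')
    also have "\<dots> \<le> L * sqrt ((vdist n x y)^2 + (u - v)^2)"
      by (rule mult_right_mono) (auto simp: L_def)
    finally show "vdist n (G x u) (G y v) \<le> L * sqrt ((vdist n x y)^2 + (u - v)^2)" .
  qed (simp add: L_def)
  have "sub_invariant n (\<lambda>x. G x v) C"
    unfolding sub_invariant_def
  proof (intro allI impI, elim conjE)
    fix \<phi> s assume \<phi>: "sub_solution n (\<lambda>x. G x v) \<phi>" and "\<phi> 0 \<in> C"
    have \<phi>vs: "\<And>t. \<phi> t \<in> vspace n"
      and \<phi>der: "\<And>t k. k < n \<Longrightarrow> ((\<lambda>s. \<phi> s k) has_real_derivative G (\<phi> t) v k) (at t)"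
      using \<phi> by (auto simp: sub_solution_def)
    obtain \<sigma> where \<sigma>: "filterlim \<sigma> at_top sequentially" and z\<sigma>: "\<And>k. (\<lambda>i::nat. z (\<sigma> i) k) \<longlonglongrightarrow> \<phi> 0 k"
      using Cseq[OF \<open>\<phi> 0 \<in> C\<close>] by blast
    \<comment> \<open>Squared distance between the solution restarted at time
      \<open>\<sigma> i\<close> and the limiting solution \<open>\<phi>\<close>. Here
      \<open>r\<close> may be negative, since invariance concerns both time directions; accordingly
      the next bound controls the absolute value of the derivative.\<close>
    define e where "e i r = (\<Sum>k<n. (z (\<sigma> i + r) k - \<phi> r k)\<^sup>2)" for i r
    have e_der: "\<exists>d. (e i has_real_derivative d) (at r) \<and> \<bar>d\<bar> \<le> 2 * L * (e i r + c\<^sup>2)"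
      if r: "0 < \<sigma> i + r" "\<bar>u (\<sigma> i + r) - v\<bar> \<le> c" for i r c
    proof -
      define d where "d = (\<Sum>k<n. 2 * ((z (\<sigma> i + r) k - \<phi> r k) * (G (z (\<sigma> i + r)) (u (\<sigma> i + r)) k - G (\<phi> r) v k)))"
      have zd: "((\<lambda>r. z (\<sigma> i + r) k) has_real_derivative G (z (\<sigma> i + r)) (u (\<sigma> i + r)) k) (at r)" if "k < n" for k
        using der[OF r(1) that] by (simp add: DERIV_shift add.commute)
      have "(e i has_real_derivative d) (at r)"
        unfolding e_def d_def
      proof (rule DERIV_sum)
        fix k assume "k \<in> {..<n}"
        then have "k < n" by simp
        from DERIV_power[OF DERIV_diff[OF zd[OF this] \<phi>der[OF this]], of 2]
        show "((\<lambda>r. (z (\<sigma> i + r) k - \<phi> r k)\<^sup>2) has_real_derivative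
          2 * ((z (\<sigma> i + r) k - \<phi> r k) * (G (z (\<sigma> i + r)) (u (\<sigma> i + r)) k - G (\<phi> r) v k))) (at r)"
          by (simp add: mult_ac)
      qed
      moreover have "\<bar>d\<bar> \<le> 2 * L * (e i r + c\<^sup>2)"
      proof -
        define w where "w = vdist n (z (\<sigma> i + r)) (\<phi> r)"
        have w2: "w\<^sup>2 = e i r" by (simp add: w_def vdist_power2 e_def)
        have c2: "(u (\<sigma> i + r) - v)\<^sup>2 \<le> c\<^sup>2" using r(2) by (simp add: abs_le_square_iff[symmetric])
        have "\<bar>d\<bar> = 2 * \<bar>\<Sum>k<n. (z (\<sigma> i + r) k - \<phi> r k) * (G (z (\<sigma> i + r)) (u (\<sigma> i + r)) k - G (\<phi> r) v k)\<bar>"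
          unfolding d_def sum_distrib_left[symmetric] by (simp add: abs_mult)
        also have "\<dots> \<le> 2 * (w * vdist n (G (z (\<sigma> i + r)) (u (\<sigma> i + r))) (G (\<phi> r) v))"
          unfolding w_def by (intro mult_left_mono vdist_inner_le) auto
        also have "\<dots> \<le> 2 * (sqrt (w\<^sup>2 + c\<^sup>2) * (L * sqrt (w\<^sup>2 + c\<^sup>2)))"
        proof (intro mult_left_mono mult_mono)
          show "w \<le> sqrt (w\<^sup>2 + c\<^sup>2)" by (rule real_le_rsqrt) simp
          have "vdist n (G (z (\<sigma> i + r)) (u (\<sigma> i + r))) (G (\<phi> r) v) \<le> L * sqrt (w\<^sup>2 + (u (\<sigma> i + r) - v)\<^sup>2)"
            unfolding w_def by (rule L(2)) (auto simp: z \<phi>vs)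
          also have "\<dots> \<le> L * sqrt (w\<^sup>2 + c\<^sup>2)"
            using L(1) c2 by (intro mult_left_mono real_sqrt_le_mono) auto
          finally show "vdist n (G (z (\<sigma> i + r)) (u (\<sigma> i + r))) (G (\<phi> r) v) \<le> L * sqrt (w\<^sup>2 + c\<^sup>2)" .
        qed (auto simp: w_def)
        also have "\<dots> = 2 * L * (w\<^sup>2 + c\<^sup>2)"
        proof -
          have "sqrt (w\<^sup>2 + c\<^sup>2) * sqrt (w\<^sup>2 + c\<^sup>2) = w\<^sup>2 + c\<^sup>2" by simp
          then show ?thesis by (simp add: mult.left_commute mult.assoc)
        qed
        finally show ?thesis using w2 by simp
      qed
      ultimately show ?thesis by blast
    qed
    \<comment> \<open>The offset \<open>c\<^sup>2\<close> absorbs the deviation of the input from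
      its limit. The condition \<open>\<bar>s\<bar> < \<sigma> i\<close> keeps the restarted
      solution at positive times, where its equation is known, even when \<open>s\<close> is
      negative.\<close>
    have e_bound: "e i s + c\<^sup>2 \<le> (e i 0 + c\<^sup>2) * exp (2 * L * \<bar>s\<bar>)"
      if T: "\<bar>s\<bar> < \<sigma> i" "\<And>t. \<sigma> i - \<bar>s\<bar> \<le> t \<Longrightarrow> \<bar>u t - v\<bar> \<le> c" for i c
    proof (cases "0 \<le> s")
      case True
      have "e i s + c\<^sup>2 \<le> (e i 0 + c\<^sup>2) * exp (2 * L * s)"
      proof (rule gronwall_differential[OF True])
        fix r assume "0 \<le> r" "r \<le> s"
        then show "\<exists>d. (e i has_real_derivative d) (at r) \<and> d \<le> 2 * L * (e i r + c\<^sup>2)"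
          using e_der[of i r c] T by force
      qed
      then show ?thesis using True by simp
    next
      case False
      \<comment> \<open>Backward times are reduced to forward ones by reflecting
        \<open>r\<close>.\<close>
      have "e i (- (- s)) + c\<^sup>2 \<le> (e i (- 0) + c\<^sup>2) * exp (2 * L * (- s))"
      proof (rule gronwall_differential[where e = "\<lambda>r. e i (- r)"])
        fix r assume r: "0 \<le> r" "r \<le> - s"
        then obtain d where d: "(e i has_real_derivative d) (at (- r))" "\<bar>d\<bar> \<le> 2 * L * (e i (- r) + c\<^sup>2)"
          using e_der[of i "- r" c] T by force
        have "((\<lambda>r. e i (- r)) has_real_derivative - d) (at r)"
          using d(1) by (simp add: DERIV_mirror)
        then show "\<exists>d. ((\<lambda>r. e i (- r)) has_real_derivative d) (at r) \<and> d \<le> 2 * L * (e i (- r) + c\<^sup>2)"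
          using d(2) by (intro exI[of _ "- d"]) auto
      qed (use False in simp)
      then show ?thesis using False by simp
    qed
    have e0: "(\<lambda>i. e i 0) \<longlonglongrightarrow> 0"
    proof -
      have "(\<lambda>i. e i 0) \<longlonglongrightarrow> (\<Sum>k<n. (\<phi> 0 k - \<phi> 0 k)\<^sup>2)"
        unfolding e_def by (intro tendsto_intros) (simp add: z\<sigma>)
      then show ?thesis by simp
    qed
    have es: "(\<lambda>i. e i s) \<longlonglongrightarrow> 0"
    proof (rule tendstoI)
      fix \<epsilon> :: real assume \<epsilon>: "\<epsilon> > 0"
      define K where "K = exp (2 * L * \<bar>s\<bar>)"
      \<comment> \<open>Chosen so that \<open>c\<^sup>2 * K\<close> is half of
        \<open>\<epsilon>\<close>; the initial error \<open>e i 0\<close> is given the other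
        half.\<close>
      define c where "c = sqrt (\<epsilon> / (2 * K))"
      have K: "K > 0" by (simp add: K_def)
      then have c: "c > 0" "c\<^sup>2 = \<epsilon> / (2 * K)" using \<epsilon> by (auto simp: c_def)
      have "eventually (\<lambda>t. \<bar>u t - v\<bar> < c) at_top" using tendstoD[OF u c(1)] by (simp add: dist_real_def)
      then obtain T where T: "\<And>t. T \<le> t \<Longrightarrow> \<bar>u t - v\<bar> < c" by (auto simp: eventually_at_top_linorder)
      have "eventually (\<lambda>i. max (\<bar>s\<bar> + 1) (T + \<bar>s\<bar>) \<le> \<sigma> i) sequentially"
        using \<sigma> unfolding filterlim_at_top by (rule spec)
      moreover have "eventually (\<lambda>i. e i 0 < \<epsilon> / (2 * K)) sequentially"
        using e0 \<epsilon> K by (intro order_tendstoD) auto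
      ultimately show "eventually (\<lambda>i. dist (e i s) 0 < \<epsilon>) sequentially"
      proof eventually_elim
        case (elim i)
        have "e i s + c\<^sup>2 \<le> (e i 0 + c\<^sup>2) * K"
          unfolding K_def by (rule e_bound) (use elim(1) T in \<open>auto intro: less_imp_le\<close>)
        also have "\<dots> < (\<epsilon> / (2 * K) + \<epsilon> / (2 * K)) * K"
          using elim(2) c(2) K by (intro mult_strict_right_mono) auto
        also have "\<dots> = \<epsilon>" using K by simp
        finally have "e i s < \<epsilon>" using zero_le_power2[of c] by linarith
        moreover have "0 \<le> e i s" by (simp add: e_def sum_nonneg)
        ultimately show ?case by simp
      qed
    qed
    show "\<phi> s \<in> C"
    proof (rule limC[where \<sigma> = "\<lambda>i. \<sigma> i + s"])
      show "filterlim (\<lambda>i. \<sigma> i + s) at_top sequentially"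
        using filterlim_tendsto_add_at_top[OF tendsto_const \<sigma>, of s] by (simp add: add.commute)
      fix k assume "k < n"
      have le: "(z (\<sigma> i + s) k - \<phi> s k)\<^sup>2 \<le> e i s" for i
        unfolding e_def using \<open>k < n\<close> by (intro member_le_sum) auto
      have "(\<lambda>i. (z (\<sigma> i + s) k - \<phi> s k)\<^sup>2) \<longlonglongrightarrow> 0"
        by (rule Lim_null_comparison[OF _ es]) (simp add: le)
      then have "(\<lambda>i. z (\<sigma> i + s) k - \<phi> s k) \<longlonglongrightarrow> 0"
        by simp
      then show "(\<lambda>i. z (\<sigma> i + s) k) \<longlonglongrightarrow> \<phi> s k" by (simp add: LIM_zero_iff)
    qed (rule \<phi>vs)
  qed
  with inv[OF Cvs compC] limC[OF \<tau> b lim] k show ?thesis by (auto simp: sub_equilibrium_def)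
qed

section \<open>The network and its energy function\<close>

text \<open>Positive load values occur only at frequencies at or above \<open>whi > 0\<close>,
  negative ones only at or below \<open>wlo < 0\<close>. So every selection, including the interval
  values at the thresholds, has the sign of the frequency and dissipates energy.\<close>

lemma Fdc_bounds:
  assumes "dlo \<le> 0" "0 \<le> dhi" "wlo < 0" "0 < whi" "v \<in> Fdc dlo dhi wlo whi w"
  shows "0 \<le> w * v" "dlo \<le> v" "v \<le> dhi"
  using assms by (auto simp: Fdc_def fc_def mult_nonneg_nonneg mult_nonpos_nonpos split: if_splits)

lemma Fdc_deadband: "wlo < w \<Longrightarrow> w < whi \<Longrightarrow> Fdc dlo dhi wlo whi w = {0}"
  by (auto simp: Fdc_def fc_def)

text \<open>Strict convexity of \<open>- cos\<close> between \<open>- pi / 2\<close> and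
  \<open>pi / 2\<close>: its graph lies above the tangent at \<open>a\<close>. By the mean value
  theorem this comes down to strict monotonicity of \<open>sin\<close>. It makes the line potentials
  minimal at the equilibrium angles.\<close>

lemma neg_cos_strict_tangent:
  assumes "\<bar>a\<bar> < pi / 2" "\<bar>y\<bar> < pi / 2" "y \<noteq> a"
  shows "- cos a - sin a * a < - cos y - sin a * y"
proof -
  have aux: "(cos p - cos q) < sin s * (q - p)"
    if "- (pi / 2) < p" "q < pi / 2" "p < q" "s = q" for p q s :: real
  proof -
    have "\<exists>z>p. z < q \<and> - cos q - (- cos p) = (q - p) * sin z"
      by (rule MVT2) (use that in \<open>auto intro!: derivative_eq_intros\<close>)
    then obtain z where z: "p < z" "z < q" "- cos q - (- cos p) = (q - p) * sin z" by blast
    have "sin z < sin q" using z that by (intro sin_monotone_2pi) auto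
    then have "(q - p) * sin z < (q - p) * sin q" using that by simp
    then show ?thesis using z that by (simp add: mult.commute)
  qed
  have aux2: "sin s * (q - p) < (cos p - cos q)"
    if "- (pi / 2) < p" "q < pi / 2" "p < q" "s = p" for p q s :: real
  proof -
    have "\<exists>z>p. z < q \<and> - cos q - (- cos p) = (q - p) * sin z"
      by (rule MVT2) (use that in \<open>auto intro!: derivative_eq_intros\<close>)
    then obtain z where z: "p < z" "z < q" "- cos q - (- cos p) = (q - p) * sin z" by blast
    have "sin p < sin z" using z that by (intro sin_monotone_2pi) auto
    then have "(q - p) * sin p < (q - p) * sin z" using that by simp
    then show ?thesis using z that by (simp add: mult.commute)
  qed
  show ?thesis
  proof (cases "y < a")
    case True
    then show ?thesis using aux[of y a a] assms by (auto simp: algebra_simps abs_less_iff)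
  next
    case False
    then show ?thesis using aux2[of a y a] assms by (auto simp: algebra_simps abs_less_iff)
  qed
qed

text \<open>The storage functions are fixed here together with their gradients.
  \<open>om_star\<close> and the zero-input form of (A1) are consequences of the hypotheses of the
  theorem, derived when the locale is interpreted.\<close>

locale power_network =
  fixes nN :: nat and E :: "(nat \<times> nat) set"
    and M pL :: "nat \<Rightarrow> real" and B :: "nat \<Rightarrow> nat \<Rightarrow> real"
    and dlo dhi wlo whi :: "nat \<Rightarrow> real"
    and nd :: "nat \<Rightarrow> nat"
    and f :: "nat \<Rightarrow> (nat \<Rightarrow> real) \<Rightarrow> real \<Rightarrow> (nat \<Rightarrow> real)"
    and g :: "nat \<Rightarrow> (nat \<Rightarrow> real) \<Rightarrow> real \<Rightarrow> real"
    and xstar :: state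
    and V :: "nat \<Rightarrow> (nat \<Rightarrow> real) \<Rightarrow> real" and DV :: "nat \<Rightarrow> (nat \<Rightarrow> real) \<Rightarrow> nat \<Rightarrow> real"
  assumes E_sub: "E \<subseteq> buses nN \<times> buses nN"
    and M_pos: "\<And>j. j \<in> buses nN \<Longrightarrow> 0 < M j"
    and B_pos: "\<And>i j. (i, j) \<in> E \<Longrightarrow> 0 < B i j"
    and d_bounds: "\<And>j. j \<in> buses nN \<Longrightarrow> dlo j \<le> 0 \<and> 0 \<le> dhi j"
    and w_bounds: "\<And>j. j \<in> buses nN \<Longrightarrow> wlo j < 0 \<and> 0 < whi j"
    and f_lip: "\<And>j. j \<in> buses nN \<Longrightarrow> lipschitz_f (nd j) (f j)"
    and g_lip: "\<And>j. j \<in> buses nN \<Longrightarrow> lipschitz_g (nd j) (g j)"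
    and compact_invariant: "\<And>j C. j \<in> buses nN \<Longrightarrow> C \<subseteq> vspace (nd j) \<Longrightarrow> compact C \<Longrightarrow>
          sub_invariant (nd j) (\<lambda>x. f j x 0) C \<Longrightarrow> (\<forall>x\<in>C. sub_equilibrium (nd j) (\<lambda>x. f j x 0) x)"
    and om_star: "\<And>j. j \<in> buses nN \<Longrightarrow> st_om xstar j = 0"
    and equil: "inQ nN E M pL B dlo dhi wlo whi nd f g xstar zero_state"
    and passivity: "\<And>j. j \<in> buses nN \<Longrightarrow>
          loc_isp_with (nd j) (f j) (g j) 0 (trunc (nd j) (st_xs xstar j)) (V j) (DV j)"
    and strict_min: "\<And>j. j \<in> buses nN \<Longrightarrow> strict_local_min (nd j) (V j) (trunc (nd j) (st_xs xstar j))"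
    and eta_star: "\<And>e. e \<in> E \<Longrightarrow> \<bar>st_eta xstar e\<bar> < pi / 2"
begin

abbreviation "N \<equiv> buses nN"

definition coords :: "(state \<Rightarrow> real) set" where
  "coords = (\<lambda>e x. st_eta x e) ` E \<union> (\<lambda>j x. st_om x j) ` N \<union> (\<Union>j\<in>N. (\<lambda>k x. st_xs x j k) ` {..<nd j})"

lemma finite_buses [simp]: "finite N"
  by (simp add: buses_def)

lemma finite_edges [simp]: "finite E"
  using E_sub finite_subset by fastforce

lemma edge_buses: "(i, j) \<in> E \<Longrightarrow> i \<in> N \<and> j \<in> N"
  using E_sub by auto

lemma eta_coord: "e \<in> E \<Longrightarrow> (\<lambda>x. st_eta x e) \<in> coords"
  by (auto simp: coords_def)

lemma om_coord: "j \<in> N \<Longrightarrow> (\<lambda>x. st_om x j) \<in> coords"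
  by (auto simp: coords_def)

lemma xs_coord: "j \<in> N \<Longrightarrow> k < nd j \<Longrightarrow> (\<lambda>x. st_xs x j k) \<in> coords"
  by (auto simp: coords_def)

lemma coords_cases:
  assumes "c \<in> coords"
  obtains e where "e \<in> E" "c = (\<lambda>x. st_eta x e)" | j where "j \<in> N" "c = (\<lambda>x. st_om x j)"
    | j k where "j \<in> N" "k < nd j" "c = (\<lambda>x. st_xs x j k)"
  using assms by (auto simp: coords_def)

sublocale coord_space coords
proof
  show "finite coords" by (auto simp: coords_def)
  fix l :: "(state \<Rightarrow> real) \<Rightarrow> real"
  show "\<exists>z. \<forall>c\<in>coords. c z = l c"
    by (rule exI[of _ "(\<lambda>e. l (\<lambda>x. st_eta x e), \<lambda>j. l (\<lambda>x. st_om x j), \<lambda>j k. l (\<lambda>x. st_xs x j k))"])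
      (auto simp: coords_def st_eta_def st_om_def st_xs_def)
qed

definition xv :: "nat \<Rightarrow> state \<Rightarrow> nat \<Rightarrow> real" where
  "xv j x = trunc (nd j) (st_xs x j)"

text \<open>The swing equation without its load: the load is the only discontinuous term, so this
  quantity is continuous in the coordinates, and inside the deadband it equals \<open>M j\<close>
  times the frequency derivative.\<close>

definition imbalance :: "nat \<Rightarrow> state \<Rightarrow> real" where
  "imbalance j x = - pL j + g j (xv j x) (- st_om x j)
     - (\<Sum>k\<in>out_nb E j. B j k * sin (st_eta x (j,k))) + (\<Sum>i\<in>in_nb E j. B i j * sin (st_eta x (i,j)))"

text \<open>The slack in the passivity inequality; it dominates the function \<open>\<phi>\<close> of the passivity hypothesis, which
  need not be continuous and so cannot be used directly in the compactness arguments.\<close>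

definition diss :: "nat \<Rightarrow> state \<Rightarrow> real" where
  "diss j x = - st_om x j * (g j (xv j x) (- st_om x j) - g j (xv j xstar) 0)
     - (\<Sum>k<nd j. DV j (xv j x) k * f j (xv j x) (- st_om x j) k)"

text \<open>Up to additive constants, a Bregman-type potential: the linear term puts its critical point
  at \<open>xstar\<close>.\<close>

definition potential :: "state \<Rightarrow> real" where
  "potential x = (\<Sum>(i,j)\<in>E. B i j * (- cos (st_eta x (i,j)) - sin (st_eta xstar (i,j)) * st_eta x (i,j)))
     + (\<Sum>j\<in>N. V j (xv j x))"

definition potential_rate :: "state \<Rightarrow> real" where
  "potential_rate x = (\<Sum>(i,j)\<in>E. B i j * (sin (st_eta x (i,j)) - sin (st_eta xstar (i,j))) * (st_om x i - st_om x j))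
     + (\<Sum>j\<in>N. \<Sum>k<nd j. DV j (xv j x) k * f j (xv j x) (- st_om x j) k)"

text \<open>The kinetic part is kept apart because the frequencies are differentiable only almost
  everywhere, whereas \<open>potential\<close> has a classical derivative along solutions.\<close>

definition energy :: "state \<Rightarrow> real" where
  "energy x = (\<Sum>j\<in>N. M j * (st_om x j)\<^sup>2 / 2) + potential x"

lemma C1: "j \<in> N \<Longrightarrow> C1_with_grad (nd j) (V j) (DV j)"
  using passivity by (simp add: loc_isp_with_def)

lemma xv_vspace [simp]: "xv j x \<in> vspace (nd j)"
  by (simp add: xv_def)

lemma xv_apply: "k < nd j \<Longrightarrow> xv j x k = st_xs x j k"
  by (simp add: xv_def trunc_def)

lemma finite_nb [simp]: "finite (out_nb E j)" "finite (in_nb E j)"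
proof -
  have "out_nb E j \<subseteq> snd ` E" "in_nb E j \<subseteq> fst ` E" by (force simp: out_nb_def in_nb_def)+
  then show "finite (out_nb E j)" "finite (in_nb E j)" by (auto intro: finite_subset)
qed

section \<open>Continuity of the network quantities in the coordinates\<close>

lemma tendsto_eta: "e \<in> E \<Longrightarrow> ((\<lambda>x. st_eta x e) \<longlongrightarrow> st_eta z e) (cnhds z)"
  by (rule tendsto_coord[OF eta_coord])

lemma tendsto_om: "j \<in> N \<Longrightarrow> ((\<lambda>x. st_om x j) \<longlongrightarrow> st_om z j) (cnhds z)"
  by (rule tendsto_coord[OF om_coord])

lemma tendsto_xv: "j \<in> N \<Longrightarrow> k < nd j \<Longrightarrow> ((\<lambda>x. xv j x k) \<longlongrightarrow> xv j z k) (cnhds z)"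
  using tendsto_coord[OF xs_coord] by (simp add: xv_apply)

lemma tendsto_f: "j \<in> N \<Longrightarrow> k < nd j \<Longrightarrow>
    ((\<lambda>x. f j (xv j x) (- st_om x j) k) \<longlongrightarrow> f j (xv j z) (- st_om z j) k) (cnhds z)"
  by (rule lipschitz_f_tendsto[OF f_lip]) (auto intro: tendsto_xv tendsto_minus[OF tendsto_om])

lemma tendsto_g: "j \<in> N \<Longrightarrow>
    ((\<lambda>x. g j (xv j x) (- st_om x j)) \<longlongrightarrow> g j (xv j z) (- st_om z j)) (cnhds z)"
  by (rule lipschitz_g_tendsto[OF g_lip]) (auto intro: tendsto_xv tendsto_minus[OF tendsto_om])

lemma tendsto_V: "j \<in> N \<Longrightarrow> ((\<lambda>x. V j (xv j x)) \<longlongrightarrow> V j (xv j z)) (cnhds z)"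
  by (rule C1_with_grad_tendsto[OF C1]) (auto intro: tendsto_xv)

lemma tendsto_DV: "j \<in> N \<Longrightarrow> k < nd j \<Longrightarrow> ((\<lambda>x. DV j (xv j x) k) \<longlongrightarrow> DV j (xv j z) k) (cnhds z)"
  by (rule C1_with_grad_gradient_tendsto[OF C1]) (auto intro: tendsto_xv)

lemma coord_cont_f: "j \<in> N \<Longrightarrow> k < nd j \<Longrightarrow> coord_cont (\<lambda>x. f j (xv j x) (- st_om x j) k)"
  unfolding coord_cont_def using tendsto_f by blast

lemma coord_cont_imbalance: "j \<in> N \<Longrightarrow> coord_cont (imbalance j)"
  unfolding coord_cont_def imbalance_def
  by (intro allI tendsto_intros tendsto_g tendsto_eta) (auto simp: out_nb_def in_nb_def)

lemma coord_cont_diss: "coord_cont (\<lambda>x. \<Sum>j\<in>N. diss j x)"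
  unfolding coord_cont_def diss_def
  by (intro allI tendsto_intros tendsto_g tendsto_om tendsto_DV tendsto_f) auto

lemma coord_cont_energy: "coord_cont energy"
  unfolding coord_cont_def energy_def potential_def case_prod_unfold
  by (intro allI tendsto_intros tendsto_V tendsto_om tendsto_eta) auto

lemma coord_cont_potential_rate: "coord_cont potential_rate"
  unfolding coord_cont_def potential_rate_def case_prod_unfold
  by (intro allI tendsto_intros tendsto_DV tendsto_f tendsto_om tendsto_eta)
    (use E_sub in auto)

section \<open>Equilibria and the energy balance\<close>

lemma inQ_om:
  assumes "inQ nN E M pL B dlo dhi wlo whi nd f g x dx" "j \<in> N"
  obtains v where "v \<in> Fdc (dlo j) (dhi j) (wlo j) (whi j) (st_om x j)"
    "st_om dx j = (imbalance j x - v) / M j"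
proof -
  from assms obtain v where v: "v \<in> Fdc (dlo j) (dhi j) (wlo j) (whi j) (st_om x j)"
    "st_om dx j = (1 / M j) * (- pL j + g j (trunc (nd j) (st_xs x j)) (- st_om x j) - v
            - (\<Sum>k\<in>out_nb E j. B j k * sin (st_eta x (j,k)))
            + (\<Sum>i\<in>in_nb E j. B i j * sin (st_eta x (i,j))))"
    unfolding inQ_def by blast
  have "st_om dx j = (imbalance j x - v) / M j"
    unfolding v(2) imbalance_def xv_def times_divide_eq_left mult_1
    by (rule arg_cong[where f = "\<lambda>a. a / M j"]) simp
  with v(1) show ?thesis by (rule that)
qed

lemma inQ_equilibriumI:
  assumes "\<And>j. j \<in> N \<Longrightarrow> st_om x j = 0" "\<And>j. j \<in> N \<Longrightarrow> imbalance j x = 0"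
    and "\<And>j k. j \<in> N \<Longrightarrow> k < nd j \<Longrightarrow> f j (xv j x) 0 k = 0"
  shows "inQ nN E M pL B dlo dhi wlo whi nd f g x zero_state"
  unfolding inQ_def
proof (intro conjI ballI allI impI)
  fix e assume "e \<in> E"
  then show "case e of (i, j) \<Rightarrow> st_eta zero_state (i, j) = st_om x i - st_om x j"
    using assms(1) edge_buses by (auto simp: zero_state_def st_eta_def split: prod.splits)
next
  fix j assume j: "j \<in> N"
  have "0 \<in> Fdc (dlo j) (dhi j) (wlo j) (whi j) (st_om x j)"
    using assms(1)[OF j] w_bounds[OF j] by (simp add: Fdc_deadband)
  moreover have "st_om zero_state j = (1 / M j) * (- pL j + g j (trunc (nd j) (st_xs x j)) (- st_om x j) - 0
            - (\<Sum>k\<in>out_nb E j. B j k * sin (st_eta x (j,k)))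
            + (\<Sum>i\<in>in_nb E j. B i j * sin (st_eta x (i,j))))"
    using assms(2)[OF j] by (simp add: zero_state_def st_om_def imbalance_def xv_def)
  ultimately show "\<exists>v\<in>Fdc (dlo j) (dhi j) (wlo j) (whi j) (st_om x j).
        st_om zero_state j = (1 / M j) * (- pL j + g j (trunc (nd j) (st_xs x j)) (- st_om x j) - v
            - (\<Sum>k\<in>out_nb E j. B j k * sin (st_eta x (j,k)))
            + (\<Sum>i\<in>in_nb E j. B i j * sin (st_eta x (i,j))))" by blast
next
  fix j k assume "j \<in> N" "k < nd j"
  then show "st_xs zero_state j k = f j (trunc (nd j) (st_xs x j)) (- st_om x j) k"
    using assms(1,3) by (simp add: zero_state_def st_xs_def xv_def)
qed

lemma imbalance_star: "j \<in> N \<Longrightarrow> imbalance j xstar = 0"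
  using inQ_om[OF equil, of j] M_pos[of j] w_bounds[of j] om_star[of j]
  by (auto simp: Fdc_deadband zero_state_def st_om_def)

text \<open>Summation by parts on the graph: each edge is counted once at its tail and once at its
  head, so nodal power injections weighted by \<open>w\<close> become edge flows weighted by
  differences of \<open>w\<close>.\<close>

lemma sum_power_balance:
  fixes p :: "nat \<Rightarrow> nat \<Rightarrow> real" and w :: "nat \<Rightarrow> real"
  shows "(\<Sum>j\<in>N. w j * ((\<Sum>k\<in>out_nb E j. p j k) - (\<Sum>i\<in>in_nb E j. p i j))) = (\<Sum>(i,j)\<in>E. p i j * (w i - w j))"
proof -
  have "(\<Sum>j\<in>N. w j * (\<Sum>k\<in>out_nb E j. p j k)) = (\<Sum>(j,k)\<in>Sigma N (out_nb E). w j * p j k)"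
    by (simp add: sum_distrib_left sum.Sigma)
  also have "Sigma N (out_nb E) = E" using E_sub by (auto simp: out_nb_def)
  finally have 1: "(\<Sum>j\<in>N. w j * (\<Sum>k\<in>out_nb E j. p j k)) = (\<Sum>(i,j)\<in>E. w i * p i j)" .
  have "(\<Sum>j\<in>N. w j * (\<Sum>i\<in>in_nb E j. p i j)) = (\<Sum>(j,i)\<in>Sigma N (in_nb E). w j * p i j)"
    by (simp add: sum_distrib_left sum.Sigma)
  also have "\<dots> = (\<Sum>(i,j)\<in>E. w j * p i j)"
    by (rule sum.reindex_bij_witness[of _ "\<lambda>(i,j). (j,i)" "\<lambda>(i,j). (j,i)"])
      (use E_sub in \<open>auto simp: in_nb_def\<close>)
  finally have 2: "(\<Sum>j\<in>N. w j * (\<Sum>i\<in>in_nb E j. p i j)) = (\<Sum>(i,j)\<in>E. w j * p i j)" .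
  show ?thesis
    using 1 2 by (simp add: right_diff_distrib sum_subtractf case_prod_unfold mult.commute)
qed

lemma energy_balance: "(\<Sum>j\<in>N. st_om x j * imbalance j x) + potential_rate x = - (\<Sum>j\<in>N. diss j x)"
proof -
  define p where "p i j = B i j * (sin (st_eta x (i,j)) - sin (st_eta xstar (i,j)))" for i j
  have "st_om x j * imbalance j x = st_om x j * (g j (xv j x) (- st_om x j) - g j (xv j xstar) 0)
      - st_om x j * ((\<Sum>k\<in>out_nb E j. p j k) - (\<Sum>i\<in>in_nb E j. p i j))" if j: "j \<in> N" for j
  proof -
    \<comment> \<open>Subtracting the equilibrium equation, which reads 0, cancels \<open>pL\<close>
      and turns flows and supplies into deviations from their equilibrium values, the form in which
      \<open>diss\<close> and the tilted potential are written.\<close>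
    have "imbalance j x = imbalance j x - imbalance j xstar" using imbalance_star[OF j] by simp
    also have "\<dots> = (g j (xv j x) (- st_om x j) - g j (xv j xstar) 0)
      - ((\<Sum>k\<in>out_nb E j. p j k) - (\<Sum>i\<in>in_nb E j. p i j))"
      using om_star[OF j] by (simp add: imbalance_def p_def right_diff_distrib sum_subtractf)
    finally show ?thesis by (simp add: right_diff_distrib)
  qed
  then have "(\<Sum>j\<in>N. st_om x j * imbalance j x)
    = (\<Sum>j\<in>N. st_om x j * (g j (xv j x) (- st_om x j) - g j (xv j xstar) 0)) - (\<Sum>(i,j)\<in>E. p i j * (st_om x i - st_om x j))"
    by (simp add: sum_subtractf sum_power_balance)
  then show ?thesis
    by (simp add: potential_rate_def diss_def p_def sum_subtractf sum_negf)
qed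

text \<open>The requirements on the radius: inside the box every \<open>diss j\<close> is
  nonnegative and is positive wherever the frequency at \<open>j\<close> is nonzero, and the energy
  has its strict minimum at \<open>xstar\<close>.\<close>

definition good_box :: "real \<Rightarrow> bool" where
  "good_box r \<longleftrightarrow> 0 < r \<and> (\<forall>x\<in>coord_box xstar r.
     (\<forall>j\<in>N. 0 \<le> diss j x \<and> (st_om x j \<noteq> 0 \<longrightarrow> 0 < diss j x)) \<and>
     ((\<exists>c\<in>coords. c x \<noteq> c xstar) \<longrightarrow> energy xstar < energy x))"

lemma eventually_diss_pos:
  assumes j: "j \<in> N"
  shows "eventually (\<lambda>x. 0 \<le> diss j x \<and> (st_om x j \<noteq> 0 \<longrightarrow> 0 < diss j x)) (cnhds xstar)"
proof -
  obtain \<Omega> X \<phi> where O: "open \<Omega>" "0 \<in> \<Omega>" and X: "open X" "xv j xstar \<in> X" and \<phi>: "pos_def_fun \<phi>"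
    and P: "\<And>u x. u \<in> \<Omega> \<Longrightarrow> x \<in> X \<inter> vspace (nd j) \<Longrightarrow>
        (\<Sum>k<nd j. DV j x k * f j x u k) \<le> (u - 0) * (g j x u - g j (xv j xstar) 0) - \<phi> (u - 0)"
    using passivity[OF j] unfolding loc_isp_with_def xv_def by blast
  have "((\<lambda>x. - st_om x j) \<longlongrightarrow> - st_om xstar j) (cnhds xstar)"
    by (intro tendsto_intros tendsto_om j)
  then have "eventually (\<lambda>x. - st_om x j \<in> \<Omega>) (cnhds xstar)"
    using O om_star[OF j] by (intro topological_tendstoD) auto
  moreover have "((\<lambda>x. xv j x i) \<longlongrightarrow> xv j xstar i) (cnhds xstar)" for i
  proof (cases "i < nd j")
    case False
    then show ?thesis by (simp add: xv_def trunc_def)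
  qed (rule tendsto_xv[OF j])
  \<comment> \<open>The passivity neighbourhood \<open>X\<close> is open in the product topology, so
    all entries of \<open>xv j x\<close> have to converge; those from \<open>nd j\<close> on are
    constantly 0.\<close>
  then have "((\<lambda>x. xv j x) \<longlongrightarrow> xv j xstar) (cnhds xstar)" by (simp add: tendsto_fun_iff)
  then have "eventually (\<lambda>x. xv j x \<in> X) (cnhds xstar)" using X by (rule topological_tendstoD)
  ultimately show ?thesis
  proof eventually_elim
    case (elim x)
    then have "\<phi> (- st_om x j) \<le> diss j x"
      using P[of "- st_om x j" "xv j x"] by (simp add: diss_def)
    moreover have "\<phi> 0 = 0" "st_om x j \<noteq> 0 \<Longrightarrow> 0 < \<phi> (- st_om x j)"
      using \<phi> by (auto simp: pos_def_fun_def)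
    ultimately show ?case by (cases "st_om x j = 0") auto
  qed
qed

lemma eventually_storage_min:
  assumes j: "j \<in> N"
  shows "eventually (\<lambda>x. V j (xv j xstar) \<le> V j (xv j x) \<and>
    ((\<exists>k<nd j. st_xs x j k \<noteq> st_xs xstar j k) \<longrightarrow> V j (xv j xstar) < V j (xv j x))) (cnhds xstar)"
proof -
  obtain \<epsilon> where \<epsilon>: "\<epsilon> > 0"
    "\<And>y. y \<in> vspace (nd j) \<Longrightarrow> 0 < vdist (nd j) y (xv j xstar) \<Longrightarrow> vdist (nd j) y (xv j xstar) < \<epsilon> \<Longrightarrow> V j (xv j xstar) < V j y"
    using strict_min[OF j] unfolding strict_local_min_def xv_def by blast
  have "eventually (\<lambda>x. vdist (nd j) (xv j x) (xv j xstar) < \<epsilon>) (cnhds xstar)"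
    using \<epsilon>(1) by (intro order_tendstoD[OF tendsto_vdist_0] tendsto_xv j)
  then show ?thesis
  proof eventually_elim
    case (elim x)
    show ?case
    proof (cases "\<exists>k<nd j. st_xs x j k \<noteq> st_xs xstar j k")
      case True
      then obtain k where "k < nd j" "xv j x k \<noteq> xv j xstar k" by (auto simp: xv_apply)
      then have "V j (xv j xstar) < V j (xv j x)" using elim by (intro \<epsilon>(2) vdist_pos[of k]) auto
      then show ?thesis by simp
    next
      case False
      then have "xv j x = xv j xstar" by (intro vspace_eqI[of _ "nd j"]) (auto simp: xv_apply)
      then show ?thesis using False by simp
    qed
  qed
qed

lemma good_box_exists: "\<exists>r. good_box r"
proof -
  have "eventually (\<lambda>x. \<bar>st_eta x e\<bar> < pi / 2) (cnhds xstar)" if e: "e \<in> E" for e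
    by (rule order_tendstoD(2)[OF tendsto_rabs[OF tendsto_eta[OF e]] eta_star[OF e]])
  then have "eventually (\<lambda>x. (\<forall>j\<in>N. 0 \<le> diss j x \<and> (st_om x j \<noteq> 0 \<longrightarrow> 0 < diss j x)) \<and>
      (\<forall>j\<in>N. V j (xv j xstar) \<le> V j (xv j x) \<and>
        ((\<exists>k<nd j. st_xs x j k \<noteq> st_xs xstar j k) \<longrightarrow> V j (xv j xstar) < V j (xv j x))) \<and>
      (\<forall>e\<in>E. \<bar>st_eta x e\<bar> < pi / 2)) (cnhds xstar)"
    by (intro eventually_conj eventually_ball_finite) (auto intro: eventually_diss_pos eventually_storage_min)
  then obtain \<delta> where \<delta>: "\<delta> > 0" and D: "\<And>x. (\<forall>c\<in>coords. \<bar>c x - c xstar\<bar> < \<delta>) \<Longrightarrow>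
      (\<forall>j\<in>N. 0 \<le> diss j x \<and> (st_om x j \<noteq> 0 \<longrightarrow> 0 < diss j x)) \<and>
      (\<forall>j\<in>N. V j (xv j xstar) \<le> V j (xv j x) \<and>
        ((\<exists>k<nd j. st_xs x j k \<noteq> st_xs xstar j k) \<longrightarrow> V j (xv j xstar) < V j (xv j x))) \<and>
      (\<forall>e\<in>E. \<bar>st_eta x e\<bar> < pi / 2)"
    unfolding eventually_cnhds by blast
  \<comment> \<open>Halving passes from the open condition to a closed box.\<close>
  have "good_box (\<delta> / 2)"
    unfolding good_box_def
  proof (intro conjI ballI)
    fix x assume x: "x \<in> coord_box xstar (\<delta> / 2)"
    then have "\<forall>c\<in>coords. \<bar>c x - c xstar\<bar> < \<delta>" using \<delta> by (force simp: coord_box_def)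
    note Dx = D[OF this]
    show "0 \<le> diss j x" "st_om x j \<noteq> 0 \<longrightarrow> 0 < diss j x" if "j \<in> N" for j
      using Dx that by auto
    show "(\<exists>c\<in>coords. c x \<noteq> c xstar) \<longrightarrow> energy xstar < energy x"
    proof
      assume ne: "\<exists>c\<in>coords. c x \<noteq> c xstar"
      define h where "h e y = B (fst e) (snd e) * (- cos (st_eta y e) - sin (st_eta xstar e) * st_eta y e)" for e y
      have en: "energy y = (\<Sum>j\<in>N. M j * (st_om y j)\<^sup>2 / 2) + ((\<Sum>e\<in>E. h e y) + (\<Sum>j\<in>N. V j (xv j y)))" for y
        by (simp add: energy_def potential_def h_def case_prod_unfold)
      have k_le: "M j * (st_om xstar j)\<^sup>2 / 2 \<le> M j * (st_om x j)\<^sup>2 / 2" if "j \<in> N" for j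
        using om_star[OF that] M_pos[OF that] by simp
      have k_lt: "M j * (st_om xstar j)\<^sup>2 / 2 < M j * (st_om x j)\<^sup>2 / 2" if "j \<in> N" "st_om x j \<noteq> st_om xstar j" for j
        using om_star[OF that(1)] M_pos[OF that(1)] that by simp
      have h_lt: "h e xstar < h e x" if e: "e \<in> E" "st_eta x e \<noteq> st_eta xstar e" for e
        unfolding h_def using neg_cos_strict_tangent[of "st_eta xstar e" "st_eta x e"] eta_star e Dx B_pos[of "fst e" "snd e"]
        by (intro mult_strict_left_mono) auto
      have h_le: "h e xstar \<le> h e x" if e: "e \<in> E" for e
        using h_lt[OF e] by (cases "st_eta x e = st_eta xstar e") (auto simp: h_def)
      have V_le: "V j (xv j xstar) \<le> V j (xv j x)" if "j \<in> N" for j using Dx that by blast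
      have k: "(\<Sum>j\<in>N. M j * (st_om xstar j)\<^sup>2 / 2) \<le> (\<Sum>j\<in>N. M j * (st_om x j)\<^sup>2 / 2)"
        and h: "(\<Sum>e\<in>E. h e xstar) \<le> (\<Sum>e\<in>E. h e x)"
        and v: "(\<Sum>j\<in>N. V j (xv j xstar)) \<le> (\<Sum>j\<in>N. V j (xv j x))"
        by (intro sum_mono k_le h_le V_le; assumption)+
      \<comment> \<open>The three parts of the energy are each minimal at \<open>xstar\<close>; the
        kind of the differing coordinate decides which of them is strictly larger.\<close>
      from ne obtain c where "c \<in> coords" "c x \<noteq> c xstar" by blast
      then show "energy xstar < energy x"
      proof (cases rule: coords_cases)
        case (1 e)
        then have "(\<Sum>e\<in>E. h e xstar) < (\<Sum>e\<in>E. h e x)"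
          using \<open>c x \<noteq> c xstar\<close> by (intro sum_strict_mono_ex1) (auto intro: h_le h_lt)
        then show ?thesis unfolding en using k v by linarith
      next
        case (2 j)
        then have "(\<Sum>j\<in>N. M j * (st_om xstar j)\<^sup>2 / 2) < (\<Sum>j\<in>N. M j * (st_om x j)\<^sup>2 / 2)"
          using \<open>c x \<noteq> c xstar\<close> k_le k_lt by (intro sum_strict_mono_ex1) (fastforce simp del: mult_le_cancel_left)+
        then show ?thesis unfolding en using h v by linarith
      next
        case (3 j k)
        then have "(\<Sum>j\<in>N. V j (xv j xstar)) < (\<Sum>j\<in>N. V j (xv j x))"
          using \<open>c x \<noteq> c xstar\<close> Dx by (intro sum_strict_mono_ex1) auto
        then show ?thesis unfolding en using k h by linarith
      qed
    qed
  qed (use \<delta> in simp)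
  then show ?thesis by blast
qed

section \<open>Euclidean distances versus coordinates\<close>

lemma coord_le_sdist:
  assumes "c \<in> coords"
  shows "\<bar>c x - c y\<bar> \<le> sdist nN E nd x y"
proof -
  let ?A = "\<Sum>e\<in>E. (st_eta x e - st_eta y e)^2" and ?B = "\<Sum>j\<in>N. (st_om x j - st_om y j)^2"
    and ?C = "\<Sum>j\<in>N. \<Sum>k<nd j. (st_xs x j k - st_xs y j k)^2"
  have nn: "0 \<le> ?A" "0 \<le> ?B" "0 \<le> ?C" by (auto intro!: sum_nonneg)
  have "(c x - c y)\<^sup>2 \<le> ?A + ?B + ?C"
    using assms
  proof (cases rule: coords_cases)
    case (1 e)
    then have "(c x - c y)\<^sup>2 \<le> ?A" by (auto intro: member_le_sum[where f = "\<lambda>e. (st_eta x e - st_eta y e)^2"])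
    then show ?thesis using nn by linarith
  next
    case (2 j)
    then have "(c x - c y)\<^sup>2 \<le> ?B" by (auto intro: member_le_sum[where f = "\<lambda>j. (st_om x j - st_om y j)^2"])
    then show ?thesis using nn by linarith
  next
    case (3 j k)
    then have "(c x - c y)\<^sup>2 \<le> (\<Sum>k<nd j. (st_xs x j k - st_xs y j k)^2)"
      by (auto intro: member_le_sum[where f = "\<lambda>k. (st_xs x j k - st_xs y j k)^2"])
    also have "\<dots> \<le> ?C"
      using 3 by (intro member_le_sum[where f = "\<lambda>j. \<Sum>k<nd j. (st_xs x j k - st_xs y j k)^2"]) (auto intro: sum_nonneg)
    finally show ?thesis using nn by linarith
  qed
  then show ?thesis unfolding sdist_def by (intro real_le_rsqrt) simp
qed

lemma sdist_tendsto_0: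
  assumes "\<And>c. c \<in> coords \<Longrightarrow> ((\<lambda>t. c (X t)) \<longlongrightarrow> c z) F"
  shows "((\<lambda>t. sdist nN E nd (X t) z) \<longlongrightarrow> 0) F"
proof -
  have "((\<lambda>t. sdist nN E nd (X t) z) \<longlongrightarrow> sdist nN E nd z z) F"
    unfolding sdist_def using assms[OF eta_coord] assms[OF om_coord] assms[OF xs_coord]
    by (intro tendsto_intros) auto
  then show ?thesis by (simp add: sdist_def)
qed

lemma setdist_le_sdist:
  assumes "y \<in> S"
  shows "0 \<le> setdist_st nN E nd x S" "setdist_st nN E nd x S \<le> sdist nN E nd x y"
proof -
  have nn: "0 \<le> sdist nN E nd x y" for y by (auto simp: sdist_def intro!: add_nonneg_nonneg sum_nonneg)
  show "0 \<le> setdist_st nN E nd x S"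
    unfolding setdist_st_def using assms nn by (intro cInf_greatest) blast+
  show "setdist_st nN E nd x S \<le> sdist nN E nd x y"
    unfolding setdist_st_def using assms nn by (intro cInf_lower bdd_belowI[of _ 0]) blast+
qed

end

section \<open>Convergence of trajectories\<close>

locale network_trajectory = power_network +
  fixes x :: "real \<Rightarrow> state"
  assumes abs_cont: "traj_abs_cont nN E nd x"
    and solution: "AE t in lebesgue. 0 \<le> t \<longrightarrow>
      (\<exists>dx. traj_deriv nN E nd x dx t \<and> inQ nN E M pL B dlo dhi wlo whi nd f g (x t) dx)"
begin

section \<open>Regularity of Filippov solutions\<close>

lemma coord_abs_cont: "c \<in> coords \<Longrightarrow> 0 \<le> T \<Longrightarrow> abs_cont_on 0 T (\<lambda>t. c (x t))"
  using abs_cont by (auto simp: traj_abs_cont_def elim: coords_cases)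

lemma coord_abs_cont_interval:
  assumes "c \<in> coords" "0 \<le> a" "a \<le> b"
  shows "abs_cont_on a b (\<lambda>t. c (x t))"
  by (rule abs_cont_on_subinterval[OF coord_abs_cont[of c b]]) (use assms in auto)

lemma coord_continuous: "c \<in> coords \<Longrightarrow> continuous_on {0..} (\<lambda>t. c (x t))"
  by (intro continuous_on_atLeast_if_compact abs_cont_on_imp_continuous_on coord_abs_cont)

lemma om_derivative:
  assumes j: "j \<in> N"
  shows "AE t in lebesgue. 0 \<le> t \<longrightarrow> (\<exists>v\<in>Fdc (dlo j) (dhi j) (wlo j) (whi j) (st_om (x t) j).
     ((\<lambda>s. st_om (x s) j) has_real_derivative (imbalance j (x t) - v) / M j) (at t))"
  using solution
proof eventually_elim
  case (elim t)
  show ?case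
  proof
    assume "0 \<le> t"
    then obtain dx where dx: "traj_deriv nN E nd x dx t" "inQ nN E M pL B dlo dhi wlo whi nd f g (x t) dx"
      using elim by blast
    have "((\<lambda>s. st_om (x s) j) has_real_derivative st_om dx j) (at t)"
      using dx(1) j by (simp add: traj_deriv_def)
    then show "\<exists>v\<in>Fdc (dlo j) (dhi j) (wlo j) (whi j) (st_om (x t) j).
     ((\<lambda>s. st_om (x s) j) has_real_derivative (imbalance j (x t) - v) / M j) (at t)"
      using inQ_om[OF dx(2) j] by metis
  qed
qed

lemma eta_derivative:
  assumes e: "(i, j) \<in> E" and t: "0 < t"
  shows "((\<lambda>s. st_eta (x s) (i, j)) has_real_derivative st_om (x t) i - st_om (x t) j) (at t)"
proof (rule abs_cont_continuous_derivative[where q = "\<lambda>t. st_om (x t) i - st_om (x t) j"])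
  show "continuous_on {0..} (\<lambda>t. st_om (x t) i - st_om (x t) j)"
    using edge_buses[OF e] coord_continuous[OF om_coord] by (intro continuous_intros) auto
  show "AE t in lebesgue. 0 \<le> t \<longrightarrow>
      ((\<lambda>s. st_eta (x s) (i, j)) has_real_derivative st_om (x t) i - st_om (x t) j) (at t)"
    using solution
  proof eventually_elim
    case (elim t)
    then show ?case using e by (fastforce simp: traj_deriv_def inQ_def)
  qed
qed (use t coord_abs_cont[OF eta_coord[OF e]] in auto)

lemma xs_derivative:
  assumes j: "j \<in> N" and k: "k < nd j" and t: "0 < t"
  shows "((\<lambda>s. st_xs (x s) j k) has_real_derivative f j (xv j (x t)) (- st_om (x t) j) k) (at t)"
proof (rule abs_cont_continuous_derivative[where q = "\<lambda>t. f j (xv j (x t)) (- st_om (x t) j) k"])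
  show "continuous_on {0..} (\<lambda>t. f j (xv j (x t)) (- st_om (x t) j) k)"
    by (rule coord_cont_continuous_on[OF coord_cont_f[OF j k] coord_continuous])
  show "AE t in lebesgue. 0 \<le> t \<longrightarrow>
      ((\<lambda>s. st_xs (x s) j k) has_real_derivative f j (xv j (x t)) (- st_om (x t) j) k) (at t)"
    using solution
  proof eventually_elim
    case (elim t)
    then show ?case using j k by (auto simp: traj_deriv_def inQ_def xv_def)
  qed
qed (use t coord_abs_cont[OF xs_coord[OF j k]] in auto)

lemma xv_derivative:
  assumes "j \<in> N" "k < nd j" "0 < t"
  shows "((\<lambda>s. xv j (x s) k) has_real_derivative f j (xv j (x t)) (- st_om (x t) j) k) (at t)"
  using xs_derivative[OF assms] assms by (simp add: xv_apply)

lemma potential_derivative: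
  assumes t: "0 < t"
  shows "((\<lambda>s. potential (x s)) has_real_derivative potential_rate (x t)) (at t)"
proof -
  have 1: "((\<lambda>s. B i j * (- cos (st_eta (x s) (i,j)) - sin (st_eta xstar (i,j)) * st_eta (x s) (i,j)))
    has_real_derivative B i j * (sin (st_eta (x t) (i,j)) - sin (st_eta xstar (i,j))) * (st_om (x t) i - st_om (x t) j)) (at t)"
    if "(i, j) \<in> E" for i j
  proof -
    note d = eta_derivative[OF that t]
    show ?thesis
      by (rule DERIV_cong[OF DERIV_cmult[OF DERIV_diff[OF DERIV_minus[OF DERIV_fun_cos[OF d]] DERIV_cmult[OF d]]]])
        (simp add: algebra_simps)
  qed
  have 2: "((\<lambda>s. V j (xv j (x s))) has_real_derivative (\<Sum>k<nd j. DV j (xv j (x t)) k * f j (xv j (x t)) (- st_om (x t) j) k)) (at t)"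
    if "j \<in> N" for j
    by (rule C1_with_grad_chain[OF C1[OF that]]) (auto intro: xv_derivative[OF that _ t])
  show ?thesis
    unfolding potential_def potential_rate_def case_prod_unfold
    by (intro DERIV_add DERIV_sum 2) (use 1 in auto)
qed

text \<open>All right-hand sides are bounded on the box, and load selections lie between
  \<open>dlo\<close> and \<open>dhi\<close>, so the velocity bound does not depend on the selection.
  The growth lemmas turn almost everywhere bounds into Lipschitz bounds, with one constant for all
  coordinates and all subintervals.\<close>

lemma coord_lipschitz_in_box:
  obtains K where "0 < K"
    "\<And>c a b. c \<in> coords \<Longrightarrow> 0 \<le> a \<Longrightarrow> a \<le> b \<Longrightarrow> (\<And>t. t \<in> {a..b} \<Longrightarrow> x t \<in> coord_box xstar r)
       \<Longrightarrow> \<bar>c (x b) - c (x a)\<bar> \<le> K * (b - a)"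
proof -
  define P where "P c K \<longleftrightarrow> (AE t in lebesgue. 0 < t \<longrightarrow> x t \<in> coord_box xstar r \<longrightarrow>
      (\<exists>d. \<bar>d\<bar> \<le> K \<and> ((\<lambda>s. c (x s)) has_real_derivative d) (at t)))" for c K
  have "\<exists>K>0. P c K" if "c \<in> coords" for c
    using that
  proof (cases rule: coords_cases)
    case (1 e)
    obtain i j where e: "e = (i, j)" by (cases e)
    have ij: "i \<in> N" "j \<in> N" using 1 e edge_buses by auto
    have "coord_cont (\<lambda>x. st_om x i - st_om x j)"
      unfolding coord_cont_def by (intro allI tendsto_intros tendsto_om ij)
    then obtain K where K: "0 < K" "\<And>y. y \<in> coord_box xstar r \<Longrightarrow> \<bar>st_om y i - st_om y j\<bar> \<le> K"
      using coord_cont_bounded_on_box by blast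
    have "\<exists>d. \<bar>d\<bar> \<le> K \<and> ((\<lambda>s. c (x s)) has_real_derivative d) (at t)"
      if "0 < t" "x t \<in> coord_box xstar r" for t
      using K(2)[OF that(2)] eta_derivative[of i j t] that(1) 1 e by blast
    then show ?thesis using K(1) by (intro exI[of _ K]) (simp add: P_def always_eventually)
  next
    case (2 j)
    obtain K where K: "0 < K" "\<And>y. y \<in> coord_box xstar r \<Longrightarrow> \<bar>imbalance j y\<bar> \<le> K"
      using coord_cont_bounded_on_box[OF coord_cont_imbalance[OF 2(1)]] by blast
    define K' where "K' = (K + \<bar>dlo j\<bar> + \<bar>dhi j\<bar>) / M j"
    have "K' > 0" using K(1) M_pos[OF 2(1)] by (auto simp: K'_def intro!: divide_pos_pos)
    moreover have "AE t in lebesgue. 0 < t \<longrightarrow> x t \<in> coord_box xstar r \<longrightarrow>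
      (\<exists>d. \<bar>d\<bar> \<le> K' \<and> ((\<lambda>s. c (x s)) has_real_derivative d) (at t))"
      using om_derivative[OF 2(1)]
    proof eventually_elim
      case (elim t)
      show ?case
      proof (intro impI)
        assume t: "0 < t" "x t \<in> coord_box xstar r"
        then obtain v where v: "v \<in> Fdc (dlo j) (dhi j) (wlo j) (whi j) (st_om (x t) j)"
          "((\<lambda>s. st_om (x s) j) has_real_derivative (imbalance j (x t) - v) / M j) (at t)"
          using elim by auto
        have "\<bar>v\<bar> \<le> \<bar>dlo j\<bar> + \<bar>dhi j\<bar>"
          using Fdc_bounds[OF _ _ _ _ v(1)] d_bounds[OF 2(1)] w_bounds[OF 2(1)] by auto
        then have "\<bar>imbalance j (x t) - v\<bar> \<le> K + \<bar>dlo j\<bar> + \<bar>dhi j\<bar>"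
          using K(2)[OF t(2)] by linarith
        then have "\<bar>(imbalance j (x t) - v) / M j\<bar> \<le> K'"
          using M_pos[OF 2(1)] by (simp add: K'_def divide_right_mono abs_divide)
        then show "\<exists>d. \<bar>d\<bar> \<le> K' \<and> ((\<lambda>s. c (x s)) has_real_derivative d) (at t)"
          using v(2) unfolding 2(2) by blast
      qed
    qed
    ultimately show ?thesis unfolding P_def by blast
  next
    case (3 j k)
    obtain K where K: "0 < K" "\<And>y. y \<in> coord_box xstar r \<Longrightarrow> \<bar>f j (xv j y) (- st_om y j) k\<bar> \<le> K"
      using coord_cont_bounded_on_box[OF coord_cont_f[OF 3(1,2)]] by blast
    have "\<exists>d. \<bar>d\<bar> \<le> K \<and> ((\<lambda>s. c (x s)) has_real_derivative d) (at t)"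
      if "0 < t" "x t \<in> coord_box xstar r" for t
      using K(2)[OF that(2)] xs_derivative[OF 3(1,2) that(1)] 3(3) by blast
    then show ?thesis using K(1) by (intro exI[of _ K]) (simp add: P_def always_eventually)
  qed
  then obtain K where K: "\<And>c. c \<in> coords \<Longrightarrow> 0 < K c" "\<And>c. c \<in> coords \<Longrightarrow> P c (K c)"
    by metis
  define L where "L = Max (insert 1 (K ` coords))"
  have L: "0 < L" "\<And>c. c \<in> coords \<Longrightarrow> K c \<le> L"
    using finite_coords by (auto simp: L_def Max_gr_iff)
  \<comment> \<open>The derivative bounds in \<open>P\<close> speak of positive times only; the
    starting time is discarded as a null set.\<close>
  have ne0: "AE t in lebesgue. (t::real) \<noteq> 0"
    by (rule AE_I'[of "{0}"]) (auto simp: negligible_iff_null_sets[symmetric])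
  show ?thesis
  proof (rule that[OF L(1)])
    fix c a b assume c: "c \<in> coords" and ab: "0 \<le> a" "a \<le> b"
      and box: "\<And>t. t \<in> {a..b} \<Longrightarrow> x t \<in> coord_box xstar r"
    note ac = coord_abs_cont_interval[OF c ab]
    have d: "AE t in lebesgue. t \<in> {a..b} \<longrightarrow> (\<exists>d. \<bar>d\<bar> \<le> L \<and> ((\<lambda>s. c (x s)) has_real_derivative d) (at t))"
      using K(2)[OF c, unfolded P_def] ne0
    proof eventually_elim
      case (elim t)
      show ?case
      proof
        assume t: "t \<in> {a..b}"
        then have "0 < t" using ab elim(2) by auto
        then show "\<exists>d. \<bar>d\<bar> \<le> L \<and> ((\<lambda>s. c (x s)) has_real_derivative d) (at t)"
          using elim(1) box[OF t] L(2)[OF c] order_trans by blast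
      qed
    qed
    have "c (x b) - c (x a) \<le> L * (b - a)"
      by (rule abs_cont_on_growth_le[OF ac ab(2)], use d in eventually_elim) (auto simp: abs_le_iff)
    moreover have "(- L) * (b - a) \<le> c (x b) - c (x a)"
      by (rule abs_cont_on_growth_ge[OF ac ab(2)], use d in eventually_elim) (auto simp: abs_le_iff minus_le_iff)
    ultimately show "\<bar>c (x b) - c (x a)\<bar> \<le> L * (b - a)" by (simp add: abs_le_iff minus_le_iff)
  qed
qed

text \<open>Almost everywhere the energy has derivative \<open>- diss\<close> summed over the buses,
  minus the nonnegative power drawn by the on-off loads. To integrate this, absolute continuity
  comes from a Lipschitz bound: \<open>potential\<close> through its bounded classical derivative,
  the kinetic terms by factoring differences of squares of bounded Lipschitz functions.\<close>

lemma energy_decay: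
  assumes ab: "0 \<le> a" "a \<le> b"
    and box: "\<And>t. t \<in> {a..b} \<Longrightarrow> x t \<in> coord_box xstar r"
    and c: "\<And>t. t \<in> {a..b} \<Longrightarrow> c \<le> (\<Sum>j\<in>N. diss j (x t))"
  shows "energy (x b) - energy (x a) \<le> (- c) * (b - a)"
proof -
  obtain K where K: "0 < K"
    "\<And>c a b. c \<in> coords \<Longrightarrow> 0 \<le> a \<Longrightarrow> a \<le> b \<Longrightarrow> (\<And>t. t \<in> {a..b} \<Longrightarrow> x t \<in> coord_box xstar r)
       \<Longrightarrow> \<bar>c (x b) - c (x a)\<bar> \<le> K * (b - a)"
    using coord_lipschitz_in_box by blast
  obtain K' where K': "0 < K'" "\<And>y. y \<in> coord_box xstar r \<Longrightarrow> \<bar>potential_rate y\<bar> \<le> K'"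
    using coord_cont_bounded_on_box[OF coord_cont_potential_rate] by blast
  have pot: "\<bar>potential (x t) - potential (x s)\<bar> \<le> K' * (t - s)" if st: "a \<le> s" "s \<le> t" "t \<le> b" for s t
  proof (rule mvt_lipschitz_bound[OF st(2), where d = "\<lambda>t. potential_rate (x t)"])
    have "potential = (\<lambda>x. energy x - (\<Sum>j\<in>N. M j * (st_om x j)\<^sup>2 / 2))" by (simp add: energy_def)
    moreover have "continuous_on {0..} (\<lambda>t. energy (x t) - (\<Sum>j\<in>N. M j * (st_om (x t) j)\<^sup>2 / 2))"
      by (intro continuous_intros coord_cont_continuous_on[OF coord_cont_energy] coord_continuous om_coord) auto
    ultimately have "continuous_on {0..} (\<lambda>t. potential (x t))" by simp
    then show "continuous_on {s..t} (\<lambda>t. potential (x t))"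
      by (rule continuous_on_subset) (use st ab in auto)
    show "((\<lambda>t. potential (x t)) has_real_derivative potential_rate (x u)) (at u) \<and> \<bar>potential_rate (x u)\<bar> \<le> K'"
      if "s < u" "u < t" for u
      using that st ab potential_derivative[of u] K'(2)[OF box, of u] by auto
  qed
  have om: "\<bar>M j * (st_om (x t) j)\<^sup>2 / 2 - M j * (st_om (x s) j)\<^sup>2 / 2\<bar> \<le> M j * K * \<bar>r\<bar> * (t - s)"
    if st: "a \<le> s" "s \<le> t" "t \<le> b" and j: "j \<in> N" for s t j
  proof -
    \<comment> \<open>Since the equilibrium frequency is 0, the box bounds the frequency itself; the
      absolute value is taken because \<open>r\<close> carries no sign assumption here.\<close>
    have r: "\<bar>st_om (x u) j\<bar> \<le> \<bar>r\<bar>" if "u \<in> {a..b}" for u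
      using box[OF that] om_coord[OF j] om_star[OF j] by (force simp: coord_box_def)
    have "\<bar>st_om (x t) j - st_om (x s) j\<bar> \<le> K * (t - s)"
      by (rule K(2)[OF om_coord[OF j]]) (use st ab box in auto)
    moreover have "\<bar>st_om (x t) j + st_om (x s) j\<bar> \<le> 2 * \<bar>r\<bar>" using r[of s] r[of t] st by auto
    ultimately have "\<bar>st_om (x t) j - st_om (x s) j\<bar> * \<bar>st_om (x t) j + st_om (x s) j\<bar> \<le> K * (t - s) * (2 * \<bar>r\<bar>)"
      using K(1) st by (intro mult_mono) auto
    then have "M j / 2 * (\<bar>st_om (x t) j - st_om (x s) j\<bar> * \<bar>st_om (x t) j + st_om (x s) j\<bar>)
        \<le> M j / 2 * (K * (t - s) * (2 * \<bar>r\<bar>))"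
      using M_pos[OF j] by (intro mult_left_mono) auto
    moreover have "M j * (st_om (x t) j)\<^sup>2 / 2 - M j * (st_om (x s) j)\<^sup>2 / 2
      = M j / 2 * ((st_om (x t) j - st_om (x s) j) * (st_om (x t) j + st_om (x s) j))"
      by (simp add: power2_eq_square algebra_simps diff_divide_distrib)
    then have "\<bar>M j * (st_om (x t) j)\<^sup>2 / 2 - M j * (st_om (x s) j)\<^sup>2 / 2\<bar>
      = M j / 2 * (\<bar>st_om (x t) j - st_om (x s) j\<bar> * \<bar>st_om (x t) j + st_om (x s) j\<bar>)"
      using M_pos[OF j] by (simp add: abs_mult del: times_divide_eq_left)
    ultimately have "\<bar>M j * (st_om (x t) j)\<^sup>2 / 2 - M j * (st_om (x s) j)\<^sup>2 / 2\<bar>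
        \<le> M j / 2 * (K * (t - s) * (2 * \<bar>r\<bar>))" by (simp only:)
    moreover have "M j / 2 * (K * (t - s) * (2 * \<bar>r\<bar>)) = M j * K * \<bar>r\<bar> * (t - s)"
      by (simp add: algebra_simps)
    ultimately show ?thesis by (simp only:)
  qed
  have "abs_cont_on a b (\<lambda>t. energy (x t))"
  proof (rule lipschitz_imp_abs_cont_on)
    fix s t assume st: "a \<le> s" "s \<le> t" "t \<le> b"
    have eq: "energy (x t) - energy (x s) = (\<Sum>j\<in>N. M j * (st_om (x t) j)\<^sup>2 / 2 - M j * (st_om (x s) j)\<^sup>2 / 2)
      + (potential (x t) - potential (x s))" by (simp add: energy_def sum_subtractf)
    have "\<bar>energy (x t) - energy (x s)\<bar> \<le> (\<Sum>j\<in>N. \<bar>M j * (st_om (x t) j)\<^sup>2 / 2 - M j * (st_om (x s) j)\<^sup>2 / 2\<bar>) + \<bar>potential (x t) - potential (x s)\<bar>"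
      unfolding eq by (rule order_trans[OF abs_triangle_ineq add_right_mono[OF sum_abs]])
    also have "\<dots> \<le> (\<Sum>j\<in>N. M j * K * \<bar>r\<bar> * (t - s)) + K' * (t - s)"
    proof (rule add_mono)
      show "(\<Sum>j\<in>N. \<bar>M j * (st_om (x t) j)\<^sup>2 / 2 - M j * (st_om (x s) j)\<^sup>2 / 2\<bar>)
        \<le> (\<Sum>j\<in>N. M j * K * \<bar>r\<bar> * (t - s))"
        by (rule sum_mono) (rule om[OF st])
    qed (rule pot[OF st])
    also have "\<dots> = ((\<Sum>j\<in>N. M j * K * \<bar>r\<bar>) + K') * (t - s)"
      by (simp only: distrib_right sum_distrib_right)
    finally show "\<bar>energy (x t) - energy (x s)\<bar> \<le> ((\<Sum>j\<in>N. M j * K * \<bar>r\<bar>) + K') * (t - s)" .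
  qed
  moreover have "AE t in lebesgue. t \<in> {a..b} \<longrightarrow> (\<exists>d\<le>- c. ((\<lambda>s. energy (x s)) has_real_derivative d) (at t))"
  proof -
    have ne0: "AE t in lebesgue. (t::real) \<noteq> 0"
      by (rule AE_I'[of "{0}"]) (auto simp: negligible_iff_null_sets[symmetric])
    have "AE t in lebesgue. \<forall>j\<in>N. 0 \<le> t \<longrightarrow> (\<exists>v\<in>Fdc (dlo j) (dhi j) (wlo j) (whi j) (st_om (x t) j).
     ((\<lambda>s. st_om (x s) j) has_real_derivative (imbalance j (x t) - v) / M j) (at t))"
      by (rule AE_finite_allI) (auto intro: om_derivative)
    then show ?thesis using ne0
    proof eventually_elim
      case (elim t)
      show ?case
      proof
        assume t: "t \<in> {a..b}"
        then have t0: "0 < t" using ab elim(2) by auto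
        then have "\<forall>j\<in>N. \<exists>v\<in>Fdc (dlo j) (dhi j) (wlo j) (whi j) (st_om (x t) j).
          ((\<lambda>s. st_om (x s) j) has_real_derivative (imbalance j (x t) - v) / M j) (at t)"
          using elim(1) by auto
        then obtain v where v: "\<And>j. j \<in> N \<Longrightarrow> v j \<in> Fdc (dlo j) (dhi j) (wlo j) (whi j) (st_om (x t) j)"
          "\<And>j. j \<in> N \<Longrightarrow> ((\<lambda>s. st_om (x s) j) has_real_derivative (imbalance j (x t) - v j) / M j) (at t)"
          by metis
        have "((\<lambda>s. M j * (st_om (x s) j)\<^sup>2 / 2) has_real_derivative st_om (x t) j * (imbalance j (x t) - v j)) (at t)"
          if "j \<in> N" for j
          using DERIV_cdivide[OF DERIV_cmult[OF DERIV_power[OF v(2)[OF that], of 2], of "M j"], of 2] M_pos[OF that]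
          by (simp add: mult_ac)
        then have "((\<lambda>s. energy (x s)) has_real_derivative
            (\<Sum>j\<in>N. st_om (x t) j * (imbalance j (x t) - v j)) + potential_rate (x t)) (at t)"
          unfolding energy_def by (intro DERIV_add DERIV_sum potential_derivative t0) auto
        \<comment> \<open>The selections \<open>v\<close> enter the balance only through the
          frequency-weighted sum, whose sign is known from \<open>Fdc_bounds\<close>.\<close>
        moreover have "(\<Sum>j\<in>N. st_om (x t) j * (imbalance j (x t) - v j)) + potential_rate (x t)
            = - (\<Sum>j\<in>N. diss j (x t)) - (\<Sum>j\<in>N. st_om (x t) j * v j)"
          unfolding energy_balance[symmetric] by (simp add: right_diff_distrib sum_subtractf)
        moreover have "0 \<le> (\<Sum>j\<in>N. st_om (x t) j * v j)"
          using Fdc_bounds(1)[OF _ _ _ _ v(1)] d_bounds w_bounds by (intro sum_nonneg) auto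
        ultimately show "\<exists>d\<le>- c. ((\<lambda>s. energy (x s)) has_real_derivative d) (at t)"
          using c[OF t] by (intro exI[of _ "(\<Sum>j\<in>N. st_om (x t) j * (imbalance j (x t) - v j)) + potential_rate (x t)"]) simp
      qed
    qed
  qed
  ultimately show ?thesis by (rule abs_cont_on_growth_le[OF _ ab(2)])
qed

end

locale confined_trajectory = network_trajectory +
  fixes r :: real
  assumes box: "good_box r" and confined: "\<And>t. 0 \<le> t \<Longrightarrow> x t \<in> coord_box xstar r"
begin

lemma observable_uniformly_continuous:
  assumes "coord_cont \<Phi>"
  shows "uniformly_continuous_on {0..} (\<lambda>t. \<Phi> (x t))"
proof -
  obtain K where K: "0 < K"
    "\<And>c a b. c \<in> coords \<Longrightarrow> 0 \<le> a \<Longrightarrow> a \<le> b \<Longrightarrow> (\<And>t. t \<in> {a..b} \<Longrightarrow> x t \<in> coord_box xstar r)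
       \<Longrightarrow> \<bar>c (x b) - c (x a)\<bar> \<le> K * (b - a)"
    using coord_lipschitz_in_box by blast
  show ?thesis
  proof (rule lipschitz_path_uniformly_continuous[OF assms, of _ _ xstar r])
    show "x t \<in> coord_box xstar r" if "t \<in> {0..}" for t using that confined by simp
    show "\<bar>c (x t) - c (x s)\<bar> \<le> K * \<bar>t - s\<bar>" if "c \<in> coords" "s \<in> {0..}" "t \<in> {0..}" for c s t
      using K(2)[of c s t] K(2)[of c t s] that confined
      by (cases "s \<le> t") (auto simp: abs_minus_commute)
  qed
qed

lemma diss_nonneg: "0 \<le> t \<Longrightarrow> 0 \<le> (\<Sum>j\<in>N. diss j (x t))"
  using box confined unfolding good_box_def by (intro sum_nonneg) auto

lemma energy_convergent: "\<exists>l. ((\<lambda>t. energy (x t)) \<longlongrightarrow> l) at_top"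
proof -
  have dec: "energy (x b) \<le> energy (x a)" if "0 \<le> a" "a \<le> b" for a b
    using energy_decay[OF that, of r 0] that confined diss_nonneg by auto
  obtain K where K: "\<And>y. y \<in> coord_box xstar r \<Longrightarrow> \<bar>energy y\<bar> \<le> K"
    using coord_cont_bounded_on_box[OF coord_cont_energy] by blast
  define S where "S = (\<lambda>t. energy (x t)) ` {0..}"
  have bdd: "bdd_below S"
  proof (rule bdd_belowI[of _ "- K"])
    fix y assume "y \<in> S"
    then obtain t where "0 \<le> t" "y = energy (x t)" by (auto simp: S_def)
    then show "- K \<le> y" using K[OF confined[of t]] by (simp add: abs_le_iff)
  qed
  have "((\<lambda>t. energy (x t)) \<longlongrightarrow> Inf S) at_top"
  proof (rule decreasing_tendsto)
    show "eventually (\<lambda>t. Inf S \<le> energy (x t)) at_top"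
      using eventually_ge_at_top[of 0]
      by eventually_elim (rule cInf_lower[OF _ bdd], simp add: S_def)
    fix y assume "Inf S < y"
    then obtain a where a: "0 \<le> a" "energy (x a) < y"
      using cInf_lessD[of S y] by (auto simp: S_def)
    show "eventually (\<lambda>t. energy (x t) < y) at_top"
      using eventually_ge_at_top[of a] by eventually_elim (use dec[OF a(1)] a(2) in force)
  qed
  then show ?thesis by blast
qed

text \<open>Barbalat's argument for the negated energy: it converges, and
  \<open>energy_decay\<close> supplies the growth hypothesis.\<close>

lemma diss_tendsto: "0 < \<epsilon> \<Longrightarrow> eventually (\<lambda>t. (\<Sum>j\<in>N. diss j (x t)) < \<epsilon>) at_top"
proof -
  assume \<epsilon>: "0 < \<epsilon>"
  obtain l where l: "((\<lambda>t. energy (x t)) \<longlongrightarrow> l) at_top" using energy_convergent by blast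
  show ?thesis
  proof (rule barbalat[OF tendsto_minus[OF l] observable_uniformly_continuous[OF coord_cont_diss] _ \<epsilon>, of 0])
    fix a b c assume "0 \<le> a" "a \<le> b" "\<And>t. t \<in> {a..b} \<Longrightarrow> c \<le> (\<Sum>j\<in>N. diss j (x t))"
    then show "c * (b - a) \<le> - energy (x b) - - energy (x a)"
      using energy_decay[of a b r c] confined by auto
  qed
qed

text \<open>By compactness of the box, the total slack is bounded below wherever the frequency at
  \<open>j\<close> has size at least \<open>e\<close>; since the slack eventually drops below this
  bound, such times cannot persist.\<close>

lemma om_tendsto_0:
  assumes j: "j \<in> N"
  shows "((\<lambda>t. st_om (x t) j) \<longlongrightarrow> 0) at_top"
proof (rule tendstoI)
  fix e :: real assume e: "e > 0"
  have "coord_cont (\<lambda>x. \<bar>st_om x j\<bar>)"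
    unfolding coord_cont_def by (intro allI tendsto_intros tendsto_om j)
  moreover have "0 < (\<Sum>j\<in>N. diss j y)" if y: "y \<in> coord_box xstar r" "e \<le> \<bar>st_om y j\<bar>" for y
  proof -
    have "0 < diss j y" "\<And>i. i \<in> N \<Longrightarrow> 0 \<le> diss i y"
      using y box e j unfolding good_box_def by auto
    then show ?thesis using j by (intro sum_pos2[of _ j]) auto
  qed
  ultimately obtain m where m: "0 < m"
    "\<And>y. y \<in> coord_box xstar r \<Longrightarrow> e \<le> \<bar>st_om y j\<bar> \<Longrightarrow> m \<le> (\<Sum>j\<in>N. diss j y)"
    using coord_cont_lower_bound_on_box[OF coord_cont_diss] by blast
  show "eventually (\<lambda>t. dist (st_om (x t) j) 0 < e) at_top"
    using diss_tendsto[OF m(1)] eventually_ge_at_top[of 0]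
  proof eventually_elim
    case (elim t)
    then show ?case using m(2)[OF confined, of t] by force
  qed
qed

text \<open>Late in time the only load selection is 0, so \<open>imbalance j / M j\<close> is almost
  everywhere the derivative of a function tending to 0. Barbalat's conclusion is one-sided and is
  therefore applied to the frequency and to its negative.\<close>

lemma imbalance_tendsto_0:
  assumes j: "j \<in> N"
  shows "((\<lambda>t. imbalance j (x t)) \<longlongrightarrow> 0) at_top"
proof -
  have Mj: "M j > 0" by (rule M_pos[OF j])
  have w: "wlo j < 0" "0 < whi j" using w_bounds[OF j] by auto
  have "eventually (\<lambda>t. wlo j < st_om (x t) j \<and> st_om (x t) j < whi j) at_top"
    using order_tendstoD[OF om_tendsto_0[OF j]] w by (intro eventually_conj) auto
  then obtain T' where T': "\<And>t. T' \<le> t \<Longrightarrow> wlo j < st_om (x t) j \<and> st_om (x t) j < whi j"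
    by (auto simp: eventually_at_top_linorder)
  define T where "T = max 0 T'"
  have der: "AE t in lebesgue. T \<le> t \<longrightarrow> ((\<lambda>s. st_om (x s) j) has_real_derivative imbalance j (x t) / M j) (at t)"
    using om_derivative[OF j]
  proof eventually_elim
    case (elim t)
    then show ?case using Fdc_deadband T'[of t] by (auto simp: T_def)
  qed
  have grow: "c * (b - a) \<le> st_om (x b) j - st_om (x a) j"
    if ab: "T \<le> a" "a \<le> b" and c: "\<And>t. t \<in> {a..b} \<Longrightarrow> c \<le> imbalance j (x t) / M j" for a b c
  proof (rule abs_cont_on_growth_ge[OF coord_abs_cont_interval[OF om_coord[OF j]] ab(2)])
    show "AE t in lebesgue. t \<in> {a..b} \<longrightarrow> (\<exists>d\<ge>c. ((\<lambda>t. st_om (x t) j) has_real_derivative d) (at t))"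
      using der by eventually_elim (use c ab in auto)
  qed (use ab in \<open>auto simp: T_def\<close>)
  have decay: "c * (b - a) \<le> - st_om (x b) j - - st_om (x a) j"
    if ab: "T \<le> a" "a \<le> b" and c: "\<And>t. t \<in> {a..b} \<Longrightarrow> c \<le> - (imbalance j (x t) / M j)" for a b c
  proof -
    have "st_om (x b) j - st_om (x a) j \<le> (- c) * (b - a)"
    proof (rule abs_cont_on_growth_le[OF coord_abs_cont_interval[OF om_coord[OF j]] ab(2)])
      show "AE t in lebesgue. t \<in> {a..b} \<longrightarrow> (\<exists>d\<le>- c. ((\<lambda>t. st_om (x t) j) has_real_derivative d) (at t))"
        using der
      proof eventually_elim
        case (elim t)
        show ?case
        proof
          assume "t \<in> {a..b}"
          then show "\<exists>d\<le>- c. ((\<lambda>t. st_om (x t) j) has_real_derivative d) (at t)"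
            using elim c[of t] ab by (intro exI[of _ "imbalance j (x t) / M j"]) auto
        qed
      qed
    qed (use ab in \<open>auto simp: T_def\<close>)
    then show ?thesis by simp
  qed
  have cc: "coord_cont (\<lambda>y. imbalance j y / M j)" "coord_cont (\<lambda>y. - (imbalance j y / M j))"
    using coord_cont_imbalance[OF j] Mj unfolding coord_cont_def by (auto intro!: tendsto_intros)
  have "((\<lambda>t. imbalance j (x t) / M j) \<longlongrightarrow> 0) at_top"
  proof (rule tendstoI)
    fix e :: real assume e: "e > 0"
    have "eventually (\<lambda>t. imbalance j (x t) / M j < e) at_top"
      by (rule barbalat[OF om_tendsto_0[OF j] observable_uniformly_continuous[OF cc(1)] grow e])
    moreover have "eventually (\<lambda>t. - (imbalance j (x t) / M j) < e) at_top"
      by (rule barbalat[OF tendsto_minus[OF om_tendsto_0[OF j]] observable_uniformly_continuous[OF cc(2)] decay e])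
    ultimately show "eventually (\<lambda>t. dist (imbalance j (x t) / M j) 0 < e) at_top"
      by eventually_elim (simp add: abs_less_iff)
  qed
  then have "((\<lambda>t. imbalance j (x t) / M j * M j) \<longlongrightarrow> 0 * M j) at_top" by (intro tendsto_intros)
  then show ?thesis using Mj by simp
qed

lemma limit_point_equilibrium:
  assumes \<tau>: "filterlim \<tau> at_top sequentially"
    and lim: "\<And>c. c \<in> coords \<Longrightarrow> (\<lambda>n::nat. c (x (\<tau> n))) \<longlonglongrightarrow> c z"
  shows "inQ nN E M pL B dlo dhi wlo whi nd f g z zero_state"
proof (rule inQ_equilibriumI)
  fix j assume j: "j \<in> N"
  have "(\<lambda>n. st_om (x (\<tau> n)) j) \<longlonglongrightarrow> 0" by (rule filterlim_compose[OF om_tendsto_0[OF j] \<tau>])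
  then show "st_om z j = 0" by (rule LIMSEQ_unique[OF lim[OF om_coord[OF j]]])
  have "(\<lambda>n. imbalance j (x (\<tau> n))) \<longlonglongrightarrow> 0" by (rule filterlim_compose[OF imbalance_tendsto_0[OF j] \<tau>])
  moreover have "(\<lambda>n. imbalance j (x (\<tau> n))) \<longlonglongrightarrow> imbalance j z"
    by (rule coord_cont_tendsto[OF coord_cont_imbalance[OF j] lim])
  ultimately show "imbalance j z = 0" by (rule LIMSEQ_unique[rotated])
  fix k assume k: "k < nd j"
  obtain R where R: "\<And>t k. 0 \<le> t \<Longrightarrow> k < nd j \<Longrightarrow> \<bar>xv j (x t) k\<bar> \<le> R"
  proof
    fix t :: real and k assume t: "0 \<le> t" and k: "k < nd j"
    have "\<bar>st_xs (x t) j k - st_xs xstar j k\<bar> \<le> r"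
      using confined[OF t] xs_coord[OF j k] by (force simp: coord_box_def)
    moreover have "\<bar>st_xs xstar j k\<bar> \<le> (\<Sum>k<nd j. \<bar>st_xs xstar j k\<bar>)"
      using k by (intro member_le_sum) auto
    ultimately show "\<bar>xv j (x t) k\<bar> \<le> (\<Sum>k<nd j. \<bar>st_xs xstar j k\<bar>) + r"
      using k by (simp add: xv_apply)
  qed
  show "f j (xv j z) 0 k = 0"
  \<comment> \<open>The supply subsystem at \<open>j\<close> is viewed as driven by the input
    \<open>- \<omega>\<close>, which tends to 0; the frequency is treated as a given function of
    time, so each bus is handled separately.\<close>
  proof (rule asymptotically_autonomous_limit_equilibrium[OF f_lip[OF j], where z = "\<lambda>t. xv j (x t)"
        and u = "\<lambda>t. - st_om (x t) j" and \<tau> = \<tau>])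
    show "((\<lambda>t. - st_om (x t) j) \<longlongrightarrow> 0) at_top" using tendsto_minus[OF om_tendsto_0[OF j]] by simp
    show "(\<lambda>n. xv j (x (\<tau> n)) k) \<longlonglongrightarrow> xv j z k" if "k < nd j" for k
      using lim[OF xs_coord[OF j that]] that by (simp add: xv_apply)
  qed (use \<tau> k R xv_derivative[OF j] compact_invariant[OF j] in auto)
qed

text \<open>Otherwise the solution is far from all equilibria at arbitrarily late times; compactness
  of the box extracts a limit point, which is an equilibrium and is approached along the
  subsequence.\<close>

lemma setdist_equilibria_tendsto_0:
  "((\<lambda>t. setdist_st nN E nd (x t) {y. inQ nN E M pL B dlo dhi wlo whi nd f g y zero_state}) \<longlongrightarrow> 0) at_top"
  (is "((\<lambda>t. ?d t) \<longlongrightarrow> 0) at_top")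
proof (rule tendstoI, rule ccontr)
  fix e :: real assume e: "e > 0" and "\<not> eventually (\<lambda>t. dist (?d t) 0 < e) at_top"
  then have "\<exists>t\<ge>real n. e \<le> dist (?d t) 0" for n
    unfolding eventually_at_top_linorder by (meson not_le)
  then obtain \<tau> where \<tau>: "\<And>n::nat. real n \<le> \<tau> n" "\<And>n. e \<le> dist (?d (\<tau> n)) 0" by metis
  have "0 \<le> \<tau> n" for n using \<tau>(1)[of n] of_nat_0_le_iff[of n] by linarith
  then have "x (\<tau> n) \<in> coord_box xstar r" for n by (rule confined)
  then obtain s z where s: "strict_mono (s :: nat \<Rightarrow> nat)"
    and z: "\<And>c. c \<in> coords \<Longrightarrow> (\<lambda>n. c (x (\<tau> (s n)))) \<longlonglongrightarrow> c z"
    using coord_box_subsequence[of "\<lambda>n. x (\<tau> n)" xstar r] by blast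
  have "filterlim \<tau> at_top sequentially"
    by (rule filterlim_at_top_mono[OF filterlim_real_sequentially]) (use \<tau>(1) in auto)
  then have "filterlim (\<lambda>n. \<tau> (s n)) at_top sequentially"
    by (rule filterlim_compose[OF _ filterlim_subseq[OF s]])
  from limit_point_equilibrium[OF this z]
  have zeq: "z \<in> {y. inQ nN E M pL B dlo dhi wlo whi nd f g y zero_state}" by simp
  have "(\<lambda>n. sdist nN E nd (x (\<tau> (s n))) z) \<longlonglongrightarrow> 0" by (rule sdist_tendsto_0[OF z])
  then have "eventually (\<lambda>n. sdist nN E nd (x (\<tau> (s n))) z < e) sequentially"
    using e by (rule order_tendstoD)
  then obtain n where "sdist nN E nd (x (\<tau> (s n))) z < e"
    by (auto simp: eventually_sequentially)
  then show False using setdist_le_sdist[OF zeq, of "x (\<tau> (s n))"] \<tau>(2)[of "s n"] by simp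
qed

end

context power_network
begin

lemma local_convergence:
  "\<exists>\<delta>>0. \<forall>x :: real \<Rightarrow> state.
     traj_abs_cont nN E nd x \<and>
     (AE t in lebesgue. t \<ge> 0 \<longrightarrow>
        (\<exists>dx. traj_deriv nN E nd x dx t \<and> inQ nN E M pL B dlo dhi wlo whi nd f g (x t) dx)) \<and>
     sdist nN E nd (x 0) xstar < \<delta>
     \<longrightarrow>
     ((\<lambda>t. setdist_st nN E nd (x t)
            {y. inQ nN E M pL B dlo dhi wlo whi nd f g y zero_state}) \<longlongrightarrow> 0) at_top \<and>
     (\<forall>j\<in>buses nN. ((\<lambda>t. st_om (x t) j) \<longlongrightarrow> 0) at_top)"
proof -
  obtain r where r: "good_box r" using good_box_exists by blast
  then have r0: "0 < r" and Wmin: "\<And>y. y \<in> coord_box xstar r \<Longrightarrow> \<exists>c\<in>coords. c y \<noteq> c xstar \<Longrightarrow> energy xstar < energy y"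
    by (auto simp: good_box_def)
  obtain \<delta> where \<delta>: "0 < \<delta>" and stable:
    "\<And>(X :: real \<Rightarrow> state) t. (\<And>c. c \<in> coords \<Longrightarrow> continuous_on {0..} (\<lambda>t. c (X t)))
      \<Longrightarrow> (\<And>T. 0 \<le> T \<Longrightarrow> (\<And>t. t \<in> {0..T} \<Longrightarrow> X t \<in> coord_box xstar r) \<Longrightarrow> energy (X T) \<le> energy (X 0))
      \<Longrightarrow> (\<And>c. c \<in> coords \<Longrightarrow> \<bar>c (X 0) - c xstar\<bar> < \<delta>) \<Longrightarrow> 0 \<le> t \<Longrightarrow> X t \<in> coord_box xstar r"
    using lyapunov_stability[OF coord_cont_energy r0 Wmin] by blast
  show ?thesis
  proof (intro exI[of _ \<delta>] conjI[OF \<delta>] allI impI, elim conjE)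
    fix x :: "real \<Rightarrow> state"
    assume ac: "traj_abs_cont nN E nd x"
      and sol: "AE t in lebesgue. t \<ge> 0 \<longrightarrow>
        (\<exists>dx. traj_deriv nN E nd x dx t \<and> inQ nN E M pL B dlo dhi wlo whi nd f g (x t) dx)"
      and init: "sdist nN E nd (x 0) xstar < \<delta>"
    interpret network_trajectory where x = x by unfold_locales (fact ac sol)+
    have decr: "energy (x T) \<le> energy (x 0)"
      if T: "0 \<le> T" "\<And>t. t \<in> {0..T} \<Longrightarrow> x t \<in> coord_box xstar r" for T
    proof -
      have "0 \<le> (\<Sum>j\<in>N. diss j (x t))" if "t \<in> {0..T}" for t
        using r T(2)[OF that] unfolding good_box_def by (intro sum_nonneg) blast
      then show ?thesis using energy_decay[OF order_refl T(1) T(2), of 0] by simp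
    qed
    have near: "\<bar>c (x 0) - c xstar\<bar> < \<delta>" if "c \<in> coords" for c
      using coord_le_sdist[OF that, of "x 0" xstar] init by simp
    \<comment> \<open>Stability needs decay of the energy only up to times before which the solution
      has stayed in the box, and \<open>energy_decay\<close> gives exactly this, so there is no
      circularity.\<close>
    interpret confined_trajectory where x = x and r = r
      by unfold_locales (rule r, rule stable[of x, OF coord_continuous decr near])
    show "((\<lambda>t. setdist_st nN E nd (x t)
            {y. inQ nN E M pL B dlo dhi wlo whi nd f g y zero_state}) \<longlongrightarrow> 0) at_top \<and>
     (\<forall>j\<in>buses nN. ((\<lambda>t. st_om (x t) j) \<longlongrightarrow> 0) at_top)"
      using setdist_equilibria_tendsto_0 om_tendsto_0 by blast
  qed
qed

end

theorem theorem1: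
  fixes nN :: nat and E :: "(nat \<times> nat) set"
    and M pL :: "nat \<Rightarrow> real" and B :: "nat \<Rightarrow> nat \<Rightarrow> real"
    and dlo dhi wlo whi :: "nat \<Rightarrow> real"
    and nd :: "nat \<Rightarrow> nat"
    and f :: "nat \<Rightarrow> (nat \<Rightarrow> real) \<Rightarrow> real \<Rightarrow> (nat \<Rightarrow> real)"
    and g :: "nat \<Rightarrow> (nat \<Rightarrow> real) \<Rightarrow> real \<Rightarrow> real"
    and xstar :: state
  assumes graph: "network_graph nN E"
    and M_pos: "\<forall>j\<in>buses nN. M j > 0"
    and B_pos: "\<forall>(i,j)\<in>E. B i j > 0"
    and d_bounds: "\<forall>j\<in>buses nN. dlo j \<le> 0 \<and> 0 \<le> dhi j"
    and w_bounds: "\<forall>j\<in>buses nN. wlo j < 0 \<and> 0 < whi j"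
    and f_lip: "\<forall>j\<in>buses nN. lipschitz_f (nd j) (f j)"
    and g_lip: "\<forall>j\<in>buses nN. lipschitz_g (nd j) (g j)"
    and A1i: "\<forall>j\<in>buses nN. \<exists>x0\<in>vspace (nd j). \<forall>k<nd j. f j x0 0 k = 0"
    and A1ii: "\<forall>j\<in>buses nN. \<forall>wb::real. \<forall>C. C \<subseteq> vspace (nd j) \<and> compact C \<and>
                 sub_invariant (nd j) (\<lambda>x. f j x (- wb)) C \<longrightarrow>
                 (\<forall>x\<in>C. sub_equilibrium (nd j) (\<lambda>x. f j x (- wb)) x)"
    and A2: "\<exists>j\<in>buses nN. \<forall>xb\<in>vspace (nd j). \<forall>wb::real.
                 (\<forall>k<nd j. f j xb (- wb) k = 0) \<longrightarrow> wb = 0"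
    and equil: "inQ nN E M pL B dlo dhi wlo whi nd f g xstar zero_state"
    and A3: "\<forall>j\<in>buses nN. \<exists>V DV.
                 loc_isp_with (nd j) (f j) (g j) 0 (trunc (nd j) (st_xs xstar j)) V DV \<and>
                 strict_local_min (nd j) V (trunc (nd j) (st_xs xstar j))"
    and A4: "\<forall>e\<in>E. \<bar>st_eta xstar e\<bar> < pi / 2"
  shows "\<exists>\<delta>>0. \<forall>x :: real \<Rightarrow> state.
           traj_abs_cont nN E nd x \<and>
           (AE t in lebesgue. t \<ge> 0 \<longrightarrow>
              (\<exists>dx. traj_deriv nN E nd x dx t \<and> inQ nN E M pL B dlo dhi wlo whi nd f g (x t) dx)) \<and>
           sdist nN E nd (x 0) xstar < \<delta>
           \<longrightarrow>
           ((\<lambda>t. setdist_st nN E nd (x t)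
                  {y. inQ nN E M pL B dlo dhi wlo whi nd f g y zero_state}) \<longlongrightarrow> 0) at_top \<and>
           (\<forall>j\<in>buses nN. ((\<lambda>t. st_om (x t) j) \<longlongrightarrow> 0) at_top)"
proof -
  \<comment> \<open>(A2) fixes the frequency of one bus; zero angle velocity equates frequencies
    across every edge, and connectedness spreads the value 0 to all buses.\<close>
  obtain j0 where j0: "j0 \<in> buses nN"
    and A2': "\<And>xb wb. xb \<in> vspace (nd j0) \<Longrightarrow> (\<And>k. k < nd j0 \<Longrightarrow> f j0 xb (- wb) k = 0) \<Longrightarrow> wb = 0"
    using A2 by blast
  have om0: "st_om xstar j0 = 0"
  proof (rule A2'[OF trunc_in_vspace[of "nd j0" "st_xs xstar j0"]])
    show "f j0 (trunc (nd j0) (st_xs xstar j0)) (- st_om xstar j0) k = 0" if "k < nd j0" for k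
      using equil j0 that by (auto simp: inQ_def zero_state_def st_xs_def)
  qed
  have edge: "st_om xstar i = st_om xstar j" if "(i, j) \<in> E" for i j
    using equil that by (force simp: inQ_def zero_state_def st_eta_def)
  have om_star: "st_om xstar j = 0" if "j \<in> buses nN" for j
  proof -
    have "(j0, j) \<in> (E \<union> E\<inverse>)\<^sup>*" using graph j0 that by (auto simp: network_graph_def)
    then show ?thesis by induction (use om0 edge in auto)
  qed
  obtain V DV where VDV: "\<And>j. j \<in> buses nN \<Longrightarrow>
      loc_isp_with (nd j) (f j) (g j) 0 (trunc (nd j) (st_xs xstar j)) (V j) (DV j) \<and>
      strict_local_min (nd j) (V j) (trunc (nd j) (st_xs xstar j))"
    using A3 by metis
  interpret power_network nN E M pL B dlo dhi wlo whi nd f g xstar V DV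
  proof
    show "E \<subseteq> buses nN \<times> buses nN" using graph by (simp add: network_graph_def)
    \<comment> \<open>The limiting input of every supply subsystem is 0, so (A1) is taken at zero
      frequency.\<close>
    show "\<forall>x\<in>C. sub_equilibrium (nd j) (\<lambda>x. f j x 0) x"
      if "j \<in> buses nN" "C \<subseteq> vspace (nd j)" "compact C" "sub_invariant (nd j) (\<lambda>x. f j x 0) C" for j C
      using A1ii[rule_format, of j C 0] that by simp
  qed (use M_pos B_pos d_bounds w_bounds f_lip g_lip om_star equil VDV A4 in auto)
  show ?thesis by (rule local_convergence)
qed


end
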